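(* Let $\{\mu_n\}_{n=1}^\infty$ be a sequence of Borel probability measures on $\mathbb{R}^2$, let $\{k_n\}_{n=1}^\infty$ be positive integers with $k_n\to\infty$, and suppose that for each $n\ge1$ there is a probability measure $\nu_n$ on $\mathbb{R}^2$ such that $k_nR_{\mu_n}=R_{\nu_n}$. Define the finite signed measures $\rho_n$ on $\mathbb{R}^2$ by $d\rho_n(s,t)=k_n\frac{st}{\sqrt{1+s^2}\sqrt{1+t^2}}\,d\mu_n(s,t)$. Then the sequence $\nu_n$ converges weakly to a probability law on $\mathbb{R}^2$ if and only if the marginal free convolutions $[\mu_n^{(j)}]^{\boxplus k_n}$ ($j=1,2$) and the signed measures $\rho_n$ converge weakly on $\mathbb{R}$ and $\mathbb{R}^2$, respectively. Furthermore, if $\nu_n\Rightarrow\nu$, $[\mu_n^{(j)}]^{\boxplus k_n}\Rightarrow\nu_\boxplus^{\gamma_j,\sigma_j}$ ($j=1,2$), and $\rho_n\Rightarrow\rho$, then the marginal laws of $\nu$ are $\nu^{(j)}=\nu_\boxplus^{\gamma_j,\sigma_j}$ for $j=1,2$, and $$G_\nu(z,w)\left[1-G_{\sqrt{1+s^2}\sqrt{1+t^2}\,d\rho}\left(1/G_{\nu^{(1)}}(z),\,1/G_{\nu^{(2)}}(w)\right)\right]=G_{\nu^{(1)}}(z)\,G_{\nu^{(2)}}(w)$$ for $(z,w)\in(\mathbb{C}\setminus\mathbb{R})^2$.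
   Context: For a Borel (signed) measure $\mu$ on $\mathbb{R}^2$ whose total variation is finite on compact sets and satisfies $\int\frac{1}{\sqrt{1+s^2}\sqrt{1+t^2}}\,d|\mu|(s,t)<\infty$, its Cauchy transform is $G_\mu(z,w)=\int_{\mathbb{R}^2}\frac{1}{(z-s)(w-t)}\,d\mu(s,t)$ for $z,w\in\mathbb{C}\setminus\mathbb{R}$; in particular $G_{\sqrt{1+s^2}\sqrt{1+t^2}\,d\rho}(z,w)=\int_{\mathbb{R}^2}\frac{\sqrt{1+s^2}\sqrt{1+t^2}}{(z-s)(w-t)}\,d\rho(s,t)$. The marginals of $\mu$ are $\mu^{(j)}=\mu\circ\pi_j^{-1}$, $j=1,2$, where $\pi_1(s,t)=s$, $\pi_2(s,t)=t$. For a probability measure $m$ on $\mathbb{R}$, $G_m(z)=\int_{\mathbb{R}}\frac{1}{z-x}\,dm(x)$, $z\notin\mathbb{R}$. For $\alpha,\beta>0$ the Stolz angle is $\Delta=\Delta_{\alpha,\beta}=\{x+iy\in\mathbb{C}: y<0,\ |x|<-\alpha y,\ y>-\beta\}$, $\overline{\Delta}=\{\bar z:z\in\Delta\}$ is its reflection, and the associated product domain is $\Omega=(\Delta\cup\overline\Delta)\times(\Delta\cup\overline\Delta)$. The one-dimensional $R$-transform $R_m$ of a probability measure $m$ on $\mathbb{R}$ is the holomorphic function on $\Delta\cup\overline\Delta$ (for a sufficiently small Stolz angle $\Delta$) with $1/z+R_m(z)\notin\mathbb{R}$, $G_m(1/z+R_m(z))=z$, and $zR_m(z)\to0$ as $z\to0$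 in $\Delta\cup\overline\Delta$. The bi-free partial $R$-transform of a probability measure $\mu$ on $\mathbb{R}^2$ is $$R_\mu(z,w)=zR_{\mu^{(1)}}(z)+wR_{\mu^{(2)}}(w)+\left[1-\frac{1}{h_\mu(z,w)}\right],\quad h_\mu(z,w)=\frac{G_\mu\left(1/z+R_{\mu^{(1)}}(z),\,1/w+R_{\mu^{(2)}}(w)\right)}{zw},$$ which is defined and holomorphic on a product domain $\Omega$ (with $\Delta$ small enough) on which $R_{\mu^{(1)}},R_{\mu^{(2)}}$ are defined and $h_\mu$ has no zeros. The identity $k_nR_{\mu_n}=R_{\nu_n}$ is understood on a product domain where both sides are defined. $\boxplus$ denotes free additive convolution of probability measures on $\mathbb{R}$ and $m^{\boxplus k}$ the $k$-fold free convolution of $m$ with itself. For $\gamma\in\mathbb{R}$ and $\sigma$ a finite positive Borel measure on $\mathbb{R}$, $\nu_\boxplus^{\gamma,\sigma}$ is the unique $\boxplus$-infinitely divisible law on $\mathbb{R}$ with $R_{\nu_\boxplus^{\gamma,\sigma}}(z)=\gamma+\int_{\mathbb{R}}\frac{z+x}{1-zx}\,d\sigma(x)$, $z\notin\mathbb{R}$. Weak convergence, written $\Rightarrow$, of finite (signed) Borel measures is convergence against bounded continuous functions; weak convergence of the $[\mu_n^{(j)}]^{\boxplus k_n}$ means weak convergence to a probability measure on $\mathbb{R}$, and weak convergence of $\rho_n$ means weak convergence to a finite signed measure on $\mathbb{R}^2$. *)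

theory Defs
  imports "HOL-Probability.Probability" "HOL-Complex_Analysis.Complex_Analysis"
begin

section \<open>Borel probability measures and weak convergence\<close>

definition borel_prob :: "'a::topological_space measure \<Rightarrow> bool" where
  "borel_prob M \<longleftrightarrow> prob_space M \<and> sets M = sets borel"

text \<open>The limit is required to be a probability measure.\<close>

definition weak_conv_prob ::
  "(nat \<Rightarrow> 'a::topological_space measure) \<Rightarrow> 'a measure \<Rightarrow> bool" where
  "weak_conv_prob Ms M \<longleftrightarrow> borel_prob M \<and>
     (\<forall>f::'a \<Rightarrow> real. continuous_on UNIV f \<and> bounded (range f) \<longrightarrow>
        (\<lambda>n. \<integral>x. f x \<partial>Ms n) \<longlonglongrightarrow> (\<integral>x. f x \<partial>M))"

definition marginal1 :: "(real \<times> real) measure \<Rightarrow> real measure" where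
  "marginal1 \<mu> = distr \<mu> borel fst"

definition marginal2 :: "(real \<times> real) measure \<Rightarrow> real measure" where
  "marginal2 \<mu> = distr \<mu> borel snd"


section \<open>Finite signed Borel measures\<close>

text \<open>A finite signed Borel measure is a real-valued set function that is countably additive on
  the Borel sets; its values on other sets are irrelevant.\<close>

definition finite_signed_measure :: "('a::topological_space set \<Rightarrow> real) \<Rightarrow> bool" where
  "finite_signed_measure \<rho> \<longleftrightarrow> \<rho> {} = 0 \<and>
     (\<forall>A::nat \<Rightarrow> 'a set. range A \<subseteq> sets borel \<and> disjoint_family A \<longrightarrow>
        (\<lambda>i. \<rho> (A i)) sums \<rho> (\<Union>i. A i))"

text \<open>The two parts of the Jordan decomposition. Since \<open>ennreal\<close> sends negative reals to 0 and
  the empty set is admitted, the supremum is that of \<open>\<rho> B\<close> over the Borel subsets \<open>B\<close> of \<open>A\<close>.\<close>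

definition pos_variation :: "('a::topological_space set \<Rightarrow> real) \<Rightarrow> 'a measure" where
  "pos_variation \<rho> =
     measure_of UNIV (sets borel) (\<lambda>A. SUP B\<in>{B \<in> sets borel. B \<subseteq> A}. ennreal (\<rho> B))"

definition neg_variation :: "('a::topological_space set \<Rightarrow> real) \<Rightarrow> 'a measure" where
  "neg_variation \<rho> = pos_variation (\<lambda>A. - \<rho> A)"

definition signed_integral ::
  "('a::topological_space set \<Rightarrow> real) \<Rightarrow> ('a \<Rightarrow> 'b::{banach, second_countable_topology}) \<Rightarrow> 'b"
  where
  "signed_integral \<rho> f = (\<integral>x. f x \<partial>pos_variation \<rho>) - (\<integral>x. f x \<partial>neg_variation \<rho>)"

definition weak_conv_signed ::
  "(nat \<Rightarrow> 'a::topological_space set \<Rightarrow> real) \<Rightarrow> ('a set \<Rightarrow> real) \<Rightarrow> bool" where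
  "weak_conv_signed \<rho>s \<rho> \<longleftrightarrow> finite_signed_measure \<rho> \<and>
     (\<forall>f::'a \<Rightarrow> real. continuous_on UNIV f \<and> bounded (range f) \<longrightarrow>
        (\<lambda>n. signed_integral (\<rho>s n) f) \<longlonglongrightarrow> signed_integral \<rho> f)"

definition rho_measure :: "nat \<Rightarrow> (real \<times> real) measure \<Rightarrow> (real \<times> real) set \<Rightarrow> real" where
  "rho_measure k \<mu> A =
     (LINT x:A|\<mu>. (case x of (s, t) \<Rightarrow> real k * (s * t / (sqrt (1 + s\<^sup>2) * sqrt (1 + t\<^sup>2)))))"


section \<open>Cauchy transforms\<close>

definition cauchy :: "real measure \<Rightarrow> complex \<Rightarrow> complex" where
  "cauchy m z = (\<integral>x. 1 / (z - complex_of_real x) \<partial>m)"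

definition cauchy2 :: "(real \<times> real) measure \<Rightarrow> complex \<Rightarrow> complex \<Rightarrow> complex" where
  "cauchy2 \<mu> z w =
     (\<integral>x. (case x of (s, t) \<Rightarrow> 1 / ((z - complex_of_real s) * (w - complex_of_real t))) \<partial>\<mu>)"

text \<open>The Cauchy transform of the signed measure with density
  \<open>sqrt (1 + s\<^sup>2) * sqrt (1 + t\<^sup>2)\<close> with respect to the finite signed measure \<open>\<rho>\<close>. This measure
  may have infinite total variation, so it is not itself a finite signed measure in general.\<close>

definition cauchy2_weighted :: "((real \<times> real) set \<Rightarrow> real) \<Rightarrow> complex \<Rightarrow> complex \<Rightarrow> complex" where
  "cauchy2_weighted \<rho> z w = signed_integral \<rho>
     (\<lambda>(s, t). complex_of_real (sqrt (1 + s\<^sup>2) * sqrt (1 + t\<^sup>2)) /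
        ((z - complex_of_real s) * (w - complex_of_real t)))"


section \<open>The R-transform\<close>

definition stolz :: "real \<Rightarrow> real \<Rightarrow> complex set" where
  "stolz \<alpha> \<beta> = {z. Im z < 0 \<and> \<bar>Re z\<bar> < - \<alpha> * Im z \<and> Im z > - \<beta>}"

definition stolz_pair :: "real \<Rightarrow> real \<Rightarrow> complex set" where
  "stolz_pair \<alpha> \<beta> = stolz \<alpha> \<beta> \<union> cnj ` stolz \<alpha> \<beta>"

definition is_R_transform ::
  "real measure \<Rightarrow> real \<Rightarrow> real \<Rightarrow> (complex \<Rightarrow> complex) \<Rightarrow> bool" where
  "is_R_transform m \<alpha> \<beta> R \<longleftrightarrow> \<alpha> > 0 \<and> \<beta> > 0 \<and>
     R holomorphic_on stolz_pair \<alpha> \<beta> \<and>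
     (\<forall>z\<in>stolz_pair \<alpha> \<beta>. 1 / z + R z \<notin> \<real> \<and> cauchy m (1 / z + R z) = z) \<and>
     ((\<lambda>z. z * R z) \<longlongrightarrow> 0) (at 0 within stolz_pair \<alpha> \<beta>)"

definition R_defined :: "real measure \<Rightarrow> real \<Rightarrow> real \<Rightarrow> bool" where
  "R_defined m \<alpha> \<beta> \<longleftrightarrow> (\<exists>R. is_R_transform m \<alpha> \<beta> R)"

text \<open>On each Stolz angle there is at most one R-transform, and those on two Stolz angles agree on
  the intersection, which is again a Stolz angle. Hence the value at \<open>z\<close> does not depend on the
  Stolz angle chosen.\<close>

definition R_transform :: "real measure \<Rightarrow> complex \<Rightarrow> complex" where
  "R_transform m z =
     (THE u. \<exists>\<alpha> \<beta> R. is_R_transform m \<alpha> \<beta> R \<and> z \<in> stolz_pair \<alpha> \<beta> \<and> u = R z)"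


section \<open>The bi-free partial R-transform\<close>

definition h_fun :: "(real \<times> real) measure \<Rightarrow> complex \<Rightarrow> complex \<Rightarrow> complex" where
  "h_fun \<mu> z w =
     cauchy2 \<mu> (1 / z + R_transform (marginal1 \<mu>) z) (1 / w + R_transform (marginal2 \<mu>) w) / (z * w)"

definition bifree_R :: "(real \<times> real) measure \<Rightarrow> complex \<Rightarrow> complex \<Rightarrow> complex" where
  "bifree_R \<mu> z w =
     z * R_transform (marginal1 \<mu>) z + w * R_transform (marginal2 \<mu>) w + (1 - 1 / h_fun \<mu> z w)"

definition bifree_R_defined :: "(real \<times> real) measure \<Rightarrow> real \<Rightarrow> real \<Rightarrow> bool" where
  "bifree_R_defined \<mu> \<alpha> \<beta> \<longleftrightarrow>
     R_defined (marginal1 \<mu>) \<alpha> \<beta> \<and> R_defined (marginal2 \<mu>) \<alpha> \<beta> \<and>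
     (\<forall>z\<in>stolz_pair \<alpha> \<beta>. \<forall>w\<in>stolz_pair \<alpha> \<beta>. h_fun \<mu> z w \<noteq> 0)"


section \<open>Free additive convolution\<close>

text \<open>The free convolution of finitely many probability measures is the probability measure whose
  R-transform is, on some Stolz angle, the sum of theirs.\<close>

definition free_conv_list :: "real measure list \<Rightarrow> real measure" where
  "free_conv_list ms = (THE M. borel_prob M \<and>
     (\<exists>\<alpha> \<beta>. R_defined M \<alpha> \<beta> \<and> (\<forall>m\<in>set ms. R_defined m \<alpha> \<beta>) \<and>
        (\<forall>z\<in>stolz_pair \<alpha> \<beta>. R_transform M z = (\<Sum>m\<leftarrow>ms. R_transform m z))))"

definition free_conv_power :: "real measure \<Rightarrow> nat \<Rightarrow> real measure" where
  "free_conv_power m k = free_conv_list (replicate k m)"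

definition free_infinitely_divisible :: "real measure \<Rightarrow> bool" where
  "free_infinitely_divisible M \<longleftrightarrow> borel_prob M \<and>
     (\<forall>n\<ge>1. \<exists>m. borel_prob m \<and> free_conv_power m n = M)"

definition nu_boxplus :: "real \<Rightarrow> real measure \<Rightarrow> real measure" where
  "nu_boxplus \<gamma> \<sigma> = (THE M. free_infinitely_divisible M \<and>
     (\<exists>\<alpha> \<beta>. R_defined M \<alpha> \<beta> \<and>
        (\<forall>z\<in>stolz_pair \<alpha> \<beta>. R_transform M z =
           complex_of_real \<gamma> + (\<integral>x. (z + complex_of_real x) / (1 - z * complex_of_real x) \<partial>\<sigma>))))"

end

theory Submission
  imports Defs
begin

text \<open>Write \<open>G\<close> for Cauchy transforms and \<open>F = 1 / G\<close>. Letting \<open>w\<close> tend to 0 in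
  \<open>k R\<^sub>\<mu>(z, w) = R\<^sub>\<nu>(z, w)\<close> shows that the marginals of \<open>\<nu>\<close> are the \<open>k\<close>-th free convolution powers of
  those of \<open>\<mu>\<close>. Hence the subordination functions are explicit, \<open>\<omega>\<^sub>j(z) = z / k + (1 - 1 / k) F\<^sub>j(z)\<close>
  with \<open>F\<^sub>j\<close> belonging to the marginals of \<open>\<nu>\<close>, and they map each half-plane into itself. By analytic
  continuation the identity of R-transforms becomes an identity between \<open>G\<^sub>\<nu>(z, w)\<close> and
  \<open>G\<^sub>\<mu>(\<omega>\<^sub>1(z), \<omega>\<^sub>2(w))\<close> valid for all nonreal \<open>z\<close>, \<open>w\<close>. Since \<open>1 / (a - s)\<close> is
  \<open>(1 + s / (a - s)) / a\<close>, the difference between \<open>G\<^sub>\<mu>\<close> and the product of the transforms of its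
  marginals is, up to terms of order \<open>1 / k\<^sup>2\<close>, the weighted transform of \<open>\<rho>\<close> divided by \<open>k a b\<close>, and in
  the limit \<open>G\<^sub>\<nu> (1 - G\<^sub>\<rho>(F\<^sub>1, F\<^sub>2)) = G\<^sub>1 G\<^sub>2\<close>.

  Convergence of the marginals makes the measures \<open>k s\<^sup>2 / (1 + s\<^sup>2) d\<mu>\<close> and \<open>k t\<^sup>2 / (1 + t\<^sup>2) d\<mu>\<close>
  bounded and tight, hence, by the inequality of the arithmetic and geometric means, also \<open>\<bar>\<rho>\<bar>\<close>. Both
  implications then follow from weak compactness, because the limit equation determines each of
  \<open>G\<^sub>\<nu>\<close> and \<open>G\<^sub>\<rho>\<close> by the other, and these transforms determine the measures.\<close>

section \<open>Cauchy transforms\<close>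

text \<open>The hypothesis lives on Stolz angles that may shrink with \<open>n\<close>, while limits
  are taken at fixed points; so the identity of R-transforms is first cleared of denominators and
  continued, one variable at a time and in each half-plane separately.

  The subordinated points still move with \<open>n\<close>, but weak convergence of the signed
  measures concerns fixed test functions. The bridge is a bound on the total variations: the
  weighted kernel depends on its poles in a way controlled uniformly over the plane, so the poles
  may be moved to their limits.

  The product of the two factors in the limit equation converges before either factor is known to.
  Its limit is nonzero and both factors are bounded, so convergence of one factor forces a nonzero
  limit and yields the other.

  Compactness is available for positive measures only. It is applied to the two Jordan parts, whose
  limits \<open>P\<close>, \<open>N\<close> need not be mutually singular; only the difference is
  determined, and an equality of differences is read as \<open>P + N' = P' + N\<close>. Its
  transform is known only at values of the functions \<open>F\<close>, an open set of poles meeting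
  both half-planes, which again suffices by continuation.\<close>

lemma borel_measurable_sets_eq: "sets M = sets borel \<Longrightarrow> f \<in> borel_measurable borel \<Longrightarrow> f \<in> borel_measurable M"
  by (simp cong: measurable_cong_sets)

definition weight :: "real \<Rightarrow> real" where "weight x = sqrt (1 + x\<^sup>2)"

lemma weight_measurable [measurable]: "weight \<in> borel_measurable borel"
  unfolding weight_def by measurable

lemma weight_pos: "weight x > 0"
  unfolding weight_def by (simp add: add_pos_nonneg)

lemma weight_ge_1: "weight x \<ge> 1"
  unfolding weight_def by simp

lemma weight_sq: "(weight x)\<^sup>2 = 1 + x\<^sup>2"
  unfolding weight_def by (simp add: add_nonneg_nonneg)

lemma weight_le: "weight x \<le> 1 + \<bar>x\<bar>"
  unfolding weight_def by (rule real_le_lsqrt) (auto simp: power2_eq_square algebra_simps)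

lemma abs_le_weight: "\<bar>x\<bar> \<le> weight x"
  unfolding weight_def by (rule real_le_rsqrt) auto

lemma continuous_weight: "continuous_on UNIV weight"
  unfolding weight_def by (intro continuous_intros)

text \<open>Comes from \<open>weight x \<le> 1 + \<bar>x\<bar> \<le> 1 + norm z + norm (z -
  x)\<close> and \<open>norm (z - x) \<ge> \<bar>Im z\<bar>\<close>: a bound for
  \<open>weight x / norm (z - x)\<close> that does not depend on the real point
  \<open>x\<close>.\<close>

definition kernel_bound :: "complex \<Rightarrow> real" where "kernel_bound z = 1 + (1 + norm z) / \<bar>Im z\<bar>"

lemma Im_le_norm_diff: "\<bar>Im z\<bar> \<le> norm (z - complex_of_real x)"
  using abs_Im_le_cmod[of "z - of_real x"] by simp

lemma nonreal_diff: "Im z \<noteq> 0 \<Longrightarrow> z - complex_of_real x \<noteq> 0"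
  by (auto simp: complex_eq_iff)

lemma kernel_bound_ge_1: "kernel_bound z \<ge> 1"
  unfolding kernel_bound_def by simp

lemma weight_kernel_le:
  assumes "Im z \<noteq> 0"
  shows "weight x / norm (z - complex_of_real x) \<le> kernel_bound z"
proof -
  let ?d = "norm (z - complex_of_real x)"
  have d: "?d \<ge> \<bar>Im z\<bar>" "\<bar>Im z\<bar> > 0" using Im_le_norm_diff assms by auto
  have "\<bar>x\<bar> \<le> norm z + ?d"
    using norm_triangle_ineq4[of z "z - complex_of_real x"] by simp
  hence "weight x \<le> (1 + norm z) + ?d" using weight_le[of x] by linarith
  hence "weight x / ?d \<le> ((1 + norm z) + ?d) / ?d" using d by (intro divide_right_mono) auto
  also have "\<dots> = 1 + (1 + norm z) / ?d"
  proof -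
    have *: "D > 0 \<Longrightarrow> ((1 + norm z) + D) / D = 1 + (1 + norm z) / D" for D :: real
      by (simp add: field_simps)
    show ?thesis by (rule *) (use d in linarith)
  qed
  also have "(1 + norm z) / ?d \<le> (1 + norm z) / \<bar>Im z\<bar>"
    using d by (intro divide_left_mono mult_pos_pos) (auto simp: add_nonneg_nonneg)
  finally show ?thesis unfolding kernel_bound_def by simp
qed

lemma kernel_le:
  assumes "Im z \<noteq> 0"
  shows "norm (1 / (z - complex_of_real x)) \<le> 1 / \<bar>Im z\<bar>"
  using Im_le_norm_diff[of z x] assms by (simp add: norm_divide frac_le)

text \<open>The numerator may grow like \<open>weight\<close> instead of being bounded, so that both
  the plain Cauchy kernel and the kernel with the density absorbed into it are covered.\<close>

lemma kernel_integrable: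
  fixes X :: "'a \<Rightarrow> real" and c :: "'a \<Rightarrow> complex"
  assumes "finite_measure M" and [measurable]: "X \<in> borel_measurable M" "c \<in> borel_measurable M"
    and c: "\<And>x. norm (c x) \<le> B * weight (X x)" and z: "Im z \<noteq> 0"
  shows "integrable M (\<lambda>x. c x / (z - complex_of_real (X x)))"
    and "norm (c x / (z - complex_of_real (X x))) \<le> B * kernel_bound z"
proof -
  interpret finite_measure M by fact
  \<comment> \<open>The bound on \<open>c\<close> at any single point forces \<open>B\<close> to be
    nonnegative; \<open>undefined\<close> serves as that point.\<close>
  have B: "B \<ge> 0" using c[of undefined] weight_pos[of "X undefined"]
    by (smt (verit) norm_ge_zero zero_le_mult_iff)
  have *: "norm (c x / (z - complex_of_real (X x))) \<le> B * kernel_bound z" for x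
  proof -
    have "norm (c x / (z - complex_of_real (X x))) \<le> B * weight (X x) / norm (z - complex_of_real (X x))"
      unfolding norm_divide using c by (intro divide_right_mono) auto
    also have "\<dots> = B * (weight (X x) / norm (z - complex_of_real (X x)))" by simp
    also have "\<dots> \<le> B * kernel_bound z" using weight_kernel_le[OF z] B by (intro mult_left_mono) auto
    finally show ?thesis .
  qed
  show "norm (c x / (z - complex_of_real (X x))) \<le> B * kernel_bound z" by (rule *)
  show "integrable M (\<lambda>x. c x / (z - complex_of_real (X x)))"
    by (rule integrable_const_bound[where B="B * kernel_bound z"]) (use * in auto)
qed

text \<open>Differentiation under the integral sign. The difference quotient is exactly an integral
  of \<open>- c x / (z0 - X x)\<close> times \<open>1 / (z - X x)\<close>, so only the factor with
  the moving pole needs a dominating constant.\<close>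

lemma kernel_holomorphic:
  fixes X :: "'a \<Rightarrow> real" and c :: "'a \<Rightarrow> complex"
  assumes fin: "finite_measure M"
    and [measurable]: "X \<in> borel_measurable M" "c \<in> borel_measurable M"
    and c: "\<And>x. norm (c x) \<le> B * weight (X x)"
  shows "(\<lambda>z. \<integral>x. c x / (z - complex_of_real (X x)) \<partial>M) holomorphic_on {z. Im z \<noteq> 0}"
    (is "?f holomorphic_on ?U")
proof -
  interpret finite_measure M by fact
  note int = kernel_integrable[OF fin assms(2,3) c]
  have op: "open {z. \<bar>Im z\<bar> > e}" for e
    by (intro open_Collect_less continuous_intros)
  have "\<exists>D. (?f has_field_derivative D) (at z0)" if z0: "Im z0 \<noteq> 0" for z0
  proof -
    \<comment> \<open>Halving the imaginary part gives an open set around \<open>z0\<close> on which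
      \<open>norm (1 / (z - X x))\<close> is at most \<open>2 / \<bar>Im z0\<bar>\<close>.\<close>
    define V where "V = {z. \<bar>Im z\<bar> > \<bar>Im z0\<bar> / 2}"
    have V: "open V" "z0 \<in> V" using z0 by (simp_all only: V_def op mem_Collect_eq)
    let ?D = "\<integral>x. - (c x / (z0 - X x) * (1 / (z0 - X x))) \<partial>M"
    have "((\<lambda>z. (?f z - ?f z0) / (z - z0)) \<longlongrightarrow> ?D) (at z0 within V)"
      unfolding tendsto_at_iff_sequentially
    proof (intro allI impI)
      fix S assume S: "\<forall>i. S i \<in> V - {z0}" "S \<longlonglongrightarrow> z0"
      have SI: "\<bar>Im (S i)\<bar> > \<bar>Im z0\<bar> / 2" "S i \<noteq> z0" "Im (S i) \<noteq> 0" for i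
        using S(1)[rule_format, of i] by (auto simp: V_def)
      have "(\<lambda>i. \<integral>x. - (c x / (z0 - X x) * (1 / (S i - X x))) \<partial>M) \<longlonglongrightarrow> ?D"
      proof (rule integral_dominated_convergence[where w="\<lambda>x. B * kernel_bound z0 * (2 / \<bar>Im z0\<bar>)"])
        show "AE x in M. (\<lambda>i. - (c x / (z0 - X x) * (1 / (S i - X x))))
            \<longlonglongrightarrow> - (c x / (z0 - X x) * (1 / (z0 - X x)))"
          by (intro AE_I2 tendsto_intros S(2) nonreal_diff z0)
        show "AE x in M. norm (- (c x / (z0 - X x) * (1 / (S i - X x)))) \<le> B * kernel_bound z0 * (2 / \<bar>Im z0\<bar>)" for i
        proof (rule AE_I2)
          fix x
          have "norm (1 / (S i - X x)) \<le> 1 / \<bar>Im (S i)\<bar>" by (rule kernel_le) (rule SI)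
          also have "\<dots> \<le> 2 / \<bar>Im z0\<bar>" using SI[of i] z0 by (simp add: field_simps)
          finally show "norm (- (c x / (z0 - X x) * (1 / (S i - X x)))) \<le> B * kernel_bound z0 * (2 / \<bar>Im z0\<bar>)"
            unfolding norm_minus_cancel norm_mult
            using int(2)[OF z0, of x] by (intro mult_mono) (auto intro: order_trans[OF norm_ge_zero])
        qed
      qed auto
      moreover have "(?f (S i) - ?f z0) / (S i - z0) = (\<integral>x. - (c x / (z0 - X x) * (1 / (S i - X x))) \<partial>M)" for i
      proof -
        have "?f (S i) - ?f z0 = (\<integral>x. c x / (S i - X x) - c x / (z0 - X x) \<partial>M)"
          by (rule Bochner_Integration.integral_diff[symmetric]) (intro int SI z0)+
        also have "\<dots> = (\<integral>x. - (c x / (z0 - X x) * (1 / (S i - X x))) * (S i - z0) \<partial>M)"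
        proof (rule Bochner_Integration.integral_cong[OF refl])
          fix x
          show "c x / (S i - X x) - c x / (z0 - X x) = - (c x / (z0 - X x) * (1 / (S i - X x))) * (S i - z0)"
            using nonreal_diff[OF z0, of "X x"] nonreal_diff[OF SI(3)[of i], of "X x"]
            by (simp add: divide_simps) (simp add: algebra_simps)
        qed
        also have "\<dots> = (\<integral>x. - (c x / (z0 - X x) * (1 / (S i - X x))) \<partial>M) * (S i - z0)"
          by (rule integral_mult_left_zero)
        finally show ?thesis using SI(2)[of i] by simp
      qed
      ultimately show "((\<lambda>z. (?f z - ?f z0) / (z - z0)) \<circ> S) \<longlonglongrightarrow> ?D"
        by (simp add: o_def)
    qed
    hence "(?f has_field_derivative ?D) (at z0)"
      unfolding has_field_derivative_iff using at_within_open[OF V(2,1)] by simp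
    thus ?thesis by blast
  qed
  moreover have "open ?U" using op[of 0] by simp
  ultimately show ?thesis by (auto simp: holomorphic_on_open)
qed

lemma Im_kernel: "Im (1 / (z - complex_of_real x)) = - Im z / (norm (z - complex_of_real x))\<^sup>2"
  by (simp add: Im_divide cmod_power2)

lemma cauchy_kernel_cnj:
  "(\<integral>x. 1 / (cnj z - complex_of_real (X x)) \<partial>M) = cnj (\<integral>x. 1 / (z - complex_of_real (X x)) \<partial>M)"
proof -
  have "cnj (\<integral>x. 1 / (z - complex_of_real (X x)) \<partial>M) = (\<integral>x. cnj (1 / (z - complex_of_real (X x))) \<partial>M)"
    by (rule Bochner_Integration.integral_cnj[symmetric])
  thus ?thesis by simp
qed

lemma cauchy_cnj: "cauchy m (cnj z) = cnj (cauchy m z)"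
  unfolding cauchy_def by (rule cauchy_kernel_cnj)

lemma borel_prob_finite: "borel_prob m \<Longrightarrow> finite_measure m"
  by (simp add: borel_prob_def prob_space_def)

lemma borel_prob_id_measurable: "borel_prob m \<Longrightarrow> (\<lambda>x. x) \<in> borel_measurable m"
  by (simp add: borel_prob_def measurable_ident_sets)

lemma cauchy_integrable:
  assumes "borel_prob m" "Im z \<noteq> 0"
  shows "integrable m (\<lambda>x. 1 / (z - complex_of_real x))"
  using kernel_integrable(1)[OF borel_prob_finite[OF assms(1)] borel_prob_id_measurable[OF assms(1)],
      of "\<lambda>_. 1" 1 z] weight_ge_1 assms(2) by simp

lemma cauchy_holomorphic:
  assumes "borel_prob m"
  shows "cauchy m holomorphic_on {z. Im z \<noteq> 0}"
  using kernel_holomorphic[OF borel_prob_finite[OF assms(1)] borel_prob_id_measurable[OF assms(1)],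
      of "\<lambda>_. 1" 1] weight_ge_1 unfolding cauchy_def by simp

text \<open>Jensen's inequality for the function \<open>\<bar>1 / (z - x)\<bar>\<^sup>2\<close>.\<close>

lemma cauchy_Im_le:
  assumes m: "borel_prob m" and z: "Im z > 0"
  shows "Im (cauchy m z) \<le> - Im z * (norm (cauchy m z))\<^sup>2" and "Im (cauchy m z) < 0"
proof -
  interpret prob_space m using m by (simp add: borel_prob_def)
  have sm: "sets m = sets borel" using m by (simp add: borel_prob_def)
  have z0: "Im z \<noteq> 0" using z by simp
  let ?g = "\<lambda>x. norm (1 / (z - complex_of_real x))"
  note int = cauchy_integrable[OF m z0]
  have b: "?g x \<le> 1 / \<bar>Im z\<bar>" for x by (rule kernel_le[OF z0])
  have i2: "integrable m (\<lambda>x. (?g x)\<^sup>2)"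
  proof (rule integrable_const_bound[where B="(1 / \<bar>Im z\<bar>)\<^sup>2"])
    show "AE x in m. norm ((?g x)\<^sup>2) \<le> (1 / \<bar>Im z\<bar>)\<^sup>2"
      using b by (intro AE_I2) (metis abs_norm_cancel norm_ge_zero norm_power power_mono real_norm_def)
  qed (rule borel_measurable_sets_eq[OF sm], measurable)
  have "Im (cauchy m z) = (\<integral>x. Im (1 / (z - complex_of_real x)) \<partial>m)"
    unfolding cauchy_def by (rule integral_Im[symmetric, OF int])
  also have "\<dots> = (\<integral>x. - Im z * (?g x)\<^sup>2 \<partial>m)"
    by (rule Bochner_Integration.integral_cong) (auto simp: Im_kernel norm_divide power_divide)
  also have "\<dots> = - Im z * (\<integral>x. (?g x)\<^sup>2 \<partial>m)" by simp
  finally have eq: "Im (cauchy m z) = - Im z * (\<integral>x. (?g x)\<^sup>2 \<partial>m)" .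
  have "norm (cauchy m z) \<le> (\<integral>x. ?g x \<partial>m)" unfolding cauchy_def by (rule integral_norm_bound)
  hence "(norm (cauchy m z))\<^sup>2 \<le> (\<integral>x. ?g x \<partial>m)\<^sup>2" by (intro power_mono) auto
  also have "\<dots> \<le> (\<integral>x. (?g x)\<^sup>2 \<partial>m)"
    using variance_eq[OF integrable_norm[OF int] i2] variance_positive[of ?g] by linarith
  finally show "Im (cauchy m z) \<le> - Im z * (norm (cauchy m z))\<^sup>2"
    using eq z by simp
  have "(\<integral>x. - (?g x)\<^sup>2 \<partial>m) < 0"
    using nonreal_diff[OF z0] by (intro expectation_less integrable_minus i2 AE_I2) auto
  hence "(\<integral>x. (?g x)\<^sup>2 \<partial>m) > 0" by simp
  thus "Im (cauchy m z) < 0" using eq z by (simp add: mult_pos_pos)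
qed

lemma cauchy_Im_pos:
  assumes m: "borel_prob m" and z: "Im z < 0"
  shows "Im (cauchy m z) > 0"
  using cauchy_Im_le(2)[OF m, of "cnj z"] z by (simp add: cauchy_cnj)

lemma cauchy_nonzero:
  assumes m: "borel_prob m" and z: "Im z \<noteq> 0"
  shows "cauchy m z \<noteq> 0"
  using cauchy_Im_le(2)[OF m, of z] cauchy_Im_pos[OF m, of z] z
  by (metis less_irrefl linorder_neqE_linordered_idom zero_complex.simps(2))

text \<open>Since \<open>Im (1 / G)\<close> is \<open>- Im G\<close> divided by the square of
  \<open>norm G\<close>, this is the Jensen bound after division: \<open>1 / G\<close> moves points
  away from the real axis. It is what keeps the subordinated points nonreal, with a margin
  independent of \<open>n\<close>.\<close>

lemma Im_recip_cauchy:
  assumes m: "borel_prob m" and z: "Im z > 0"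
  shows "Im (1 / cauchy m z) \<ge> Im z"
proof -
  let ?G = "cauchy m z"
  have "?G \<noteq> 0" using cauchy_nonzero[OF m] z by simp
  hence p: "(norm ?G)\<^sup>2 > 0" by simp
  have "Im (1 / ?G) = - Im ?G / (norm ?G)\<^sup>2" by (simp add: Im_divide cmod_power2)
  also have "\<dots> \<ge> (Im z * (norm ?G)\<^sup>2) / (norm ?G)\<^sup>2"
    using cauchy_Im_le(1)[OF m z] p by (intro divide_right_mono) auto
  finally show ?thesis using p by simp
qed

lemma Im_recip_cauchy_neg:
  assumes m: "borel_prob m" and z: "Im z < 0"
  shows "Im (1 / cauchy m z) \<le> Im z"
  using Im_recip_cauchy[OF m, of "cnj z"] z by (simp add: cauchy_cnj flip: complex_cnj_divide)
     (simp add: Im_divide)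

lemma Im_recip_cauchy_abs:
  assumes m: "borel_prob m" and z: "Im z \<noteq> 0"
  shows "\<bar>Im (1 / cauchy m z)\<bar> \<ge> \<bar>Im z\<bar>"
  using Im_recip_cauchy[OF m, of z] Im_recip_cauchy_neg[OF m, of z] z by linarith

lemma borel_measurable_fst_real [measurable]: "fst \<in> borel_measurable (borel :: (real \<times> real) measure)"
  and borel_measurable_snd_real [measurable]: "snd \<in> borel_measurable (borel :: (real \<times> real) measure)"
  by (auto intro!: borel_measurable_continuous_onI continuous_intros)

section \<open>Poisson kernels and Stieltjes inversion on the line\<close>

definition poisson :: "real \<Rightarrow> real \<Rightarrow> real \<Rightarrow> real" where
  "poisson u y x = y / ((u - x)\<^sup>2 + y\<^sup>2)"

lemma poisson_measurable [measurable]: "poisson u y \<in> borel_measurable borel"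
  unfolding poisson_def by measurable

lemma poisson_nonneg: "y > 0 \<Longrightarrow> poisson u y x \<ge> 0"
  unfolding poisson_def by (simp add: divide_nonneg_pos add_nonneg_pos)

lemma poisson_le: "y > 0 \<Longrightarrow> poisson u y x \<le> 1 / y"
proof -
  assume y: "y > 0"
  have "y * y \<le> (u - x)\<^sup>2 + y\<^sup>2" by (simp add: power2_eq_square)
  moreover have "(u - x)\<^sup>2 + y\<^sup>2 > 0" using y by (simp add: add_nonneg_pos)
  ultimately show ?thesis using y unfolding poisson_def by (simp add: field_simps)
qed

lemma poisson_kernel: "poisson u y x = - Im (1 / (Complex u y - complex_of_real x))"
  by (simp add: poisson_def Im_divide)

text \<open>In the variable \<open>u\<close> the kernel has the primitive
  \<open>arctan ((u - x) / y)\<close>. It carries no factor \<open>1 / pi\<close>, so inversion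
  recovers \<open>pi\<close> times the measure.\<close>

lemma poisson_interval:
  assumes "y > 0" "a \<le> b"
  shows "(\<integral>u. indicator {a..b} u * poisson u y x \<partial>lborel) = arctan ((b - x) / y) - arctan ((a - x) / y)"
proof -
  have nz: "(u - x)\<^sup>2 + y\<^sup>2 \<noteq> 0" for u using assms by (simp add: add_nonneg_eq_0_iff)
  have "(\<integral>u. poisson u y x * indicator {a..b} u \<partial>lborel) = arctan ((b - x) / y) - arctan ((a - x) / y)"
  proof (rule integral_FTC_Icc_real[OF assms(2)])
    fix u
    have "1 + ((u - x) / y)\<^sup>2 \<noteq> 0"
      by (smt (verit) zero_le_power2)
    then show "((\<lambda>u. arctan ((u - x) / y)) has_real_derivative poisson u y x) (at u)"
      using assms(1) nz[of u]
      by (auto intro!: derivative_eq_intros simp: poisson_def divide_simps power2_eq_square add_nonneg_eq_0_iff)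
    show "isCont (\<lambda>u. poisson u y x) u"
      unfolding poisson_def using nz by (intro continuous_intros) auto
  qed
  thus ?thesis by (simp add: mult.commute)
qed

lemma poisson_interval_integral:
  fixes m :: "real measure"
  assumes "finite_measure m" and sets: "sets m = sets borel" and y: "y > 0" and ab: "a \<le> b"
  shows "(\<integral>u. (\<integral>x. indicator {a..b} u * poisson u y x \<partial>m) \<partial>lborel)
    = (\<integral>x. arctan ((b - x) / y) - arctan ((a - x) / y) \<partial>m)"
proof -
  interpret finite_measure m by fact
  interpret P: pair_sigma_finite m lborel by unfold_locales
  note [measurable_cong] = sets
  have "integrable (m \<Otimes>\<^sub>M lborel) (\<lambda>(x, u). indicator {a..b} u * poisson u y x)"
  proof (rule Bochner_Integration.integrable_bound)
    have "emeasure (m \<Otimes>\<^sub>M lborel) (space m \<times> {a..b}) < \<infinity>"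
      by (subst lborel.emeasure_pair_measure_Times)
         (use ab in \<open>auto simp: emeasure_eq_measure ennreal_mult_less_top\<close>)
    thus "integrable (m \<Otimes>\<^sub>M lborel) (\<lambda>x. 1 / y * indicator (space m \<times> {a..b}) x)"
      by (intro integrable_mult_right integrable_real_indicator) auto
    show "(\<lambda>(x, u). indicator {a..b} u * poisson u y x) \<in> borel_measurable (m \<Otimes>\<^sub>M lborel)"
    proof -
      have "sets (m \<Otimes>\<^sub>M lborel) = sets (borel \<Otimes>\<^sub>M borel :: (real \<times> real) measure)"
        by (rule sets_pair_measure_cong) (simp_all add: sets)
      moreover have "(\<lambda>(x, u). indicator {a..b} u * poisson u y x) \<in> borel_measurable (borel \<Otimes>\<^sub>M borel)"
        unfolding poisson_def by measurable
      ultimately show ?thesis by (simp cong: measurable_cong_sets)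
    qed
    show "AE x in m \<Otimes>\<^sub>M lborel. norm (case x of (x, u) \<Rightarrow> indicator {a..b} u * poisson u y x)
            \<le> norm (1 / y * indicator (space m \<times> {a..b}) x)"
      using sets_eq_imp_space_eq[OF sets] poisson_nonneg[OF y] poisson_le[OF y] y
      by (auto simp: indicator_def split: prod.splits)
  qed
  hence "(\<integral>u. (\<integral>x. indicator {a..b} u * poisson u y x \<partial>m) \<partial>lborel)
    = (\<integral>x. (\<integral>u. indicator {a..b} u * poisson u y x \<partial>lborel) \<partial>m)"
    by (rule P.Fubini_integral)
  thus ?thesis by (simp add: poisson_interval[OF y ab])
qed

text \<open>The heights \<open>1 / (n + 2)\<close> tend to 0 and lie strictly between 0 and 1 for
  every \<open>n\<close>. Inversion assumes equality only at such heights, because the argument with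
  weights needs poles different from \<open>\<i>\<close> and \<open>- \<i>\<close>.\<close>

lemma arctan_div_tendsto:
  "(\<lambda>n. arctan (c / (1 / (real n + 2)))) \<longlonglongrightarrow> pi / 2 * sgn c"
proof -
  have eq: "(\<lambda>n. arctan (c / (1 / (real n + 2)))) = (\<lambda>n. arctan (c * (real n + 2)))" by simp
  consider "c > 0" | "c = 0" | "c < 0" by linarith
  thus ?thesis
  proof cases
    case 1
    have "filterlim (\<lambda>n. c * (real n + 2)) at_top sequentially" using 1 by real_asymp
    from filterlim_compose[OF tendsto_arctan_at_top this] show ?thesis unfolding eq using 1 by simp
  next
    case 2 thus ?thesis by simp
  next
    case 3
    have "filterlim (\<lambda>n. c * (real n + 2)) at_bot sequentially" using 3 by real_asymp
    from filterlim_compose[OF tendsto_arctan_at_bot this] show ?thesis unfolding eq using 3 by simp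
  qed
qed

lemma abs_arctan_le: "\<bar>arctan x\<bar> \<le> pi / 2"
  using arctan_bounded[of x] by auto

text \<open>Stieltjes inversion: integrating the Poisson kernel over an interval gives a difference of
  arctangents, which tends to a jump function as \<open>y\<close> tends to 0.\<close>

lemma measure_eqI_poisson:
  fixes m m' :: "real measure"
  assumes fin: "finite_measure m" "finite_measure m'"
    and sets: "sets m = sets borel" "sets m' = sets borel"
    and eq: "\<And>u y. 0 < y \<Longrightarrow> y < 1 \<Longrightarrow> (\<integral>x. poisson u y x \<partial>m) = (\<integral>x. poisson u y x \<partial>m')"
  shows "m = m'"
proof (rule measure_eqI_lessThan[OF sets])
  interpret m: finite_measure m by fact
  interpret m': finite_measure m' by fact
  show "emeasure m {x<..} < \<infinity>" for x by (simp add: m.emeasure_eq_measure)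
  fix a :: real
  have lim: "(\<lambda>n. \<integral>x. arctan ((b - x) / (1 / (real n + 2))) - arctan ((a - x) / (1 / (real n + 2))) \<partial>M)
      \<longlonglongrightarrow> (\<integral>x. pi / 2 * sgn (b - x) - pi / 2 * sgn (a - x) \<partial>M)"
    if M: "finite_measure M" and sM: "sets M = sets borel" for M a b
  proof (rule integral_dominated_convergence[where w="\<lambda>_. pi"])
    interpret finite_measure M by fact
    show "integrable M (\<lambda>_. pi)" by simp
    show "AE x in M. norm (arctan ((b - x) / (1 / (real n + 2))) - arctan ((a - x) / (1 / (real n + 2)))) \<le> pi" for n
      using abs_arctan_le by (intro AE_I2) (smt (verit) field_sum_of_halves real_norm_def)
    show "AE x in M. (\<lambda>n. arctan ((b - x) / (1 / (real n + 2))) - arctan ((a - x) / (1 / (real n + 2))))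
        \<longlonglongrightarrow> pi / 2 * sgn (b - x) - pi / 2 * sgn (a - x)"
      by (intro AE_I2 tendsto_diff arctan_div_tendsto)
  qed (rule borel_measurable_sets_eq[OF sM], measurable)+
  have eq2: "(\<integral>x. pi / 2 * sgn (b - x) - pi / 2 * sgn (a - x) \<partial>m) = (\<integral>x. pi / 2 * sgn (b - x) - pi / 2 * sgn (a - x) \<partial>m')"
    if ab: "a \<le> b" for a b
  proof (rule LIMSEQ_unique[OF lim[OF fin(1) sets(1)]])
    have "(\<integral>x. arctan ((b - x) / (1 / (real n + 2))) - arctan ((a - x) / (1 / (real n + 2))) \<partial>m) =
          (\<integral>x. arctan ((b - x) / (1 / (real n + 2))) - arctan ((a - x) / (1 / (real n + 2))) \<partial>m')" for n
    proof -
      have y: "1 / (real n + 2) > 0" "1 / (real n + 2) < 1" by auto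
      show ?thesis
        unfolding poisson_interval_integral[OF fin(1) sets(1) y(1) ab, symmetric]
          poisson_interval_integral[OF fin(2) sets(2) y(1) ab, symmetric]
        by (simp add: eq[OF y] del: divide_divide_eq_right)
    qed
    thus "(\<lambda>n. \<integral>x. arctan ((b - x) / (1 / (real n + 2))) - arctan ((a - x) / (1 / (real n + 2))) \<partial>m)
      \<longlonglongrightarrow> (\<integral>x. pi / 2 * sgn (b - x) - pi / 2 * sgn (a - x) \<partial>m')"
      using lim[OF fin(2) sets(2)] by simp
  qed
  \<comment> \<open>In the limit of the arctangents each endpoint of the interval receives only half
    its mass. Letting the left end approach \<open>a\<close> from the right and the right end go to
    infinity removes this: the limit is \<open>pi\<close> times the indicator of
    \<open>{a<..}\<close>, with value 0 at \<open>a\<close>. The term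
    \<open>\<bar>a\<bar> + 1\<close> keeps the endpoints in order for every
    \<open>n\<close>.\<close>
  define f where "f n x = pi / 2 * sgn (\<bar>a\<bar> + 1 + real n - x) - pi / 2 * sgn (a + 1 / (real n + 1) - x)" for n x
  have f_lim: "(\<lambda>n. \<integral>x. f n x \<partial>M) \<longlonglongrightarrow> (\<integral>x. pi * indicator {a<..} x \<partial>M)"
    if M: "finite_measure M" and sM: "sets M = sets borel" for M
  proof (rule integral_dominated_convergence[where w="\<lambda>_. pi"])
    interpret finite_measure M by fact
    show "integrable M (\<lambda>_. pi)" by simp
    show "AE x in M. norm (f n x) \<le> pi" for n by (auto simp: f_def sgn_real_def)
    show "f n \<in> borel_measurable M" for n unfolding f_def by (rule borel_measurable_sets_eq[OF sM]) measurable
    show "AE x in M. (\<lambda>n. f n x) \<longlonglongrightarrow> pi * indicator {a<..} x"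
    proof (rule AE_I2)
      fix x
      have "eventually (\<lambda>n. real n > x) sequentially"
        using filterlim_real_sequentially filterlim_at_top_dense by blast
      moreover have "eventually (\<lambda>n. x > a \<longrightarrow> 1 / (real n + 1) < x - a) sequentially"
      proof (cases "x > a")
        case True
        have "(\<lambda>n. 1 / (real n + 1)) \<longlonglongrightarrow> 0" by real_asymp
        from order_tendstoD(2)[OF this, of "x - a"] True show ?thesis by auto
      qed auto
      ultimately have "eventually (\<lambda>n. f n x = pi * indicator {a<..} x) sequentially"
      proof eventually_elim
        case (elim n)
        have "sgn (\<bar>a\<bar> + 1 + real n - x) = 1" using elim by (simp add: sgn_real_def)
        moreover have "sgn (a + 1 / (real n + 1) - x) = (if x > a then - 1 else 1)"
          using elim(2) by (auto simp: sgn_real_def) (smt (verit) divide_pos_pos of_nat_0_le_iff)+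
        ultimately show ?case by (simp add: f_def)
      qed
      thus "(\<lambda>n. f n x) \<longlonglongrightarrow> pi * indicator {a<..} x" by (rule tendsto_eventually)
    qed
  qed (rule borel_measurable_sets_eq[OF sM], measurable)
  have "(\<integral>x. pi * indicator {a<..} x \<partial>m) = (\<integral>x. pi * indicator {a<..} x \<partial>m')"
  proof (rule LIMSEQ_unique[OF f_lim[OF fin(1) sets(1)]])
    have "(\<integral>x. f n x \<partial>m) = (\<integral>x. f n x \<partial>m')" for n
    proof -
      have "1 / (real n + 1) \<le> 1" by simp
      hence "a + 1 / (real n + 1) \<le> \<bar>a\<bar> + 1 + real n" by linarith
      thus ?thesis unfolding f_def by (rule eq2)
    qed
    thus "(\<lambda>n. \<integral>x. f n x \<partial>m) \<longlonglongrightarrow> (\<integral>x. pi * indicator {a<..} x \<partial>m')"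
      using f_lim[OF fin(2) sets(2)] by simp
  qed
  hence "measure m {a<..} = measure m' {a<..}" using sets by simp
  thus "emeasure m {a<..} = emeasure m' {a<..}"
    by (simp add: m.emeasure_eq_measure m'.emeasure_eq_measure)
qed

lemma cauchy_inject:
  assumes m: "borel_prob m" "borel_prob m'"
    and eq: "\<And>z. Im z > 0 \<Longrightarrow> cauchy m z = cauchy m' z"
  shows "m = m'"
proof (rule measure_eqI_poisson)
  show "finite_measure m" "finite_measure m'" "sets m = sets borel" "sets m' = sets borel"
    using m by (simp_all add: borel_prob_finite borel_prob_def)
  fix u y :: real assume "0 < y"
  have *: "(\<integral>x. poisson u y x \<partial>m) = - Im (cauchy m (Complex u y))" if m: "borel_prob m" for m
    using integral_Im[OF cauchy_integrable[OF m], of "Complex u y"] \<open>0 < y\<close>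
    by (simp add: cauchy_def poisson_kernel)
  show "(\<integral>x. poisson u y x \<partial>m) = (\<integral>x. poisson u y x \<partial>m')"
    using m \<open>0 < y\<close> by (simp add: * eq)
qed

text \<open>The density \<open>sqrt (1 + s\<^sup>2) * sqrt (1 + t\<^sup>2)\<close> is absorbed into the kernel, which stays bounded,
  because its product with \<open>\<rho>\<close> may have infinite total variation.\<close>

definition wkernel :: "complex \<Rightarrow> complex \<Rightarrow> real \<times> real \<Rightarrow> complex" where
  "wkernel z w x = complex_of_real (weight (fst x) * weight (snd x)) /
     ((z - complex_of_real (fst x)) * (w - complex_of_real (snd x)))"

abbreviation wtransform :: "(real \<times> real) measure \<Rightarrow> complex \<Rightarrow> complex \<Rightarrow> complex" where
  "wtransform M z w \<equiv> (\<integral>x. wkernel z w x \<partial>M)"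

lemma wkernel_measurable [measurable]: "wkernel z w \<in> borel_measurable borel"
  unfolding wkernel_def by measurable

lemma wkernel_le:
  assumes "Im z \<noteq> 0" "Im w \<noteq> 0"
  shows "norm (wkernel z w x) \<le> kernel_bound z * kernel_bound w"
proof -
  have "norm (wkernel z w x) = (weight (fst x) / norm (z - complex_of_real (fst x))) *
      (weight (snd x) / norm (w - complex_of_real (snd x)))"
    using weight_pos[of "fst x"] weight_pos[of "snd x"] by (simp add: wkernel_def norm_mult norm_divide)
  also have "\<dots> \<le> kernel_bound z * kernel_bound w"
    using weight_pos[of "fst x"] weight_pos[of "snd x"] kernel_bound_ge_1[of z]
    by (intro mult_mono weight_kernel_le assms) (auto intro: divide_nonneg_nonneg less_imp_le)
  finally show ?thesis .
qed

section \<open>Transforms in two variables and their injectivity\<close>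

lemma cauchy2_eq:
  "cauchy2 M z w = (\<integral>x. 1 / ((z - complex_of_real (fst x)) * (w - complex_of_real (snd x))) \<partial>M)"
  unfolding cauchy2_def by (simp add: case_prod_unfold)

lemma kernel2_le:
  assumes "Im z \<noteq> 0" "Im w \<noteq> 0"
  shows "norm (1 / ((z - complex_of_real (fst x)) * (w - complex_of_real (snd x)))) \<le> 1 / \<bar>Im z\<bar> * (1 / \<bar>Im w\<bar>)"
proof -
  have "norm (1 / ((z - complex_of_real (fst x)) * (w - complex_of_real (snd x)))) =
    norm (1 / (z - complex_of_real (fst x))) * norm (1 / (w - complex_of_real (snd x)))"
    by (simp add: norm_mult norm_divide)
  also have "\<dots> \<le> 1 / \<bar>Im z\<bar> * (1 / \<bar>Im w\<bar>)"
    by (intro mult_mono kernel_le assms) auto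
  finally show ?thesis .
qed

lemma integrable_bounded:
  fixes f :: "'a::topological_space \<Rightarrow> 'b::{banach, second_countable_topology}"
  assumes "finite_measure M" "sets M = sets borel" "f \<in> borel_measurable borel" "\<And>x. norm (f x) \<le> B"
  shows "integrable M f"
proof -
  interpret finite_measure M by fact
  show ?thesis
    using assms by (intro integrable_const_bound[where B=B]) (auto intro: borel_measurable_sets_eq)
qed

lemma integrable_scaleR_bounded:
  fixes f :: "'a::topological_space \<Rightarrow> 'b::{banach, second_countable_topology}" and h :: "'a \<Rightarrow> real"
  assumes h: "integrable M h" and M: "sets M = sets borel"
    and f: "f \<in> borel_measurable borel" "\<And>x. norm (f x) \<le> B"
  shows "integrable M (\<lambda>x. h x *\<^sub>R f x)"
proof (rule Bochner_Integration.integrable_bound)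
  have B: "B \<ge> 0" using order_trans[OF norm_ge_zero f(2)] .
  show "integrable M (\<lambda>x. B * \<bar>h x\<bar>)" using h by simp
  show "AE x in M. norm (h x *\<^sub>R f x) \<le> norm (B * \<bar>h x\<bar>)"
    using f(2) B by (intro AE_I2) (auto simp: mult.commute[of B] abs_mult intro!: mult_left_mono)
  show "(\<lambda>x. h x *\<^sub>R f x) \<in> borel_measurable M"
    using h borel_measurable_sets_eq[OF M f(1)] by simp
qed

lemma kernel2_integrable:
  assumes "finite_measure M" "sets M = sets borel" "Im z \<noteq> 0" "Im w \<noteq> 0"
  shows "integrable M (\<lambda>x. 1 / ((z - complex_of_real (fst x)) * (w - complex_of_real (snd x))))"
proof (rule integrable_bounded[OF assms(1,2)])
  show "(\<lambda>x. 1 / ((z - complex_of_real (fst x)) * (w - complex_of_real (snd x)))) \<in> borel_measurable borel"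
    by measurable
qed (rule kernel2_le[OF assms(3,4)])

text \<open>A product of two imaginary parts is not the imaginary part of a product, so each factor
  is written with \<open>(cnj v - v) / (2 * \<i>)\<close> and expanded. This brings in all four
  choices of conjugates, which is why the transform has to be known for poles in all four products
  of half-planes.\<close>

lemma poisson2_cauchy2:
  fixes M :: "(real \<times> real) measure" and u u' y y' :: real
  assumes M: "finite_measure M" "sets M = sets borel" and y: "y > 0" "y' > 0"
  defines "z \<equiv> Complex u y" and "w \<equiv> Complex u' y'"
  shows "complex_of_real (\<integral>x. poisson u y (fst x) * poisson u' y' (snd x) \<partial>M) =
    (cauchy2 M (cnj z) w + cauchy2 M z (cnj w) - cauchy2 M (cnj z) (cnj w) - cauchy2 M z w) / 4"
proof -
  have nz: "Im z \<noteq> 0" "Im (cnj z) \<noteq> 0" "Im w \<noteq> 0" "Im (cnj w) \<noteq> 0"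
    using y by (auto simp: z_def w_def)
  note int = kernel2_integrable[OF M]
  have half: "complex_of_real (- Im v) = (cnj v - v) / (2 * \<i>)" for v
    by (simp add: complex_eq_iff Re_divide Im_divide)
  have sum4: "(\<integral>x. (f1 x + f2 x - f3 x - f4 x) / 4 \<partial>M) =
      ((\<integral>x. f1 x \<partial>M) + (\<integral>x. f2 x \<partial>M) - (\<integral>x. f3 x \<partial>M) - (\<integral>x. f4 x \<partial>M)) / 4"
    if "integrable M f1" "integrable M f2" "integrable M f3" "integrable M f4" for f1 f2 f3 f4 :: "real \<times> real \<Rightarrow> complex"
    using that by simp
  have p: "complex_of_real (poisson u y s) = (1 / (cnj z - s) - 1 / (z - s)) / (2 * \<i>)" for s
    unfolding poisson_kernel z_def[symmetric] half by simp
  have q: "complex_of_real (poisson u' y' s) = (1 / (cnj w - s) - 1 / (w - s)) / (2 * \<i>)" for s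
    unfolding poisson_kernel w_def[symmetric] half by simp
  have quad: "((A - B) / (2 * \<i>)) * ((C - D) / (2 * \<i>)) = (A * D + B * C - A * C - B * D) / 4" for A B C D :: complex
    by (simp add: field_simps)
  have pt: "complex_of_real (poisson u y s * poisson u' y' t) =
      (1 / ((cnj z - s) * (w - t)) + 1 / ((z - s) * (cnj w - t))
      - 1 / ((cnj z - s) * (cnj w - t)) - 1 / ((z - s) * (w - t))) / 4" for s t
  proof -
    have "complex_of_real (poisson u y s * poisson u' y' t) =
      ((1 / (cnj z - s) - 1 / (z - s)) / (2 * \<i>)) * ((1 / (cnj w - t) - 1 / (w - t)) / (2 * \<i>))"
      by (simp only: of_real_mult p q)
    also have "\<dots> = (1 / (cnj z - s) * (1 / (w - t)) + 1 / (z - s) * (1 / (cnj w - t))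
      - 1 / (cnj z - s) * (1 / (cnj w - t)) - 1 / (z - s) * (1 / (w - t))) / 4"
      by (rule quad)
    finally show ?thesis by (simp only: times_divide_times_eq mult_1)
  qed
  have "complex_of_real (\<integral>x. poisson u y (fst x) * poisson u' y' (snd x) \<partial>M) =
     (\<integral>x. complex_of_real (poisson u y (fst x) * poisson u' y' (snd x)) \<partial>M)"
    by (rule integral_complex_of_real[symmetric])
  also have "\<dots> = (cauchy2 M (cnj z) w + cauchy2 M z (cnj w) - cauchy2 M (cnj z) (cnj w) - cauchy2 M z w) / 4"
    unfolding pt cauchy2_eq by (rule sum4) (rule int, (rule nz)+)+
  finally show ?thesis unfolding z_def w_def .
qed

text \<open>Reduction from the plane to the line: with \<open>g\<close> a function of one coordinate
  and \<open>f\<close> the other coordinate, the pushed-forward measure lives on the line, where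
  \<open>measure_eqI_poisson\<close> applies.\<close>

lemma integral_distr_density:
  fixes M :: "'a::topological_space measure" and f :: "'a \<Rightarrow> real"
  assumes M: "finite_measure M" "sets M = sets borel"
    and [measurable]: "f \<in> borel_measurable borel" "g \<in> borel_measurable borel" "h \<in> borel_measurable borel"
    and g: "\<And>x. 0 \<le> g x" "\<And>x. g x \<le> B"
  shows "finite_measure (distr (density M g) borel f)"
    and "(\<integral>x. h x \<partial>distr (density M g) borel f) = (\<integral>x. g x * h (f x) \<partial>M :: real)"
proof -
  interpret finite_measure M by fact
  note [measurable_cong] = M(2)
  have "integrable M g" by (rule integrable_bounded[OF M, of _ B]) (use g in auto)
  hence "(\<integral>\<^sup>+x. ennreal (g x) \<partial>M) < \<infinity>"
    using g by (simp add: integrable_iff_bounded)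
  hence "finite_measure (density M g)"
    by (intro finite_measureI)
       (simp add: emeasure_density borel_measurable_sets_eq[OF M(2)] cong: nn_integral_cong_simp)
  thus "finite_measure (distr (density M g) borel f)"
    by (rule finite_measure.finite_measure_distr) (rule borel_measurable_sets_eq, simp add: M(2), rule assms)
  show "(\<integral>x. h x \<partial>distr (density M g) borel f) = (\<integral>x. g x * h (f x) \<partial>M)"
  proof -
    have "(\<integral>x. h x \<partial>distr (density M g) borel f) = (\<integral>x. h (f x) \<partial>density M g)"
      by (rule integral_distr) (auto intro: borel_measurable_sets_eq simp: M(2))
    also have "\<dots> = (\<integral>x. g x *\<^sub>R h (f x) \<partial>M)"
      by (rule integral_density) (use g in \<open>auto intro!: borel_measurable_sets_eq[OF M(2)]\<close>)
    finally show ?thesis by simp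
  qed
qed

text \<open>Stieltjes inversion one coordinate at a time. With the Poisson kernel in the second
  coordinate kept as a density, inversion in the first coordinate replaces the other kernel by an
  indicator; with that indicator as density, inversion in the second coordinate yields rectangles,
  which generate the Borel sets.\<close>

lemma measure_eqI_cauchy2:
  fixes M M' :: "(real \<times> real) measure"
  assumes M: "finite_measure M" "sets M = sets borel" and M': "finite_measure M'" "sets M' = sets borel"
    and eq: "\<And>z w. Im z \<noteq> 0 \<Longrightarrow> Im w \<noteq> 0 \<Longrightarrow> \<bar>Im z\<bar> < 1 \<Longrightarrow> \<bar>Im w\<bar> < 1 \<Longrightarrow> cauchy2 M z w = cauchy2 M' z w"
  shows "M = M'"
proof -
  interpret M: finite_measure M by fact
  interpret M': finite_measure M' by fact
  have pp: "(\<integral>x. poisson u y (fst x) * poisson u' y' (snd x) \<partial>M) =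
      (\<integral>x. poisson u y (fst x) * poisson u' y' (snd x) \<partial>M')"
    if y: "0 < y" "y < 1" "0 < y'" "y' < 1" for u y u' y'
  proof -
    have "complex_of_real (\<integral>x. poisson u y (fst x) * poisson u' y' (snd x) \<partial>M) =
      complex_of_real (\<integral>x. poisson u y (fst x) * poisson u' y' (snd x) \<partial>M')"
      using y by (simp add: poisson2_cauchy2[OF M] poisson2_cauchy2[OF M'] eq del: of_real_eq_iff)
    thus ?thesis by simp
  qed
  have mf: "fst \<in> borel_measurable (borel :: (real \<times> real) measure)"
    and ms: "snd \<in> borel_measurable (borel :: (real \<times> real) measure)" by measurable
  note D = integral_distr_density[OF M] and D' = integral_distr_density[OF M']
  have pA: "(\<integral>x. poisson u' y' (snd x) * indicator A (fst x) \<partial>M) =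
      (\<integral>x. poisson u' y' (snd x) * indicator A (fst x) \<partial>M')"
    if y: "0 < y'" "y' < 1" and [measurable]: "A \<in> sets borel" for u' y' A
  proof -
    let ?g = "\<lambda>x::real\<times>real. poisson u' y' (snd x)"
    have g: "?g \<in> borel_measurable borel" by measurable
    note b = poisson_nonneg[OF y(1)] poisson_le[OF y(1)]
    have "distr (density M ?g) borel fst = distr (density M' ?g) borel fst"
    proof (rule measure_eqI_poisson)
      show "finite_measure (distr (density M ?g) borel fst)" "finite_measure (distr (density M' ?g) borel fst)"
        by (rule D(1)[OF mf g _ b] D'(1)[OF mf g _ b], rule poisson_measurable)+
      fix u y :: real assume "0 < y" "y < 1"
      show "(\<integral>x. poisson u y x \<partial>distr (density M ?g) borel fst) = (\<integral>x. poisson u y x \<partial>distr (density M' ?g) borel fst)"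
        using pp[OF \<open>0 < y\<close> \<open>y < 1\<close> y, of u u']
        by (simp add: D(2)[OF mf g poisson_measurable b] D'(2)[OF mf g poisson_measurable b] mult.commute)
    qed auto
    moreover have i: "indicator A \<in> borel_measurable (borel :: real measure)" by measurable
    ultimately show ?thesis
      using D(2)[OF mf g i b] D'(2)[OF mf g i b] by simp
  qed
  have AB: "measure M (A \<times> B) = measure M' (A \<times> B)"
    if [measurable]: "A \<in> sets borel" "B \<in> sets borel" for A B
  proof -
    let ?g = "\<lambda>x::real\<times>real. indicator A (fst x) :: real"
    have g: "?g \<in> borel_measurable borel" by measurable
    have b: "?g x \<ge> 0" "?g x \<le> 1" for x by (auto simp: indicator_def)
    have "distr (density M ?g) borel snd = distr (density M' ?g) borel snd"
    proof (rule measure_eqI_poisson)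
      show "finite_measure (distr (density M ?g) borel snd)" "finite_measure (distr (density M' ?g) borel snd)"
        by (rule D(1)[OF ms g _ b] D'(1)[OF ms g _ b], rule poisson_measurable)+
      fix u y :: real assume "0 < y" "y < 1"
      show "(\<integral>x. poisson u y x \<partial>distr (density M ?g) borel snd) = (\<integral>x. poisson u y x \<partial>distr (density M' ?g) borel snd)"
        using pA[OF \<open>0 < y\<close> \<open>y < 1\<close> that(1), of u]
        by (simp add: D(2)[OF ms g poisson_measurable b] D'(2)[OF ms g poisson_measurable b] mult.commute)
    qed auto
    moreover have i: "indicator B \<in> borel_measurable (borel :: real measure)" by measurable
    ultimately have "(\<integral>x. indicator A (fst x) * indicator B (snd x) \<partial>M) = (\<integral>x. indicator A (fst x) * indicator B (snd x) \<partial>M' :: real)"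
      using D(2)[OF ms g i b] D'(2)[OF ms g i b] by simp
    moreover have "indicator A (fst x) * indicator B (snd x) = (indicator (A \<times> B) x :: real)" for x
      by (cases x) (auto simp: indicator_def)
    moreover have "A \<times> B \<in> sets borel" unfolding borel_prod[symmetric] by measurable
    ultimately show ?thesis using M(2) M'(2) by simp
  qed
  let ?E = "{A \<times> B |A B. A \<in> sets (borel :: real measure) \<and> B \<in> sets (borel :: real measure)}"
  have sE: "sets (borel :: (real \<times> real) measure) = sigma_sets UNIV ?E"
    unfolding borel_prod[symmetric] sets_pair_measure by simp
  show ?thesis
  proof (rule measure_eqI_generator_eq[where E="?E" and \<Omega>=UNIV and A="\<lambda>_. UNIV"])
    show "Int_stable ?E" by (rule Int_stable_pair_measure_generator)
    show "sets M = sigma_sets UNIV ?E" "sets M' = sigma_sets UNIV ?E"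
      using M(2) M'(2) sE by auto
    show "emeasure M X = emeasure M' X" if "X \<in> ?E" for X
      using that by (auto simp: M.emeasure_eq_measure M'.emeasure_eq_measure AB)
    show "range (\<lambda>_. UNIV) \<subseteq> ?E"
      by (auto intro!: exI[of _ UNIV])
  qed auto
qed

lemma partial_fractions3:
  fixes a b c s :: complex
  assumes "a \<noteq> b" "a \<noteq> c" "b \<noteq> c" "a \<noteq> s" "b \<noteq> s" "c \<noteq> s"
  shows "1 / ((a - s) * (b - s) * (c - s)) =
    1 / ((b - a) * (c - a)) / (a - s) + 1 / ((a - b) * (c - b)) / (b - s) + 1 / ((a - c) * (b - c)) / (c - s)"
proof -
  \<comment> \<open>Once the differences are named, the claim is the polynomial identity
    \<open>r * B * C - q * A * C + p * A * B = p * q * r\<close> divided by a common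
    product.\<close>
  define p q A where "p = b - a" and "q = c - a" and "A = a - s"
  define r B C where "r = q - p" and "B = A + p" and "C = A + q"
  have eqs: "a - s = A" "b - s = B" "c - s = C" "b - a = p" "c - a = q" "a - b = - p" "c - b = r" "a - c = - q" "b - c = - r"
    by (simp_all add: p_def q_def r_def A_def B_def C_def)
  have nz: "p \<noteq> 0" "q \<noteq> 0" "r \<noteq> 0" "A \<noteq> 0" "B \<noteq> 0" "C \<noteq> 0"
    using assms eqs by auto
  have "r * B * C - q * A * C + p * A * B = p * q * r"
    by (simp add: r_def B_def C_def algebra_simps)
  hence "1 / (A * B * C) = (r * B * C - q * A * C + p * A * B) / (p * q * r * A * B * C)"
    using nz by simp
  also have "\<dots> = 1 / (p * q) / A - 1 / (p * r) / B + 1 / (q * r) / C"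
    using nz by (simp add: add_divide_distrib diff_divide_distrib mult.assoc)
  finally show ?thesis unfolding eqs by simp
qed

text \<open>The square of \<open>weight s\<close> is \<open>1 + s\<^sup>2\<close>, the product of
  \<open>\<i> - s\<close> and \<open>- \<i> - s\<close>. Dividing by the weight thus amounts to
  multiplying by it and adding simple poles at \<open>\<i>\<close> and \<open>- \<i>\<close>, and
  partial fractions separate the three poles. The condition \<open>\<bar>Im z\<bar> < 1\<close>
  keeps \<open>z\<close> distinct from the other two.\<close>

lemma kernel_over_weight:
  assumes "Im z \<noteq> 0" "\<bar>Im z\<bar> < 1"
  shows "\<exists>A c. (\<forall>j<3::nat. Im (c j) \<noteq> 0) \<and>
    (\<forall>s. 1 / (z - complex_of_real s) / complex_of_real (weight s) =
       (\<Sum>j<3. A j * (complex_of_real (weight s) / (c j - complex_of_real s))))"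
proof -
  define c where "c j = (if j = 0 then z else if j = 1 then \<i> else - \<i>)" for j :: nat
  define A where "A j = (if j = 0 then 1 / ((\<i> - z) * (- \<i> - z)) else
    if j = 1 then 1 / ((z - \<i>) * (- \<i> - \<i>)) else 1 / ((z - (- \<i>)) * (\<i> - (- \<i>))))" for j :: nat
  have "1 / (z - complex_of_real s) / complex_of_real (weight s) =
       (\<Sum>j<3. A j * (complex_of_real (weight s) / (c j - complex_of_real s)))" for s
  proof -
    have ne: "z \<noteq> \<i>" "z \<noteq> - \<i>" "\<i> \<noteq> - \<i>" "z \<noteq> s" "\<i> \<noteq> complex_of_real s" "- \<i> \<noteq> complex_of_real s"
      using assms by (auto simp: complex_eq_iff)
    have W: "complex_of_real (weight s) \<noteq> 0" using weight_pos[of s] by simp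
    have W2: "complex_of_real (weight s) * complex_of_real (weight s) = (\<i> - s) * (- \<i> - s)"
    proof -
      have "complex_of_real (weight s) * complex_of_real (weight s) = complex_of_real ((weight s)\<^sup>2)"
        by (simp add: power2_eq_square)
      also have "\<dots> = (\<i> - s) * (- \<i> - s)" unfolding weight_sq
        by (simp add: algebra_simps power2_eq_square)
      finally show ?thesis .
    qed
    have "1 / (z - s) / complex_of_real (weight s) = complex_of_real (weight s) *
        (1 / ((z - s) * (complex_of_real (weight s) * complex_of_real (weight s))))"
      using W by simp
    also have "\<dots> = complex_of_real (weight s) * (1 / ((z - s) * (\<i> - s) * (- \<i> - s)))"
      unfolding W2 by (simp add: mult.assoc)
    also have "\<dots> = (\<Sum>j<3. A j * (complex_of_real (weight s) / (c j - complex_of_real s)))"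
      unfolding partial_fractions3[OF ne]
      by (simp add: A_def c_def eval_nat_numeral distrib_left right_diff_distrib)
    finally show ?thesis .
  qed
  moreover have "\<forall>j<3. Im (c j) \<noteq> 0" using assms by (simp add: c_def)
  ultimately show ?thesis by blast
qed

lemma wkernel_integrable:
  assumes "finite_measure M" "sets M = sets borel" "Im z \<noteq> 0" "Im w \<noteq> 0"
  shows "integrable M (wkernel z w)"
  by (rule integrable_bounded[OF assms(1,2) wkernel_measurable wkernel_le[OF assms(3,4)]])

text \<open>The weights are at least 1, so dividing by them keeps the measure finite, and
  multiplying again recovers \<open>M\<close>: two measures agree as soon as their divided versions
  do.\<close>

lemma density_inverse_weight:
  fixes M :: "(real \<times> real) measure"
  assumes M: "finite_measure M" "sets M = sets borel"
  defines "v \<equiv> \<lambda>x::real\<times>real. 1 / (weight (fst x) * weight (snd x))"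
  shows "finite_measure (density M v)"
    and "density (density M v) (\<lambda>x. ennreal (weight (fst x) * weight (snd x))) = M"
proof -
  interpret finite_measure M by fact
  have [measurable]: "v \<in> borel_measurable borel" unfolding v_def by measurable
  have [measurable]: "v \<in> borel_measurable M" by (rule borel_measurable_sets_eq[OF M(2)]) measurable
  have [measurable]: "(\<lambda>x. weight (fst x) * weight (snd x)) \<in> borel_measurable M"
    by (rule borel_measurable_sets_eq[OF M(2)]) measurable
  have v: "v x > 0" "v x \<le> 1" for x
  proof -
    have "1 * 1 \<le> weight (fst x) * weight (snd x)"
      by (intro mult_mono weight_ge_1) (auto intro: less_imp_le weight_pos)
    thus "v x > 0" "v x \<le> 1" by (auto simp: v_def)
  qed
  have "integrable M v" by (rule integrable_bounded[OF M, of _ 1]) (use v in \<open>auto simp: less_imp_le\<close>)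
  hence "(\<integral>\<^sup>+x. ennreal (v x) \<partial>M) < \<infinity>"
    using v by (simp add: integrable_iff_bounded less_imp_le)
  thus "finite_measure (density M v)"
    by (intro finite_measureI) (simp add: emeasure_density cong: nn_integral_cong_simp)
  have "ennreal (v x) * ennreal (weight (fst x) * weight (snd x)) = 1" for x
    using v(1)[of x] weight_pos[of "fst x"] weight_pos[of "snd x"]
    by (simp add: ennreal_mult[symmetric] less_imp_le v_def)
  thus "density (density M v) (\<lambda>x. ennreal (weight (fst x) * weight (snd x))) = M"
    by (subst density_density_eq) (auto simp: density_1)
qed

text \<open>By \<open>kernel_over_weight\<close> in both variables, the plain transform of the
  divided measure at one point is a combination of nine weighted transforms of the original measure.
  Injectivity thus reduces to that of \<open>cauchy2\<close>.\<close>

lemma measure_eqI_wkernel: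
  fixes P Q :: "(real \<times> real) measure"
  assumes P: "finite_measure P" "sets P = sets borel" and Q: "finite_measure Q" "sets Q = sets borel"
    and eq: "\<And>z w. Im z \<noteq> 0 \<Longrightarrow> Im w \<noteq> 0 \<Longrightarrow> wtransform P z w = wtransform Q z w"
  shows "P = Q"
proof -
  define v where "v = (\<lambda>x::real\<times>real. 1 / (weight (fst x) * weight (snd x)))"
  have vm: "v \<in> borel_measurable borel" unfolding v_def by measurable
  have v0: "v x \<ge> 0" for x using weight_pos[of "fst x"] weight_pos[of "snd x"] by (simp add: v_def)
  have "density P v = density Q v"
  proof (rule measure_eqI_cauchy2)
    show "finite_measure (density P v)" "finite_measure (density Q v)"
      unfolding v_def by (intro density_inverse_weight P Q)+
    fix z w :: complex assume zw: "Im z \<noteq> 0" "Im w \<noteq> 0" "\<bar>Im z\<bar> < 1" "\<bar>Im w\<bar> < 1"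
    obtain A c where A: "\<forall>j<3::nat. Im (c j) \<noteq> 0" "\<forall>s. 1 / (z - complex_of_real s) / complex_of_real (weight s) =
       (\<Sum>j<3. A j * (complex_of_real (weight s) / (c j - complex_of_real s)))"
      using kernel_over_weight[OF zw(1,3)] by blast
    obtain B d where B: "\<forall>j<3::nat. Im (d j) \<noteq> 0" "\<forall>s. 1 / (w - complex_of_real s) / complex_of_real (weight s) =
       (\<Sum>j<3. B j * (complex_of_real (weight s) / (d j - complex_of_real s)))"
      using kernel_over_weight[OF zw(2,4)] by blast
    have pt: "v x *\<^sub>R (1 / ((z - complex_of_real (fst x)) * (w - complex_of_real (snd x)))) =
        (\<Sum>j<3. \<Sum>l<3. A j * B l * wkernel (c j) (d l) x)" for x
    proof -
      have "v x *\<^sub>R (1 / ((z - complex_of_real (fst x)) * (w - complex_of_real (snd x)))) =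
          (1 / (z - complex_of_real (fst x)) / complex_of_real (weight (fst x))) *
          (1 / (w - complex_of_real (snd x)) / complex_of_real (weight (snd x)))"
        by (simp add: v_def scaleR_conv_of_real)
      also have "\<dots> = (\<Sum>j<3. \<Sum>l<3. A j * B l * wkernel (c j) (d l) x)"
        unfolding A(2)[rule_format] B(2)[rule_format] sum_product
        by (intro sum.cong refl) (simp add: wkernel_def)
      finally show ?thesis .
    qed
    have main: "cauchy2 (density M v) z w = (\<Sum>j<3. \<Sum>l<3. A j * B l * wtransform M (c j) (d l))"
      if M: "finite_measure M" "sets M = sets borel" for M
    proof -
      have "cauchy2 (density M v) z w = (\<integral>x. v x *\<^sub>R (1 / ((z - complex_of_real (fst x)) * (w - complex_of_real (snd x)))) \<partial>M)"
        unfolding cauchy2_eq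
        by (rule integral_density) (use v0 in \<open>auto intro!: borel_measurable_sets_eq[OF M(2)] vm\<close>)
      also have "\<dots> = (\<integral>x. (\<Sum>j<3. \<Sum>l<3. A j * B l * wkernel (c j) (d l) x) \<partial>M)"
        by (simp only: pt)
      also have "\<dots> = (\<Sum>j<3. \<integral>x. (\<Sum>l<3. A j * B l * wkernel (c j) (d l) x) \<partial>M)"
        by (rule Bochner_Integration.integral_sum)
           (intro Bochner_Integration.integrable_sum integrable_mult_right wkernel_integrable[OF M];
             use A(1) B(1) in auto)
      also have "\<dots> = (\<Sum>j<3. \<Sum>l<3. \<integral>x. A j * B l * wkernel (c j) (d l) x \<partial>M)"
        by (intro sum.cong refl Bochner_Integration.integral_sum)
           (intro integrable_mult_right wkernel_integrable[OF M];
             use A(1) B(1) in auto)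
      finally show ?thesis by simp
    qed
    show "cauchy2 (density P v) z w = cauchy2 (density Q v) z w"
      unfolding main[OF P] main[OF Q] using A(1) B(1) by (intro sum.cong refl) (simp add: eq)
  qed (simp_all add: P Q)
  thus ?thesis
    using density_inverse_weight(2)[OF P] density_inverse_weight(2)[OF Q] unfolding v_def by metis
qed

section \<open>Signed measures\<close>

text \<open>The Hahn decomposition made explicit: among the Borel subsets of \<open>A\<close> the
  supremum is attained at \<open>A \<inter> {x. g x > 0}\<close>, and \<open>ennreal\<close> cuts
  \<open>g\<close> down to its positive part.\<close>

lemma pos_variation_density:
  fixes Q :: "'a::topological_space measure" and g :: "'a \<Rightarrow> real"
  assumes sets: "sets Q = sets borel" and g: "integrable Q g"
    and \<rho>: "\<And>A. A \<in> sets borel \<Longrightarrow> \<rho> A = (LINT x:A|Q. g x)"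
  shows "pos_variation \<rho> = density Q (\<lambda>x. ennreal (g x))"
proof -
  have space: "space Q = UNIV" using sets_eq_imp_space_eq[OF sets] by simp
  have [measurable]: "g \<in> borel_measurable Q" using g by simp
  let ?D = "density Q (\<lambda>x. ennreal (g x))"
  have int: "set_integrable Q A g" if "A \<in> sets borel" for A
    unfolding set_integrable_def using g that sets by (intro integrable_mult_indicator) auto
  have eq: "(SUP B\<in>{B \<in> sets borel. B \<subseteq> A}. ennreal (\<rho> B)) = emeasure ?D A" if A: "A \<in> sets borel" for A
  proof (rule antisym)
    show "(SUP B\<in>{B \<in> sets borel. B \<subseteq> A}. ennreal (\<rho> B)) \<le> emeasure ?D A"
    proof (rule SUP_least)
      fix B assume B: "B \<in> {B \<in> sets borel. B \<subseteq> A}"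
      hence B': "B \<in> sets borel" by simp
      have i: "integrable Q (\<lambda>x. max 0 (g x) * indicator B x)"
        using B' g sets by (intro integrable_real_mult_indicator) auto
      have "\<rho> B \<le> (\<integral>x. max 0 (g x) * indicator B x \<partial>Q)"
        unfolding \<rho>[OF B'] set_lebesgue_integral_def
        by (rule integral_mono[OF int[OF B', unfolded set_integrable_def] i]) (auto simp: indicator_def)
      hence "ennreal (\<rho> B) \<le> ennreal (\<integral>x. max 0 (g x) * indicator B x \<partial>Q)"
        by (rule ennreal_leI)
      also have "\<dots> = (\<integral>\<^sup>+x. ennreal (max 0 (g x) * indicator B x) \<partial>Q)"
        by (intro nn_integral_eq_integral[symmetric] i) auto
      also have "\<dots> = (\<integral>\<^sup>+x. ennreal (g x) * indicator B x \<partial>Q)"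
        by (intro nn_integral_cong) (auto simp: indicator_def max_def ennreal_neg)
      also have "\<dots> \<le> (\<integral>\<^sup>+x. ennreal (g x) * indicator A x \<partial>Q)"
        using B by (intro nn_integral_mono) (auto simp: indicator_def)
      also have "\<dots> = emeasure ?D A" using A sets by (simp add: emeasure_density)
      finally show "ennreal (\<rho> B) \<le> emeasure ?D A" .
    qed
    have gB: "{x. g x > 0} \<in> sets borel"
      using measurable_sets[of g Q borel "{0<..}"] sets space by (auto simp: vimage_def)
    have AB: "A \<inter> {x. g x > 0} \<in> sets borel" using A gB by auto
    have "emeasure ?D A = (\<integral>\<^sup>+x. ennreal (g x) * indicator A x \<partial>Q)"
      using A sets by (simp add: emeasure_density)
    also have "\<dots> = (\<integral>\<^sup>+x. ennreal (g x * indicator (A \<inter> {x. g x > 0}) x) \<partial>Q)"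
      by (intro nn_integral_cong) (auto simp: indicator_def ennreal_neg)
    also have "\<dots> = ennreal (\<integral>x. g x * indicator (A \<inter> {x. g x > 0}) x \<partial>Q)"
      using AB g sets by (intro nn_integral_eq_integral integrable_real_mult_indicator) (auto simp: indicator_def)
    also have "\<dots> = ennreal (\<rho> (A \<inter> {x. g x > 0}))"
      unfolding \<rho>[OF AB] by (simp add: set_lebesgue_integral_def mult.commute)
    also have "\<dots> \<le> (SUP B\<in>{B \<in> sets borel. B \<subseteq> A}. ennreal (\<rho> B))"
      using AB by (intro SUP_upper) auto
    finally show "emeasure ?D A \<le> (SUP B\<in>{B \<in> sets borel. B \<subseteq> A}. ennreal (\<rho> B))" .
  qed
  have "pos_variation \<rho> = measure_of UNIV (sets borel) (emeasure ?D)"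
    unfolding pos_variation_def
  proof (rule measure_of_eq)
    fix A assume "A \<in> sigma_sets UNIV (sets (borel :: 'a measure))"
    hence "A \<in> sets borel" using sets.sigma_sets_eq[of "borel :: 'a measure"] by simp
    thus "(SUP B\<in>{B \<in> sets borel. B \<subseteq> A}. ennreal (\<rho> B)) = emeasure ?D A" by (rule eq)
  qed auto
  also have "\<dots> = ?D" using measure_of_of_measure[of ?D] sets space by simp
  finally show ?thesis .
qed

text \<open>The two variations have the densities \<open>max 0 (g x)\<close> and
  \<open>max 0 (- g x)\<close>, whose difference is \<open>g x\<close>.\<close>

lemma signed_integral_density:
  fixes Q :: "'a::topological_space measure" and g :: "'a \<Rightarrow> real"
    and f :: "'a \<Rightarrow> 'b::{banach, second_countable_topology}"
  assumes sets: "sets Q = sets borel" and g: "integrable Q g"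
    and \<rho>: "\<And>A. A \<in> sets borel \<Longrightarrow> \<rho> A = (LINT x:A|Q. g x)"
    and f: "f \<in> borel_measurable borel" "\<And>x. norm (f x) \<le> B"
  shows "signed_integral \<rho> f = (\<integral>x. g x *\<^sub>R f x \<partial>Q)"
proof -
  have [measurable]: "f \<in> borel_measurable Q" by (rule borel_measurable_sets_eq[OF sets f(1)])
  have [measurable]: "g \<in> borel_measurable Q" using g by simp
  have B: "B \<ge> 0" using order_trans[OF norm_ge_zero f(2)] .
  have pv: "(\<integral>x. f x \<partial>pos_variation \<rho>') = (\<integral>x. max 0 (g' x) *\<^sub>R f x \<partial>Q)"
    "integrable Q (\<lambda>x. max 0 (g' x) *\<^sub>R f x)"
    if g': "integrable Q g'" "\<And>A. A \<in> sets borel \<Longrightarrow> \<rho>' A = (LINT x:A|Q. g' x)" for \<rho>' g'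
  proof -
    have [measurable]: "g' \<in> borel_measurable Q" using g' by simp
    have "density Q (\<lambda>x. ennreal (g' x)) = density Q (\<lambda>x. ennreal (max 0 (g' x)))"
      by (intro density_cong) (auto simp: max_def ennreal_neg)
    hence "pos_variation \<rho>' = density Q (\<lambda>x. ennreal (max 0 (g' x)))"
      using pos_variation_density[OF sets g'] by simp
    thus "(\<integral>x. f x \<partial>pos_variation \<rho>') = (\<integral>x. max 0 (g' x) *\<^sub>R f x \<partial>Q)"
      by (simp only:) (rule integral_density, auto)
    show "integrable Q (\<lambda>x. max 0 (g' x) *\<^sub>R f x)"
      by (rule integrable_scaleR_bounded[OF _ sets f]) (use g' in simp)
  qed
  have \<rho>': "- \<rho> A = (LINT x:A|Q. - g x)" if "A \<in> sets borel" for A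
    using \<rho>[OF that] by (simp add: set_lebesgue_integral_def)
  have "signed_integral \<rho> f = (\<integral>x. max 0 (g x) *\<^sub>R f x \<partial>Q) - (\<integral>x. max 0 (- g x) *\<^sub>R f x \<partial>Q)"
    unfolding signed_integral_def neg_variation_def
    using pv(1)[of g \<rho>, OF g \<rho>] pv(1)[of "\<lambda>x. - g x" "\<lambda>A. - \<rho> A", OF _ \<rho>'] g by simp
  also have "\<dots> = (\<integral>x. max 0 (g x) *\<^sub>R f x - max 0 (- g x) *\<^sub>R f x \<partial>Q)"
    using pv(2)[of g \<rho>, OF g \<rho>] pv(2)[of "\<lambda>x. - g x" "\<lambda>A. - \<rho> A", OF _ \<rho>'] g
    by (intro Bochner_Integration.integral_diff[symmetric]) auto
  also have "\<dots> = (\<integral>x. g x *\<^sub>R f x \<partial>Q)"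
    by (intro Bochner_Integration.integral_cong) (auto simp: max_def scaleR_left_diff_distrib[symmetric])
  finally show ?thesis .
qed

lemma finite_signed_measure_density:
  fixes Q :: "'a::topological_space measure" and g :: "'a \<Rightarrow> real"
  assumes sets: "sets Q = sets borel" and g: "integrable Q g"
    and \<rho>: "\<And>A. A \<in> sets borel \<Longrightarrow> \<rho> A = (LINT x:A|Q. g x)"
  shows "finite_signed_measure \<rho>"
  unfolding finite_signed_measure_def
proof (intro conjI allI impI)
  show "\<rho> {} = 0" using \<rho>[of "{}"] by (simp add: set_lebesgue_integral_def)
  fix A :: "nat \<Rightarrow> 'a set" assume A: "range A \<subseteq> sets borel \<and> disjoint_family A"
  hence Ai: "A i \<in> sets borel" for i by auto
  have [measurable]: "g \<in> borel_measurable Q" "\<And>i. A i \<in> sets Q" using g Ai sets by auto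
  have int: "integrable Q (\<lambda>x. indicator (A i) x *\<^sub>R g x)" for i
    using g Ai sets by (intro integrable_mult_indicator) auto
  have "(\<lambda>n. \<integral>x. indicator (\<Union>i<n. A i) x *\<^sub>R g x \<partial>Q) \<longlonglongrightarrow> (\<integral>x. indicator (\<Union>i. A i) x *\<^sub>R g x \<partial>Q)"
  proof (rule integral_dominated_convergence[where w="\<lambda>x. \<bar>g x\<bar>"])
    show "AE x in Q. (\<lambda>n. indicator (\<Union>i<n. A i) x *\<^sub>R g x) \<longlonglongrightarrow> indicator (\<Union>i. A i) x *\<^sub>R g x"
      by (intro AE_I2 tendsto_scaleR tendsto_const LIMSEQ_indicator_UN)
  qed (use g in \<open>auto simp: indicator_def\<close>)
  moreover have "(\<integral>x. indicator (\<Union>i<n. A i) x *\<^sub>R g x \<partial>Q) = (\<Sum>i<n. LINT x:A i|Q. g x)" for n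
  proof -
    have "disjoint_family_on A {..<n}" using A by (auto simp: disjoint_family_on_def)
    hence "(\<integral>x. indicator (\<Union>i<n. A i) x *\<^sub>R g x \<partial>Q) = (\<integral>x. (\<Sum>i<n. indicator (A i) x *\<^sub>R g x) \<partial>Q)"
      by (simp add: indicator_UN_disjoint sum_distrib_right)
    also have "\<dots> = (\<Sum>i<n. \<integral>x. indicator (A i) x *\<^sub>R g x \<partial>Q)"
      by (rule Bochner_Integration.integral_sum) (rule int)
    finally show ?thesis by (simp add: set_lebesgue_integral_def)
  qed
  ultimately have "(\<lambda>i. LINT x:A i|Q. g x) sums (LINT x:(\<Union>i. A i)|Q. g x)"
    by (simp add: sums_def set_lebesgue_integral_def)
  thus "(\<lambda>i. \<rho> (A i)) sums \<rho> (\<Union>i. A i)" using Ai \<rho> by (simp add: sets.countable_UN)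
qed

text \<open>If \<open>\<rho>\<close> were unbounded on the subsets of \<open>E\<close>, one could split off a piece of measure more than
  1 in absolute value and keep a remainder with the same property; the disjoint pieces obtained in
  this way contradict countable additivity.\<close>

lemma finite_signed_measure_bounded:
  fixes \<rho> :: "'a::topological_space set \<Rightarrow> real"
  assumes \<rho>: "finite_signed_measure \<rho>"
  shows "\<exists>K. \<forall>B\<in>sets borel. \<bar>\<rho> B\<bar> \<le> K"
proof (rule ccontr)
  assume unb: "\<not> (\<exists>K. \<forall>B\<in>sets borel. \<bar>\<rho> B\<bar> \<le> K)"
  have \<rho>0: "\<rho> {} = 0" using \<rho> by (simp add: finite_signed_measure_def)
  have ca: "(\<lambda>i. \<rho> (A i)) sums \<rho> (\<Union>i. A i)" if "range A \<subseteq> sets borel" "disjoint_family A" for A :: "nat \<Rightarrow> 'a set"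
    using \<rho> that by (simp add: finite_signed_measure_def)
  have add: "\<rho> (A \<union> B) = \<rho> A + \<rho> B" if "A \<in> sets borel" "B \<in> sets borel" "A \<inter> B = {}" for A B
  proof -
    have "(\<lambda>i. \<rho> (binaryset A B i)) sums \<rho> (\<Union>i. binaryset A B i)"
      by (intro ca) (use that in \<open>auto simp: range_binaryset_eq disjoint_family_on_def binaryset_def\<close>)
    moreover have "(\<lambda>i. \<rho> (binaryset A B i)) sums (\<Sum>i\<in>{0,1}. \<rho> (binaryset A B i))"
      by (intro sums_finite) (auto simp: binaryset_def \<rho>0)
    ultimately show ?thesis
      using sums_unique2 by (fastforce simp: binaryset_def UN_binaryset_eq[unfolded binaryset_def])
  qed
  define bad where "bad E \<longleftrightarrow> E \<in> sets borel \<and> (\<forall>K. \<exists>B\<in>sets borel. B \<subseteq> E \<and> \<bar>\<rho> B\<bar> > K)" for E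
  have "\<exists>E'. bad E' \<and> E' \<subseteq> E \<and> \<bar>\<rho> (E - E')\<bar> > 1" if "bad E" for E
  proof -
    have E: "E \<in> sets borel" using that by (simp add: bad_def)
    \<comment> \<open>The margin \<open>\<bar>\<rho> E\<bar> + 1\<close> makes both \<open>B\<close>
      and \<open>E - B\<close> have measure above 1 in absolute value, so whichever of them is kept
      as the remainder, the piece split off is large.\<close>
    obtain B where B: "B \<in> sets borel" "B \<subseteq> E" "\<bar>\<rho> B\<bar> > \<bar>\<rho> E\<bar> + 1"
      using \<open>bad E\<close> unfolding bad_def by blast
    have "\<rho> E = \<rho> B + \<rho> (E - B)" using add[of B "E - B"] B E by (simp add: Un_absorb1)
    hence B': "\<bar>\<rho> (E - B)\<bar> > 1" "\<bar>\<rho> B\<bar> > 1" using B(3) by linarith+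
    show ?thesis
    proof (cases "bad B")
      case True thus ?thesis using B B' by blast
    next
      case False
      then obtain K1 where K1: "\<And>C. C \<in> sets borel \<Longrightarrow> C \<subseteq> B \<Longrightarrow> \<bar>\<rho> C\<bar> \<le> K1"
        using B(1) unfolding bad_def by (meson not_le)
      have "bad (E - B)"
        unfolding bad_def
      proof (intro conjI allI)
        show "E - B \<in> sets borel" using E B by auto
        fix K
        obtain C where C: "C \<in> sets borel" "C \<subseteq> E" "\<bar>\<rho> C\<bar> > K + K1"
          using \<open>bad E\<close> unfolding bad_def by blast
        have "\<rho> C = \<rho> (C \<inter> B) + \<rho> (C - B)" using add[of "C \<inter> B" "C - B"] C B
          by (simp add: Int_Diff_Un Diff_Int_distrib2 inf_assoc)
        moreover have "\<bar>\<rho> (C \<inter> B)\<bar> \<le> K1" using C B by (intro K1) auto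
        ultimately have "\<bar>\<rho> (C - B)\<bar> > K" using C(3) by linarith
        thus "\<exists>D\<in>sets borel. D \<subseteq> E - B \<and> \<bar>\<rho> D\<bar> > K" using C B by (intro bexI[of _ "C - B"]) auto
      qed
      moreover have "E - (E - B) = B" using B(2) by auto
      ultimately show ?thesis using B' by (intro exI[of _ "E - B"]) auto
    qed
  qed
  then obtain S where S: "\<And>E. bad E \<Longrightarrow> bad (S E) \<and> S E \<subseteq> E \<and> \<bar>\<rho> (E - S E)\<bar> > 1" by metis
  define E where "E i = (S ^^ i) UNIV" for i
  have bad_E: "bad (E i)" for i
  proof (induction i)
    case 0 show ?case using unb unfolding bad_def E_def by (simp add: not_le)
  next
    case (Suc i) thus ?case using S by (simp add: E_def)
  qed
  have dec: "E (Suc i) \<subseteq> E i" for i using S[OF bad_E[of i]] by (simp add: E_def)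
  have anti: "E j \<subseteq> E i" if "i \<le> j" for i j using lift_Suc_antimono_le[of E, OF dec that] .
  define A where "A i = E i - E (Suc i)" for i
  have "disjoint_family A"
    unfolding disjoint_family_on_def
  proof (intro ballI impI)
    fix i j :: nat assume "i \<noteq> j"
    show "A i \<inter> A j = {}"
      using anti[of "Suc i" j] anti[of "Suc j" i] \<open>i \<noteq> j\<close> unfolding A_def by (cases "i < j") auto
  qed
  moreover have "range A \<subseteq> sets borel" using bad_E by (auto simp: A_def bad_def)
  ultimately have "(\<lambda>i. \<rho> (A i)) \<longlonglongrightarrow> 0" using ca sums_summable summable_LIMSEQ_zero by blast
  moreover have "\<bar>\<rho> (A i)\<bar> > 1" for i using S[OF bad_E[of i]] by (simp add: A_def E_def)
  ultimately have "1 \<le> (0::real)"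
    by (intro LIMSEQ_le_const[OF tendsto_rabs_zero]) (auto intro: less_imp_le)
  thus False by simp
qed

text \<open>\<open>measure_of\<close> returns the given set function if that is a measure and 0
  otherwise. In either case the total mass is at most the supremum, so a bound on
  \<open>\<rho>\<close> is enough.\<close>

lemma finite_pos_variation:
  fixes \<rho> :: "'a::topological_space set \<Rightarrow> real"
  assumes K: "\<forall>B\<in>sets borel. \<bar>\<rho> B\<bar> \<le> K"
  shows "finite_measure (pos_variation \<rho>)"
proof (rule finite_measureI)
  have "(SUP B\<in>{B \<in> sets borel. B \<subseteq> UNIV}. ennreal (\<rho> B)) \<le> ennreal K"
    using K by (intro SUP_least ennreal_leI) (auto simp: abs_le_iff)
  hence "(SUP B\<in>{B \<in> sets borel. B \<subseteq> UNIV}. ennreal (\<rho> B)) < \<infinity>"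
    by (rule le_less_trans) simp
  moreover have "emeasure (pos_variation \<rho>) (space (pos_variation \<rho>))
      \<le> (SUP B\<in>{B \<in> sets borel. B \<subseteq> UNIV}. ennreal (\<rho> B))"
    unfolding pos_variation_def emeasure_measure_of_conv space_measure_of_conv
    by (rule if_split[where P="\<lambda>y. y \<le> _", THEN iffD2]) simp
  ultimately show "emeasure (pos_variation \<rho>) (space (pos_variation \<rho>)) \<noteq> \<infinity>"
    using le_less_trans by (metis less_irrefl)
qed

lemma sets_pos_variation: "sets (pos_variation \<rho>) = sets borel"
  unfolding pos_variation_def
  by (subst sets_measure_of) (auto simp: sets.sigma_sets_eq[of borel, simplified])

text \<open>Weak convergence is stated for real test functions while the kernels are complex.
  Splitting the integral needs integrability against both variations, which the boundedness of
  \<open>\<rho>\<close> provides.\<close>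

lemma signed_integral_Re_Im:
  fixes f :: "'a::topological_space \<Rightarrow> complex"
  assumes \<rho>: "finite_signed_measure \<rho>" and f: "f \<in> borel_measurable borel" "\<And>x. norm (f x) \<le> B"
  shows "Re (signed_integral \<rho> f) = signed_integral \<rho> (\<lambda>x. Re (f x))"
    and "Im (signed_integral \<rho> f) = signed_integral \<rho> (\<lambda>x. Im (f x))"
proof -
  obtain K where K: "\<forall>B\<in>sets borel. \<bar>\<rho> B\<bar> \<le> K" using finite_signed_measure_bounded[OF \<rho>] by blast
  hence K': "\<forall>B\<in>sets borel. \<bar>- \<rho> B\<bar> \<le> K" by simp
  have "integrable (pos_variation \<rho>) f"
    by (rule integrable_bounded[OF finite_pos_variation[OF K] sets_pos_variation f])
  moreover have "integrable (neg_variation \<rho>) f" unfolding neg_variation_def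
    by (rule integrable_bounded[OF finite_pos_variation[OF K'] sets_pos_variation f])
  ultimately show "Re (signed_integral \<rho> f) = signed_integral \<rho> (\<lambda>x. Re (f x))"
    "Im (signed_integral \<rho> f) = signed_integral \<rho> (\<lambda>x. Im (f x))"
    by (simp_all add: signed_integral_def)
qed

section \<open>Sums and differences of finite measures\<close>

definition add_measure :: "'a::topological_space measure \<Rightarrow> 'a measure \<Rightarrow> 'a measure" where
  "add_measure P N = measure_of UNIV (sets borel) (\<lambda>A. emeasure P A + emeasure N A)"

lemma sets_add_measure: "sets (add_measure P N) = sets borel"
  unfolding add_measure_def
  by (subst sets_measure_of) (auto simp: sets.sigma_sets_eq[of borel, simplified])

lemma emeasure_add_measure:
  assumes "sets P = sets borel" "sets N = sets borel" "A \<in> sets borel"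
  shows "emeasure (add_measure P N) A = emeasure P A + emeasure N A"
  unfolding add_measure_def
proof (rule emeasure_measure_of_sigma)
  show "sigma_algebra UNIV (sets (borel :: 'a measure))"
    using sets.sigma_algebra_axioms[of "borel :: 'a measure"] by simp
  show "positive (sets borel) (\<lambda>A. emeasure P A + emeasure N A)" by (simp add: positive_def)
  show "countably_additive (sets borel) (\<lambda>A. emeasure P A + emeasure N A)"
  proof (rule countably_additiveI)
    fix A :: "nat \<Rightarrow> 'a set" assume A: "range A \<subseteq> sets borel" "disjoint_family A"
    have "(\<Sum>i. emeasure P (A i) + emeasure N (A i)) = (\<Sum>i. emeasure P (A i)) + (\<Sum>i. emeasure N (A i))"
      by (rule suminf_add[symmetric]) auto
    thus "(\<Sum>i. emeasure P (A i) + emeasure N (A i)) = emeasure P (\<Union>i. A i) + emeasure N (\<Union>i. A i)"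
      using suminf_emeasure[of A P] suminf_emeasure[of A N] A assms by simp
  qed
qed fact

lemma finite_add_measure:
  assumes "finite_measure P" "finite_measure N" "sets P = sets borel" "sets N = sets borel"
  shows "finite_measure (add_measure P N)"
proof (rule finite_measureI)
  interpret P: finite_measure P by fact
  interpret N: finite_measure N by fact
  have "space (add_measure P N) = UNIV" using sets_eq_imp_space_eq[OF sets_add_measure] by simp
  thus "emeasure (add_measure P N) (space (add_measure P N)) \<noteq> \<infinity>"
    using assms by (simp add: emeasure_add_measure)
qed

text \<open>The sum dominates both summands, so Radon-Nikodym supplies real nonnegative densities
  with respect to one common reference measure.\<close>

lemma add_measure_densities:
  assumes P: "finite_measure P" "sets P = sets borel" and N: "finite_measure N" "sets N = sets borel"
  obtains p q where "integrable (add_measure P N) p" "integrable (add_measure P N) q"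
    "\<And>x. 0 \<le> p x" "\<And>x. 0 \<le> q x"
    "P = density (add_measure P N) p" "N = density (add_measure P N) q"
proof -
  define S where "S = add_measure P N"
  have sS: "sets S = sets borel" by (simp add: S_def sets_add_measure)
  interpret S: finite_measure S unfolding S_def by (intro finite_add_measure P N)
  have RN: "\<exists>p. integrable S p \<and> (\<forall>x. 0 \<le> p x) \<and> M = density S p"
    if M: "finite_measure M" "sets M = sets borel" and le: "\<And>A. A \<in> sets borel \<Longrightarrow> emeasure M A \<le> emeasure S A" for M
  proof -
    have ac: "absolutely_continuous S M"
      unfolding absolutely_continuous_def
    proof
      fix A assume "A \<in> null_sets S"
      hence "A \<in> sets borel" "emeasure S A = 0" using sS by (auto simp: null_sets_def)
      thus "A \<in> null_sets M" using le[of A] M(2) by (auto simp: null_sets_def)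
    qed
    have sM: "sets M = sets S" using M sS by simp
    obtain p where p: "p \<in> borel_measurable S" "AE x in S. RN_deriv S M x = ennreal (p x)" "\<And>x. 0 \<le> p x"
      using S.real_RN_deriv[OF M(1) ac sM] by metis
    have "M = density S (RN_deriv S M)" using S.density_RN_deriv[OF ac sM] by simp
    also have "\<dots> = density S p" using p by (intro density_cong) auto
    finally have eq: "M = density S p" .
    have "emeasure M (space M) < \<infinity>" using finite_measure.emeasure_finite[OF M(1)] by (simp add: less_top)
    also have "emeasure M (space M) = (\<integral>\<^sup>+x. ennreal (p x) \<partial>S)"
    proof -
      have "emeasure M (space M) = emeasure (density S p) (space S)"
        using eq by (metis space_density)
      also have "\<dots> = (\<integral>\<^sup>+x. ennreal (p x) \<partial>S)"
        by (subst emeasure_density) (use p(1) in \<open>auto intro!: nn_integral_cong\<close>)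
      finally show ?thesis .
    qed
    finally have "integrable S p" using p by (simp add: integrable_iff_bounded)
    thus ?thesis using p eq by blast
  qed
  have le: "emeasure P A \<le> emeasure S A" "emeasure N A \<le> emeasure S A" if "A \<in> sets borel" for A
    unfolding S_def emeasure_add_measure[OF P(2) N(2) that] by simp_all
  obtain p where p: "integrable S p" "\<forall>x. 0 \<le> p x" "P = density S p"
    using RN[OF P le(1)] by blast
  obtain q where q: "integrable S q" "\<forall>x. 0 \<le> q x" "N = density S q"
    using RN[OF N le(2)] by blast
  show ?thesis
    by (rule that[folded S_def, OF p(1) q(1) p(2)[rule_format] q(2)[rule_format] p(3) q(3)])
qed

lemma integral_add_measure:
  fixes f :: "'a::topological_space \<Rightarrow> 'b::{banach, second_countable_topology}"
  assumes P: "finite_measure P" "sets P = sets borel" and N: "finite_measure N" "sets N = sets borel"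
    and f: "f \<in> borel_measurable borel" "\<And>x. norm (f x) \<le> B"
  shows "(\<integral>x. f x \<partial>add_measure P N) = (\<integral>x. f x \<partial>P) + (\<integral>x. f x \<partial>N)"
proof -
  obtain p q where pq: "integrable (add_measure P N) p" "integrable (add_measure P N) q"
    "\<And>x. 0 \<le> p x" "\<And>x. 0 \<le> q x"
    "P = density (add_measure P N) p" "N = density (add_measure P N) q"
    using add_measure_densities[OF P N] by blast
  define S where "S = add_measure P N"
  note pq = pq[folded S_def]
  have sS: "sets S = sets borel" by (simp add: S_def sets_add_measure)
  have [measurable]: "f \<in> borel_measurable S" "p \<in> borel_measurable S" "q \<in> borel_measurable S"
    using borel_measurable_sets_eq[OF sS f(1)] pq(1,2) by auto
  interpret S: finite_measure S unfolding S_def by (intro finite_add_measure P N)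
  have B: "B \<ge> 0" using order_trans[OF norm_ge_zero f(2)] .
  note ib = integrable_scaleR_bounded[OF _ sS f]
  have "S = density S (\<lambda>x. ennreal (p x + q x))"
  proof (rule measure_eqI)
    fix A assume A: "A \<in> sets S"
    hence A': "A \<in> sets borel" using sS by simp
    have "emeasure S A = emeasure (density S p) A + emeasure (density S q) A"
      unfolding pq(5)[symmetric] pq(6)[symmetric] unfolding S_def
      by (rule emeasure_add_measure[OF P(2) N(2) A'])
    also have "\<dots> = (\<integral>\<^sup>+x. ennreal (p x) * indicator A x + ennreal (q x) * indicator A x \<partial>S)"
      using A by (subst nn_integral_add) (auto simp: emeasure_density)
    also have "\<dots> = emeasure (density S (\<lambda>x. ennreal (p x + q x))) A"
      using A pq(3,4) by (subst emeasure_density) (auto simp: distrib_right intro!: nn_integral_cong)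
    finally show "emeasure S A = emeasure (density S (\<lambda>x. ennreal (p x + q x))) A" .
  qed simp
  hence "(\<integral>x. f x \<partial>S) = (\<integral>x. f x \<partial>density S (\<lambda>x. ennreal (p x + q x)))"
    by (rule arg_cong[where f="\<lambda>S. \<integral>x. f x \<partial>S"])
  also have "\<dots> = (\<integral>x. (p x + q x) *\<^sub>R f x \<partial>S)"
    using pq(3,4) by (intro integral_density) auto
  also have "\<dots> = (\<integral>x. p x *\<^sub>R f x \<partial>S) + (\<integral>x. q x *\<^sub>R f x \<partial>S)"
    unfolding scaleR_left_distrib by (rule Bochner_Integration.integral_add) (intro ib pq(1,2))+
  also have "(\<integral>x. p x *\<^sub>R f x \<partial>S) = (\<integral>x. f x \<partial>P)"
    by (subst pq(5), rule integral_density[symmetric]) (use pq(1-4) in auto)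
  also have "(\<integral>x. q x *\<^sub>R f x \<partial>S) = (\<integral>x. f x \<partial>N)"
    by (subst pq(6), rule integral_density[symmetric]) (use pq(1-4) in auto)
  finally show ?thesis by (simp add: S_def)
qed

text \<open>\<open>P\<close> and \<open>N\<close> need not be mutually singular, so in general they
  are not the two variations of their difference. Writing the difference with density
  \<open>p - q\<close> against the sum gives the formula for integrals all the same.\<close>

lemma difference_signed_measure:
  fixes P N :: "'a::topological_space measure"
  assumes P: "finite_measure P" "sets P = sets borel" and N: "finite_measure N" "sets N = sets borel"
  obtains \<rho> where "finite_signed_measure \<rho>"
    "\<And>(f :: 'a \<Rightarrow> real) B. f \<in> borel_measurable borel \<Longrightarrow> (\<And>x. norm (f x) \<le> B) \<Longrightarrow>
       signed_integral \<rho> f = (\<integral>x. f x \<partial>P) - (\<integral>x. f x \<partial>N)"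
proof -
  obtain p q where pq: "integrable (add_measure P N) p" "integrable (add_measure P N) q"
    "\<And>x. 0 \<le> p x" "\<And>x. 0 \<le> q x"
    "P = density (add_measure P N) p" "N = density (add_measure P N) q"
    using add_measure_densities[OF P N] by blast
  define S where "S = add_measure P N"
  note pq = pq[folded S_def]
  have sS: "sets S = sets borel" by (simp add: S_def sets_add_measure)
  define \<rho> where "\<rho> A = (LINT x:A|S. p x - q x)" for A
  have i: "integrable S (\<lambda>x. p x - q x)" using pq(1,2) by simp
  show ?thesis
  proof (rule that)
    show "finite_signed_measure \<rho>"
      by (rule finite_signed_measure_density[OF sS i]) (simp add: \<rho>_def)
    fix f :: "'a \<Rightarrow> real" and B assume f: "f \<in> borel_measurable borel" "\<And>x. norm (f x) \<le> B"
    have [measurable]: "f \<in> borel_measurable S" "p \<in> borel_measurable S" "q \<in> borel_measurable S"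
      using borel_measurable_sets_eq[OF sS f(1)] pq(1,2) by auto
    have B: "B \<ge> 0" using order_trans[OF norm_ge_zero f(2)] .
    note ib = integrable_scaleR_bounded[OF _ sS f]
    have "signed_integral \<rho> f = (\<integral>x. (p x - q x) *\<^sub>R f x \<partial>S)"
      by (rule signed_integral_density[OF sS i _ f]) (simp add: \<rho>_def)
    also have "\<dots> = (\<integral>x. p x *\<^sub>R f x \<partial>S) - (\<integral>x. q x *\<^sub>R f x \<partial>S)"
      unfolding scaleR_left_diff_distrib by (rule Bochner_Integration.integral_diff) (intro ib pq(1,2))+
    also have "(\<integral>x. p x *\<^sub>R f x \<partial>S) = (\<integral>x. f x \<partial>P)"
      by (subst pq(5), rule integral_density[symmetric]) (use pq(1-4) in auto)
    also have "(\<integral>x. q x *\<^sub>R f x \<partial>S) = (\<integral>x. f x \<partial>N)"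
      by (subst pq(6), rule integral_density[symmetric]) (use pq(1-4) in auto)
    finally show "signed_integral \<rho> f = (\<integral>x. f x \<partial>P) - (\<integral>x. f x \<partial>N)" .
  qed
qed

text \<open>\<open>P\<close> and \<open>P'\<close> cannot be compared directly. Moving the negative
  parts across turns the hypothesis into an equality of weighted transforms of the positive measures
  \<open>P + N'\<close> and \<open>P' + N\<close>.\<close>

lemma signed_determined_by_wkernel:
  fixes P N P' N' :: "(real \<times> real) measure" and f :: "real \<times> real \<Rightarrow> real"
  assumes P: "finite_measure P" "sets P = sets borel" and N: "finite_measure N" "sets N = sets borel"
    and P': "finite_measure P'" "sets P' = sets borel" and N': "finite_measure N'" "sets N' = sets borel"
    and eq: "\<And>z w. Im z \<noteq> 0 \<Longrightarrow> Im w \<noteq> 0 \<Longrightarrow>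
      wtransform P z w - wtransform N z w = wtransform P' z w - wtransform N' z w"
    and f: "f \<in> borel_measurable borel" "\<And>x. norm (f x) \<le> B"
  shows "(\<integral>x. f x \<partial>P) - (\<integral>x. f x \<partial>N) = (\<integral>x. f x \<partial>P') - (\<integral>x. f x \<partial>N')"
proof -
  have "add_measure P N' = add_measure P' N"
  proof (rule measure_eqI_wkernel)
    fix z w assume zw: "Im z \<noteq> 0" "Im w \<noteq> 0"
    show "wtransform (add_measure P N') z w = wtransform (add_measure P' N) z w"
      using eq[OF zw] integral_add_measure[OF P N' wkernel_measurable wkernel_le[OF zw]]
        integral_add_measure[OF P' N wkernel_measurable wkernel_le[OF zw]] by (simp add: algebra_simps)
  qed (intro finite_add_measure P N P' N' sets_add_measure)+
  thus ?thesis
    using integral_add_measure[OF P N' f] integral_add_measure[OF P' N f] by simp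
qed

section \<open>Weak compactness in the plane\<close>

definition wave :: "real \<Rightarrow> real" where
  "wave t = max 0 (min 1 (1 / 2 - cos (2 * pi * t)))"

lemma wave_bounds: "0 \<le> wave t" "wave t \<le> 1"
  by (simp_all add: wave_def)

lemma wave_periodic: "wave (t + real n) = wave t"
proof -
  have "cos (2 * pi * (t + real n)) = cos (2 * pi * t + real n * (2 * pi))"
    by (simp add: algebra_simps)
  also have "\<dots> = cos (2 * pi * t)"
    using cos.plus_of_nat[of "2 * pi * t" n] by simp
  finally show ?thesis by (simp add: wave_def)
qed

lemma continuous_wave: "continuous_on A wave"
  unfolding wave_def by (intro continuous_intros)

text \<open>Base-4 expansion with the digits 0 and 2 only. Everything after the first digit
  contributes at most 1/6, and the resulting gap lets a continuous function read off the
  digit.\<close>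

definition expand4 :: "(nat \<Rightarrow> real) \<Rightarrow> real" where
  "expand4 c = (\<Sum>j. 2 * c j / 4 ^ Suc j)"

lemma expand4_summable:
  fixes c :: "nat \<Rightarrow> real"
  assumes "\<And>j. c j \<in> {0, 1}"
  shows "summable (\<lambda>j. 2 * c j / 4 ^ Suc j)"
proof (rule summable_comparison_test'[where N=0])
  show "summable (\<lambda>j. 2 / 4 * (1 / 4) ^ j :: real)"
    by (intro summable_mult summable_geometric) simp
  show "norm (2 * c j / 4 ^ Suc j) \<le> 2 / 4 * (1 / 4) ^ j" for j
    using assms[of j] by (auto simp: power_divide)
qed

lemma expand4_Suc:
  assumes "\<And>j. c j \<in> {0, 1}"
  shows "expand4 c = c 0 / 2 + expand4 (\<lambda>j. c (Suc j)) / 4"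
proof -
  have s: "summable (\<lambda>j. 2 * c j / 4 ^ Suc j)" by (rule expand4_summable) (rule assms)
  have "expand4 c = (\<Sum>j. 2 * c (Suc j) / 4 ^ Suc (Suc j)) + 2 * c 0 / 4 ^ Suc 0"
    unfolding expand4_def using suminf_split_head[OF s] by linarith
  also have "(\<Sum>j. 2 * c (Suc j) / 4 ^ Suc (Suc j)) = (\<Sum>j. (2 * c (Suc j) / 4 ^ Suc j) / 4)"
    by (simp add: field_simps)
  also have "\<dots> = expand4 (\<lambda>j. c (Suc j)) / 4"
    unfolding expand4_def by (rule suminf_divide[OF expand4_summable]) (rule assms)
  finally show ?thesis by simp
qed

lemma expand4_bounds:
  assumes "\<And>j. c j \<in> {0, 1}"
  shows "0 \<le> expand4 c" "expand4 c \<le> 2 / 3"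
proof -
  have c: "0 \<le> c j" "c j \<le> 1" for j using assms[of j] by auto
  show "0 \<le> expand4 c" unfolding expand4_def
    by (intro suminf_nonneg expand4_summable assms) (simp add: c)
  have s: "summable (\<lambda>j. 2 / 4 * (1 / 4) ^ j :: real)"
    by (intro summable_mult summable_geometric) simp
  have "expand4 c \<le> (\<Sum>j. 2 / 4 * (1 / 4) ^ j)"
    unfolding expand4_def
    using c by (intro suminf_le expand4_summable assms s) (auto simp: power_divide divide_right_mono)
  also have "\<dots> = 2 / 4 * (1 / (1 - 1 / 4))"
    by (subst suminf_mult) (auto simp: suminf_geometric)
  finally show "expand4 c \<le> 2 / 3" by simp
qed

text \<open>A first digit 0 puts the argument into the interval from 0 to 1/6, where the cosine of
  \<open>2 * pi * t\<close> is at least 1/2 and \<open>wave\<close> is 0; a first digit 2 puts it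
  between 1/2 and 2/3, where the cosine is at most -1/2 and \<open>wave\<close> is 1. This is the
  reason for truncating \<open>1 / 2 - cos\<close> in \<open>wave\<close>.\<close>

lemma wave_expand4:
  assumes c: "\<And>j. c j \<in> {0, 1}"
  shows "wave (expand4 c) = c 0"
proof -
  define \<tau> where "\<tau> = expand4 (\<lambda>j. c (Suc j)) / 4"
  have \<tau>: "0 \<le> \<tau>" "\<tau> \<le> 1 / 6" using expand4_bounds[of "\<lambda>j. c (Suc j)"] c by (auto simp: \<tau>_def)
  have "cos (2 * pi * \<tau>) \<ge> cos (pi / 3)"
  proof (rule cos_monotone_0_pi_le)
    show "2 * pi * \<tau> \<le> pi / 3"
      using mult_left_mono[OF \<tau>(2), of "2 * pi"] by simp
  qed (use \<tau> in auto)
  hence cos: "cos (2 * pi * \<tau>) \<ge> 1 / 2" by (simp add: cos_60)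
  have e: "expand4 c = c 0 / 2 + \<tau>" using expand4_Suc[of c, OF c] by (simp add: \<tau>_def)
  show ?thesis
  proof (cases "c 0 = 0")
    case True
    thus ?thesis using cos e by (simp add: wave_def)
  next
    case False
    hence c0: "c 0 = 1" using c[of 0] by auto
    have "cos (2 * pi * (1 / 2 + \<tau>)) = cos (2 * pi * \<tau> + pi)" by (simp add: algebra_simps)
    also have "\<dots> = - cos (2 * pi * \<tau>)" by simp
    finally show ?thesis using cos e c0 by (simp add: wave_def)
  qed
qed

text \<open>Multiplication by \<open>4 ^ n\<close> moves digit \<open>n\<close> to the front; the
  digits before it contribute an integer, which \<open>wave\<close> does not see because it has
  period 1.\<close>

lemma wave_power_expand4:
  assumes c: "\<And>j. c j \<in> {0, 1}"
  shows "wave (4 ^ n * expand4 c) = c n"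
  using c
proof (induction n arbitrary: c)
  case 0 thus ?case using wave_expand4[of c] by simp
next
  case (Suc n)
  have "\<exists>m. 4 ^ n * (2 * c 0) = real m"
    using Suc.prems[of 0] by (auto intro: exI[of _ "4 ^ n * 2"] exI[of _ 0])
  then obtain m where m: "4 ^ n * (2 * c 0) = real m" ..
  have "4 ^ Suc n * expand4 c = 4 ^ n * expand4 (\<lambda>j. c (Suc j)) + real m"
    unfolding expand4_Suc[of c, OF Suc.prems] m[symmetric] by (simp add: algebra_simps)
  hence "wave (4 ^ Suc n * expand4 c) = wave (4 ^ n * expand4 (\<lambda>j. c (Suc j)))"
    by (simp only: wave_periodic)
  thus ?case using Suc.IH[of "\<lambda>j. c (Suc j)"] Suc.prems by simp
qed

text \<open>Greedy doubling. The digit is 1 from 1/2 on and the remainder may equal 1, so that the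
  endpoint \<open>x = 1\<close> is covered, with all digits 1.\<close>

lemma binary_expansion:
  fixes x :: real
  assumes "0 \<le> x" "x \<le> 1"
  shows "\<exists>b. (\<forall>n. b n \<in> {0, 1}) \<and> (\<lambda>n. b n / 2 ^ Suc n) sums x"
proof -
  define d where "d r = (if r \<ge> 1 / 2 then 1 else 0 :: real)" for r :: real
  define r where "r n = ((\<lambda>r. 2 * r - d r) ^^ n) x" for n
  have r: "0 \<le> r n" "r n \<le> 1" for n
    by (induction n) (use assms in \<open>auto simp: r_def d_def\<close>)
  have part: "x - (\<Sum>j<n. d (r j) / 2 ^ Suc j) = r n / 2 ^ n" for n
  proof (induction n)
    case (Suc n)
    have "x - (\<Sum>j<Suc n. d (r j) / 2 ^ Suc j) = r n / 2 ^ n - d (r n) / 2 ^ Suc n"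
      using Suc by simp
    also have "\<dots> = (2 * r n - d (r n)) / 2 ^ Suc n" by (simp add: field_simps)
    also have "2 * r n - d (r n) = r (Suc n)" by (simp add: r_def)
    finally show ?case .
  qed (simp add: r_def)
  have "(\<lambda>n. r n / 2 ^ n) \<longlonglongrightarrow> 0"
  proof (rule tendsto_sandwich[of "\<lambda>_. 0" _ _ "\<lambda>n. (1 / 2) ^ n"])
    show "\<forall>\<^sub>F n in sequentially. r n / 2 ^ n \<le> (1 / 2) ^ n"
      using r by (auto simp: power_divide divide_right_mono)
  qed (use r in \<open>auto intro!: LIMSEQ_power_zero\<close>)
  hence "(\<lambda>n. x - r n / 2 ^ n) \<longlonglongrightarrow> x - 0" by (intro tendsto_intros)
  hence "(\<lambda>n. d (r n) / 2 ^ Suc n) sums x"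
    unfolding sums_def part[symmetric] by simp
  thus ?thesis by (intro exI[of _ "\<lambda>n. d (r n)"]) (auto simp: d_def)
qed

text \<open>Schoenberg's space-filling curve with base 4 and a truncated cosine: the digits of the
  parameter at even and odd places are the binary digits of the two coordinates.\<close>

definition curve_coord :: "nat \<Rightarrow> real \<Rightarrow> real" where
  "curve_coord k t = (\<Sum>n. wave (4 ^ (2 * n + k) * t) / 2 ^ Suc n)"

lemma curve_summand_le: "norm (wave s / 2 ^ Suc n) \<le> (1 / 2) ^ Suc n"
  using wave_bounds[of s] by (simp add: power_divide divide_right_mono)

lemma half_sums: "(\<lambda>n. (1 / 2) ^ Suc n :: real) sums 1"
  using power_half_series by simp

lemma continuous_curve_coord: "continuous_on UNIV (curve_coord k)"
proof -
  have lim: "uniform_limit UNIV (\<lambda>N t. \<Sum>n<N. wave (4 ^ (2 * n + k) * t) / 2 ^ Suc n) (curve_coord k) sequentially"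
    unfolding curve_coord_def
    by (rule Weierstrass_m_test[where M="\<lambda>n. (1 / 2) ^ Suc n"])
       (rule curve_summand_le, rule sums_summable[OF half_sums])
  have "continuous_on UNIV (\<lambda>t. wave (4 ^ (2 * n + k) * t))" for n
    by (rule continuous_on_compose2[OF continuous_wave[of UNIV]]) (auto intro!: continuous_intros)
  hence "\<forall>\<^sub>F N in sequentially. continuous_on UNIV (\<lambda>t. \<Sum>n<N. wave (4 ^ (2 * n + k) * t) / 2 ^ Suc n)"
    by (intro always_eventually allI continuous_on_sum continuous_on_divide) (auto intro!: continuous_intros)
  from uniform_limit_theorem[OF this lim] show ?thesis by simp
qed

lemma curve_surj:
  assumes "0 \<le> x" "x \<le> 1" "0 \<le> y" "y \<le> 1"
  shows "\<exists>t\<in>{0..1}. curve_coord 0 t = x \<and> curve_coord 1 t = y"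
proof -
  obtain a where a: "\<And>n. a n \<in> {0, 1}" "(\<lambda>n. a n / 2 ^ Suc n) sums x"
    using binary_expansion[of x] assms by blast
  obtain b where b: "\<And>n. b n \<in> {0, 1}" "(\<lambda>n. b n / 2 ^ Suc n) sums y"
    using binary_expansion[of y] assms by blast
  define c where "c j = (if even j then a (j div 2) else b (j div 2))" for j :: nat
  have c: "c j \<in> {0, 1}" for j using a b by (simp add: c_def)
  have "curve_coord 0 (expand4 c) = x"
    unfolding curve_coord_def wave_power_expand4[of c, OF c] using sums_unique[OF a(2)] by (simp add: c_def)
  moreover have "curve_coord 1 (expand4 c) = y"
    unfolding curve_coord_def wave_power_expand4[of c, OF c] using sums_unique[OF b(2)] by (simp add: c_def)
  moreover have "expand4 c \<in> {0..1}" using expand4_bounds[of c, OF c] by auto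
  ultimately show ?thesis by blast
qed

section \<open>A Borel section of the curve over the plane\<close>

definition squash :: "real \<Rightarrow> real" where "squash x = x / (1 + \<bar>x\<bar>)"
definition unsquash :: "real \<Rightarrow> real" where "unsquash y = y / (1 - \<bar>y\<bar>)"

lemma unsquash_squash: "unsquash (squash x) = x"
proof -
  have "1 - \<bar>squash x\<bar> = 1 / (1 + \<bar>x\<bar>)"
    by (simp add: squash_def abs_divide field_simps)
  thus ?thesis by (simp add: unsquash_def squash_def field_simps)
qed

lemma squash_bounds: "\<bar>squash x\<bar> < 1"
  by (simp add: squash_def abs_divide)

lemma continuous_squash: "continuous_on A squash"
  unfolding squash_def by (intro continuous_intros) auto

lemma abs_squash_le: "\<bar>x\<bar> \<le> K \<Longrightarrow> \<bar>squash x\<bar> \<le> squash K"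
  by (simp add: squash_def abs_divide field_simps)

definition curve :: "real \<Rightarrow> real \<times> real" where
  "curve t = (2 * curve_coord 0 t - 1, 2 * curve_coord 1 t - 1)"

lemma continuous_curve: "continuous_on A curve"
  unfolding curve_def
  by (intro continuous_intros continuous_on_subset[OF continuous_curve_coord]) auto

lemma curve_onto:
  assumes "\<bar>u\<bar> \<le> 1" "\<bar>v\<bar> \<le> 1"
  shows "\<exists>t\<in>{0..1}. curve t = (u, v)"
proof -
  have "\<exists>t\<in>{0..1}. curve_coord 0 t = (u + 1) / 2 \<and> curve_coord 1 t = (v + 1) / 2"
    by (rule curve_surj) (use assms in auto)
  then obtain t where "t \<in> {0..1}" "curve_coord 0 t = (u + 1) / 2" "curve_coord 1 t = (v + 1) / 2" by blast
  thus ?thesis by (intro bexI[of _ t]) (simp_all add: curve_def)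
qed

text \<open>The first parameter at which the curve meets the squashed point. Choosing the first one
  makes the section Borel: its sublevel sets are preimages of images of compact initial pieces of
  the parameter interval.\<close>

definition curve_time :: "real \<times> real \<Rightarrow> real" where
  "curve_time x = Inf {t \<in> {0..1}. curve t = (squash (fst x), squash (snd x))}"

lemma curve_time:
  "curve_time x \<in> {0..1}" "curve (curve_time x) = (squash (fst x), squash (snd x))"
  "t \<in> {0..1} \<Longrightarrow> curve t = (squash (fst x), squash (snd x)) \<Longrightarrow> curve_time x \<le> t"
proof -
  let ?S = "{t \<in> {0..1}. curve t = (squash (fst x), squash (snd x))}"
  have ne: "?S \<noteq> {}" using curve_onto[of "squash (fst x)" "squash (snd x)"] squash_bounds
    by (auto simp: less_imp_le)
  have bdd: "bdd_below ?S" by (rule bdd_belowI[of _ 0]) auto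
  have "closed ({0..1} \<inter> curve -` {(squash (fst x), squash (snd x))})"
    by (intro continuous_closed_preimage continuous_curve) auto
  hence "closed ?S" by (simp add: vimage_def Int_def)
  from closed_contains_Inf[OF ne bdd this]
  show "curve_time x \<in> {0..1}" "curve (curve_time x) = (squash (fst x), squash (snd x))"
    unfolding curve_time_def by auto
  show "curve_time x \<le> t" if "t \<in> {0..1}" "curve t = (squash (fst x), squash (snd x))"
    unfolding curve_time_def by (rule cInf_lower[OF _ bdd]) (use that in auto)
qed

lemma curve_time_measurable [measurable]: "curve_time \<in> borel_measurable borel"
  unfolding borel_measurable_iff_le
proof
  fix c :: real
  have eq: "{x. curve_time x \<le> c} = (\<lambda>x. (squash (fst x), squash (snd x))) -` (curve ` ({0..1} \<inter> {..c}))"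
  proof (intro equalityI subsetI)
    fix x assume "x \<in> {x. curve_time x \<le> c}"
    hence "curve_time x \<in> {0..1} \<inter> {..c}" using curve_time(1)[of x] by simp
    moreover have "(squash (fst x), squash (snd x)) = curve (curve_time x)" by (simp add: curve_time(2))
    ultimately show "x \<in> (\<lambda>x. (squash (fst x), squash (snd x))) -` (curve ` ({0..1} \<inter> {..c}))"
      unfolding vimage_def by blast
  next
    fix x assume "x \<in> (\<lambda>x. (squash (fst x), squash (snd x))) -` (curve ` ({0..1} \<inter> {..c}))"
    then obtain t where "t \<in> {0..1}" "t \<le> c" "curve t = (squash (fst x), squash (snd x))" by auto
    thus "x \<in> {x. curve_time x \<le> c}" using curve_time(3)[of t x] by simp
  qed
  have "compact (curve ` ({0..1} \<inter> {..c}))"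
    by (intro compact_continuous_image continuous_curve compact_Int_closed) auto
  moreover have "continuous_on UNIV (\<lambda>x::real\<times>real. (squash (fst x), squash (snd x)))"
    by (intro continuous_intros continuous_on_compose2[OF continuous_squash[of UNIV]]) auto
  ultimately have "closed {x. curve_time x \<le> c}"
    unfolding eq by (intro continuous_closed_vimage compact_imp_closed) (auto simp: continuous_on_eq_continuous_at)
  thus "{x \<in> space borel. curve_time x \<le> c} \<in> sets borel" by simp
qed

definition decode :: "real \<Rightarrow> real \<times> real" where
  "decode t = (unsquash (fst (curve t)), unsquash (snd (curve t)))"

lemma decode_curve_time: "decode (curve_time x) = x"
  by (simp add: decode_def curve_time unsquash_squash)

lemma curve_measurable [measurable]: "curve \<in> borel_measurable borel"
  by (rule borel_measurable_continuous_onI[OF continuous_curve])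

lemma decode_measurable [measurable]: "decode \<in> borel_measurable borel"
proof -
  have "(\<lambda>t. unsquash (fst (curve t))) \<in> borel_measurable borel" "(\<lambda>t. unsquash (snd (curve t))) \<in> borel_measurable borel"
    unfolding unsquash_def by measurable
  thus ?thesis unfolding decode_def[abs_def] borel_prod[symmetric] by measurable
qed

text \<open>The maximum norm on the square. Below 1 the curve point comes from a point of the plane
  and \<open>decode\<close> is continuous; the value 1 is the boundary, that is, infinity of the
  plane, where \<open>unsquash\<close> breaks down.\<close>

definition curve_size :: "real \<Rightarrow> real" where
  "curve_size t = max \<bar>fst (curve t)\<bar> \<bar>snd (curve t)\<bar>"

lemma continuous_curve_size: "continuous_on A curve_size"
  unfolding curve_size_def by (intro continuous_intros continuous_curve)

lemma isCont_decode:
  assumes "curve_size t < 1"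
  shows "isCont decode t"
proof -
  have "isCont curve t" using continuous_curve[of UNIV] by (simp add: continuous_on_eq_continuous_at)
  moreover have "\<bar>fst (curve t)\<bar> \<noteq> 1" "\<bar>snd (curve t)\<bar> \<noteq> 1" using assms by (auto simp: curve_size_def)
  ultimately show ?thesis
    unfolding decode_def unsquash_def by (intro continuous_intros) auto
qed

section \<open>Tightness and Prokhorov's theorem\<close>

definition outside :: "real \<Rightarrow> (real \<times> real) set" where
  "outside K = {x. \<bar>fst x\<bar> > K \<or> \<bar>snd x\<bar> > K}"

text \<open>The bound is demanded only for large \<open>n\<close>, which is the form in which the
  asymptotic tail estimates deliver it.\<close>

definition tight2 :: "(nat \<Rightarrow> (real \<times> real) measure) \<Rightarrow> bool" where
  "tight2 M \<longleftrightarrow> (\<forall>\<epsilon>>0. \<exists>K. \<forall>\<^sub>F n in sequentially. measure (M n) (outside K) < \<epsilon>)"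

lemma outside_borel: "outside K \<in> sets borel"
  unfolding outside_def by measurable

text \<open>The measures are transported to \<open>[0, 1]\<close> along a Borel section of the curve, where Helly's
  theorem applies, and the limit is pushed forward again. Tightness ensures that the limit does not
  charge the parameters of the boundary of the square.\<close>

lemma prokhorov_prob:
  fixes M :: "nat \<Rightarrow> (real \<times> real) measure"
  assumes M: "\<And>n. borel_prob (M n)" and tight: "tight2 M"
  shows "\<exists>r M0. strict_mono r \<and> weak_conv_prob (\<lambda>n. M (r n)) M0"
proof -
  have sM: "sets (M n) = sets borel" and pM: "prob_space (M n)" for n
    using M[of n] by (auto simp: borel_prob_def)
  define L where "L n = distr (M n) borel curve_time" for n
  have ctM: "curve_time \<in> borel_measurable (M n)" for n
    by (rule borel_measurable_sets_eq[OF sM curve_time_measurable])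
  have rdL: "real_distribution (L n)" for n
    unfolding L_def real_distribution_def real_distribution_axioms_def
    using prob_space.prob_space_distr[OF pM ctM] by simp
  have L_int: "(\<integral>t. f t \<partial>L n) = (\<integral>x. f (curve_time x) \<partial>M n)"
    if "f \<in> borel_measurable borel" for f :: "real \<Rightarrow> real" and n
    unfolding L_def by (rule integral_distr[OF ctM that])
  \<comment> \<open>All parameters lie in \<open>{0..1}\<close>, inside this half-open interval, so
    the transported laws are tight on the line automatically. Tightness in the plane is used
    afterwards, against mass at the boundary.\<close>
  have "measure (L n) {-1<..2} = 1" for n
  proof -
    have "measure (L n) {-1<..2} = measure (M n) (curve_time -` {-1<..2} \<inter> space (M n))"
      unfolding L_def by (rule measure_distr[OF ctM]) simp
    also have "curve_time -` {-1<..2} \<inter> space (M n) = space (M n)"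
    proof -
      have "curve_time x \<in> {-1<..2}" for x using curve_time(1)[of x] by auto
      thus ?thesis by blast
    qed
    finally show ?thesis using prob_space.prob_space[OF pM] by simp
  qed
  hence "- 1 < (2 :: real) \<and> (\<forall>n. measure (L n) {-1<..2} > 1 - \<epsilon>)" if "\<epsilon> > 0" for \<epsilon>
    using that by simp
  hence "tight L"
    unfolding tight_def using rdL by blast
  from tight_imp_convergent_subsubsequence[OF this strict_mono_id]
  obtain r L0 where r: "strict_mono r" "real_distribution L0" "weak_conv_m (\<lambda>n. L (r n)) L0"
    by (auto simp: o_def)
  interpret L0: real_distribution L0 by fact
  note conv = weak_conv_imp_bdd_ae_continuous_conv[OF rdL r(2,3)]
  have small: "measure L0 {t. curve_size t \<ge> 1} \<le> \<epsilon>" if "\<epsilon> > 0" for \<epsilon>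
  proof -
    obtain K0 where K0: "\<forall>\<^sub>F n in sequentially. measure (M n) (outside K0) < \<epsilon>"
      using tight \<open>\<epsilon> > 0\<close> unfolding tight2_def by blast
    define K where "K = \<bar>K0\<bar>"
    have K: "\<forall>\<^sub>F n in sequentially. measure (M n) (outside K) < \<epsilon>"
      using K0
    proof eventually_elim
      case (elim n)
      interpret prob_space "M n" by (rule pM)
      have "measure (M n) (outside K) \<le> measure (M n) (outside K0)"
        by (rule finite_measure_mono) (auto simp: K_def sM outside_borel, auto simp: outside_def)
      thus ?case using elim by simp
    qed
    define \<kappa> where "\<kappa> = squash K"
    have \<kappa>: "\<kappa> < 1" using squash_bounds[of K] by (simp add: \<kappa>_def)
    \<comment> \<open>A continuous cutoff that is 1 on the parameters of the boundary and 0 on those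
      of the box of half-width \<open>K\<close>. Its integral bounds the boundary mass of the limit
      from above, passes to the limit, and along the sequence is at most the mass outside the
      box.\<close>
    define \<psi> where "\<psi> t = max 0 (min 1 ((curve_size t - \<kappa>) / (1 - \<kappa>)))" for t
    have c\<psi>: "continuous_on UNIV \<psi>"
      unfolding \<psi>_def by (intro continuous_intros continuous_curve_size) (use \<kappa> in auto)
    have [measurable]: "\<psi> \<in> borel_measurable borel" by (rule borel_measurable_continuous_onI[OF c\<psi>])
    have \<psi>01: "0 \<le> \<psi> t" "\<psi> t \<le> 1" for t by (auto simp: \<psi>_def)
    have \<psi>1: "\<psi> t = 1" if "curve_size t \<ge> 1" for t using that \<kappa> by (simp add: \<psi>_def)
    have \<psi>0: "\<psi> t = 0" if "curve_size t \<le> \<kappa>" for t using that \<kappa> by (simp add: \<psi>_def divide_le_0_iff)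
    have "{t. curve_size t \<ge> 1} \<in> sets borel"
      by (intro borel_closed closed_Collect_le continuous_curve_size continuous_intros)
    hence "measure L0 {t. curve_size t \<ge> 1} = (\<integral>t. indicator {t. curve_size t \<ge> 1} t \<partial>L0)" by simp
    also have "\<dots> \<le> (\<integral>t. \<psi> t \<partial>L0)"
    proof (rule integral_mono)
      show "integrable L0 \<psi>"
        by (rule L0.integrable_const_bound[where B=1]) (use \<psi>01 in auto)
      show "integrable L0 (indicator {t. curve_size t \<ge> 1} :: real \<Rightarrow> real)"
        using \<open>{t. curve_size t \<ge> 1} \<in> sets borel\<close> by (intro integrable_real_indicator) (auto simp: L0.emeasure_eq_measure)
    qed (use \<psi>01 \<psi>1 in \<open>auto simp: indicator_def\<close>)
    also have "\<dots> \<le> \<epsilon>"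
    proof (rule LIMSEQ_le_const2)
      show "(\<lambda>n. \<integral>t. \<psi> t \<partial>L (r n)) \<longlonglongrightarrow> (\<integral>t. \<psi> t \<partial>L0)"
      proof (rule conv)
        show "emeasure L0 {t. \<not> isCont \<psi> t} = 0"
          using c\<psi> by (simp add: continuous_on_eq_continuous_at)
      qed (use \<psi>01 in auto)
      have "\<forall>\<^sub>F n in sequentially. measure (M (r n)) (outside K) < \<epsilon>"
        using eventually_subseq[OF r(1) K] .
      then obtain N where N: "\<And>n. n \<ge> N \<Longrightarrow> measure (M (r n)) (outside K) < \<epsilon>"
        by (auto simp: eventually_sequentially)
      have "(\<integral>t. \<psi> t \<partial>L (r n)) \<le> \<epsilon>" if "n \<ge> N" for n
      proof -
        interpret prob_space "M (r n)" by (rule pM)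
        have "(\<integral>t. \<psi> t \<partial>L (r n)) = (\<integral>x. \<psi> (curve_time x) \<partial>M (r n))" by (rule L_int) simp
        also have "\<dots> \<le> (\<integral>x. indicator (outside K) x \<partial>M (r n))"
        proof (rule integral_mono)
          show "integrable (M (r n)) (\<lambda>x. \<psi> (curve_time x))"
            by (rule integrable_bounded[OF finite_measure_axioms sM, where B=1]) (use \<psi>01 in auto)
          show "integrable (M (r n)) (indicator (outside K) :: _ \<Rightarrow> real)"
            by (intro integrable_real_indicator) (auto simp: sM outside_borel emeasure_eq_measure)
          fix x
          show "\<psi> (curve_time x) \<le> indicator (outside K) x"
          proof (cases "x \<in> outside K")
            case True thus ?thesis using \<psi>01 by (simp add: indicator_def)
          next
            case False
            hence "curve_size (curve_time x) \<le> \<kappa>"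
              by (simp add: outside_def curve_size_def curve_time \<kappa>_def abs_squash_le)
            thus ?thesis using \<psi>0 by simp
          qed
        qed
        also have "\<dots> = measure (M (r n)) (outside K)"
          using sM outside_borel by simp
        finally show ?thesis using N[OF that] by simp
      qed
      thus "\<exists>N. \<forall>n\<ge>N. (\<integral>t. \<psi> t \<partial>L (r n)) \<le> \<epsilon>" by blast
    qed
    finally show ?thesis .
  qed
  have null: "emeasure L0 {t. curve_size t \<ge> 1} = 0"
  proof -
    have "measure L0 {t. curve_size t \<ge> 1} = 0"
      using field_le_epsilon[of "measure L0 {t. curve_size t \<ge> 1}" 0] small measure_nonneg
      by (metis add_0 antisym)
    thus ?thesis by (simp add: L0.emeasure_eq_measure)
  qed
  define M0 where "M0 = distr L0 borel decode"
  have "borel_prob M0"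
    unfolding M0_def borel_prob_def by (auto intro!: L0.prob_space_distr)
  moreover have "(\<lambda>n. \<integral>x. f x \<partial>M (r n)) \<longlonglongrightarrow> (\<integral>x. f x \<partial>M0)"
    if f: "continuous_on UNIV f" "bounded (range f)" for f :: "real \<times> real \<Rightarrow> real"
  proof -
    obtain B where B: "\<And>x. norm (f x) \<le> B" using f(2) by (auto simp: bounded_iff)
    have [measurable]: "f \<in> borel_measurable borel" by (rule borel_measurable_continuous_onI[OF f(1)])
    have "(\<lambda>n. \<integral>t. f (decode t) \<partial>L (r n)) \<longlonglongrightarrow> (\<integral>t. f (decode t) \<partial>L0)"
    proof (rule conv)
      have "isCont (\<lambda>t. f (decode t)) t" if "curve_size t < 1" for t
      proof (rule isCont_o2[OF isCont_decode[OF that]])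
        show "isCont f (decode t)" using f(1) unfolding continuous_on_eq_continuous_at[OF open_UNIV] by blast
      qed
      hence "{t. \<not> isCont (\<lambda>t. f (decode t)) t} \<subseteq> {t. curve_size t \<ge> 1}"
        by (auto simp: not_le[symmetric])
      moreover have "{t. curve_size t \<ge> 1} \<in> sets L0"
        by (simp, intro borel_closed closed_Collect_le continuous_curve_size continuous_intros)
      ultimately show "emeasure L0 {t. \<not> isCont (\<lambda>t. f (decode t)) t} = 0"
        using null emeasure_mono by (metis le_zero_eq)
      show "norm (f (decode t)) \<le> B" for t by (rule B)
    qed measurable
    moreover have "(\<integral>t. f (decode t) \<partial>L n) = (\<integral>x. f x \<partial>M n)" for n
      by (subst L_int) (auto simp: decode_curve_time)
    moreover have "(\<integral>t. f (decode t) \<partial>L0) = (\<integral>x. f x \<partial>M0)"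
      unfolding M0_def by (rule integral_distr[symmetric]) auto
    ultimately show ?thesis by simp
  qed
  ultimately show ?thesis using r(1) unfolding weak_conv_prob_def by blast
qed

lemma density_const:
  fixes M :: "'a::topological_space measure" and f :: "'a \<Rightarrow> real"
  assumes M: "sets M = sets borel" and f: "f \<in> borel_measurable borel" and c: "c \<ge> 0"
  shows "(\<integral>x. f x \<partial>density M (\<lambda>_. ennreal c)) = c * (\<integral>x. f x \<partial>M)"
  using borel_measurable_sets_eq[OF M f] c by (simp add: integral_density)

text \<open>Along a subsequence the total masses converge. If their limit is 0, all integrals of
  bounded functions tend to 0 and the null measure is the limit; otherwise normalising reduces the
  claim to probability measures.\<close>

lemma prokhorov_finite:
  fixes M :: "nat \<Rightarrow> (real \<times> real) measure"
  assumes fM: "\<And>n. finite_measure (M n)" and sM: "\<And>n. sets (M n) = sets borel"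
    and bdd: "\<forall>\<^sub>F n in sequentially. measure (M n) UNIV \<le> C" and tight: "tight2 M"
  shows "\<exists>r M0. strict_mono r \<and> finite_measure M0 \<and> sets M0 = sets borel \<and>
    (\<forall>f :: real \<times> real \<Rightarrow> real. continuous_on UNIV f \<and> bounded (range f) \<longrightarrow>
       (\<lambda>n. \<integral>x. f x \<partial>M (r n)) \<longlonglongrightarrow> (\<integral>x. f x \<partial>M0))"
proof -
  define m where "m n = measure (M n) UNIV" for n
  have spM: "space (M n) = UNIV" for n using sets_eq_imp_space_eq[OF sM] by simp
  have "Bseq m"
    by (rule Bseq_eventually_mono[of _ "\<lambda>_. C"]) (use bdd in \<open>auto simp: m_def elim: eventually_mono\<close>)
  then obtain c r1 where r1: "strict_mono (r1 :: nat \<Rightarrow> nat)" "(m \<circ> r1) \<longlonglongrightarrow> c"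
    using bounded_imp_convergent_subsequence[of m] by (auto simp: Bseq_eq_bounded)
  have c0: "c \<ge> 0" by (rule LIMSEQ_le_const[OF r1(2)]) (auto simp: m_def)
  show ?thesis
  proof (cases "c = 0")
    case True
    have "(\<lambda>n. \<integral>x. f x \<partial>M (r1 n)) \<longlonglongrightarrow> 0"
      if f: "continuous_on UNIV f" "bounded (range f)" for f :: "real \<times> real \<Rightarrow> real"
    proof -
      obtain B where B: "\<And>x. norm (f x) \<le> B" using f(2) by (auto simp: bounded_iff)
      have fm: "f \<in> borel_measurable borel" by (rule borel_measurable_continuous_onI[OF f(1)])
      have le: "norm (\<integral>x. f x \<partial>M n) \<le> B * m n" for n
      proof -
        interpret finite_measure "M n" by (rule fM)
        have "norm (\<integral>x. f x \<partial>M n) \<le> (\<integral>x. norm (f x) \<partial>M n)" by (rule integral_norm_bound)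
        also have "\<dots> \<le> (\<integral>x. B \<partial>M n)"
          by (intro integral_mono integrable_norm integrable_bounded[OF fM sM fm B] B) simp
        finally show ?thesis by (simp add: m_def spM mult.commute)
      qed
      have lim: "(\<lambda>n. B * m (r1 n)) \<longlonglongrightarrow> 0" using tendsto_mult_right_zero[of "m \<circ> r1"] r1(2) True
        by (simp add: o_def tendsto_mult_right_zero)
      show ?thesis by (rule Lim_null_comparison[OF _ lim]) (simp add: le del: real_norm_def)
    qed
    moreover have "finite_measure (null_measure (borel :: (real \<times> real) measure))"
      by (intro finite_measureI) simp
    ultimately show ?thesis
      using r1(1) by (intro exI[of _ r1] exI[of _ "null_measure borel"]) auto
  next
    case False
    hence c: "c > 0" using c0 by simp
    \<comment> \<open>The point mass is a placeholder for indices of mass 0. These are finitely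
      many, because the masses tend to \<open>c > 0\<close>.\<close>
    define N where "N n = (if m (r1 n) > 0 then density (M (r1 n)) (\<lambda>_. ennreal (1 / m (r1 n))) else return borel (0, 0))" for n
    have bN: "borel_prob (N n)" for n
    proof (cases "m (r1 n) > 0")
      case True
      interpret finite_measure "M (r1 n)" by (rule fM)
      have "emeasure (density (M (r1 n)) (\<lambda>_. ennreal (1 / m (r1 n)))) UNIV = ennreal (1 / m (r1 n)) * emeasure (M (r1 n)) UNIV"
        using emeasure_density_const[of UNIV "M (r1 n)"] sM by simp
      also have "\<dots> = 1"
        using True by (simp add: emeasure_eq_measure ennreal_mult[symmetric] m_def)
      finally show ?thesis using True sM unfolding borel_prob_def N_def
        by (auto intro!: prob_spaceI simp: spM)
    next
      case False thus ?thesis unfolding borel_prob_def N_def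
        by (auto intro!: prob_space_return)
    qed
    have ev: "\<forall>\<^sub>F n in sequentially. m (r1 n) > c / 2"
      using order_tendstoD(1)[OF r1(2), of "c / 2"] c by simp
    have "tight2 N"
      unfolding tight2_def
    proof (intro allI impI)
      fix \<epsilon> :: real assume "\<epsilon> > 0"
      hence "\<epsilon> * (c / 2) > 0" using c by simp
      then obtain K where "\<forall>\<^sub>F n in sequentially. measure (M n) (outside K) < \<epsilon> * (c / 2)"
        using tight unfolding tight2_def by blast
      from eventually_subseq[OF r1(1) this] ev
      have "\<forall>\<^sub>F n in sequentially. measure (N n) (outside K) < \<epsilon>"
      proof eventually_elim
        case (elim n)
        let ?A = "outside K"
        have pos: "m (r1 n) > 0" using elim(2) c by linarith
        have "emeasure (N n) ?A = ennreal (1 / m (r1 n)) * emeasure (M (r1 n)) ?A"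
          using pos sM outside_borel[of K] by (simp add: N_def emeasure_density_const)
        hence "measure (N n) ?A = measure (M (r1 n)) ?A / m (r1 n)"
          using pos by (simp add: measure_def enn2real_mult)
        also have "\<dots> < \<epsilon> * (c / 2) / m (r1 n)" using elim pos by (intro divide_strict_right_mono)
        also have "\<dots> \<le> \<epsilon>" using elim(2) pos \<open>\<epsilon> > 0\<close> by (simp add: field_simps)
        finally show ?case .
      qed
      thus "\<exists>K. \<forall>\<^sub>F n in sequentially. measure (N n) (outside K) < \<epsilon>" by blast
    qed
    from prokhorov_prob[OF bN this] obtain r2 N0 where r2: "strict_mono r2" "weak_conv_prob (\<lambda>n. N (r2 n)) N0"
      by blast
    have N0: "finite_measure N0" "sets N0 = sets borel"
      using r2(2) by (auto simp: weak_conv_prob_def borel_prob_def prob_space_def)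
    have mr: "(\<lambda>n. m (r1 (r2 n))) \<longlonglongrightarrow> c"
      using LIMSEQ_subseq_LIMSEQ[OF r1(2) r2(1)] by (simp add: o_def)
    have "(\<lambda>n. \<integral>x. f x \<partial>M (r1 (r2 n))) \<longlonglongrightarrow> (\<integral>x. f x \<partial>density N0 (\<lambda>_. ennreal c))"
      if f: "continuous_on UNIV f" "bounded (range f)" for f :: "real \<times> real \<Rightarrow> real"
    proof -
      have fm: "f \<in> borel_measurable borel" by (rule borel_measurable_continuous_onI[OF f(1)])
      have "(\<lambda>n. m (r1 (r2 n)) * (\<integral>x. f x \<partial>N (r2 n))) \<longlonglongrightarrow> c * (\<integral>x. f x \<partial>N0)"
        using r2(2) f by (intro tendsto_mult mr) (auto simp: weak_conv_prob_def)
      moreover have "\<forall>\<^sub>F n in sequentially. m (r1 (r2 n)) * (\<integral>x. f x \<partial>N (r2 n)) = (\<integral>x. f x \<partial>M (r1 (r2 n)))"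
        using eventually_subseq[OF r2(1) ev]
      proof eventually_elim
        case (elim n)
        hence "m (r1 (r2 n)) > 0" using c by linarith
        thus ?case using density_const[OF sM fm, of "1 / m (r1 (r2 n))" "r1 (r2 n)"] by (simp add: N_def)
      qed
      ultimately show ?thesis
        unfolding density_const[OF N0(2) fm c0] by (rule Lim_transform_eventually)
    qed
    moreover have "finite_measure (density N0 (\<lambda>_. ennreal c))"
    proof (rule finite_measureI)
      have "emeasure (density N0 (\<lambda>_. ennreal c)) (space N0) = ennreal c * emeasure N0 (space N0)"
        by (rule emeasure_density_const) simp
      thus "emeasure (density N0 (\<lambda>_. ennreal c)) (space (density N0 (\<lambda>_. ennreal c))) \<noteq> \<infinity>"
        using finite_measure.emeasure_finite[OF N0(1)] by (simp add: ennreal_mult_eq_top_iff)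
    qed
    ultimately show ?thesis
      using strict_mono_o[OF r1(1) r2(1)] N0(2)
      by (intro exI[of _ "r1 \<circ> r2"] exI[of _ "density N0 (\<lambda>_. ennreal c)"]) (auto simp: o_def)
  qed
qed

section \<open>R-transforms and subordination\<close>

lemma stolz_pair_iff:
  "z \<in> stolz_pair \<alpha> \<beta> \<longleftrightarrow> Im z \<noteq> 0 \<and> \<bar>Re z\<bar> < \<alpha> * \<bar>Im z\<bar> \<and> \<bar>Im z\<bar> < \<beta>"
proof -
  have "z \<in> cnj ` stolz \<alpha> \<beta> \<longleftrightarrow> cnj z \<in> stolz \<alpha> \<beta>"
    by (metis complex_cnj_cnj image_iff)
  thus ?thesis by (auto simp: stolz_pair_def stolz_def)
qed

lemma stolz_pair_mono:
  assumes "\<alpha>' \<le> \<alpha>" "\<beta>' \<le> \<beta>"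
  shows "stolz_pair \<alpha>' \<beta>' \<subseteq> stolz_pair \<alpha> \<beta>"
proof
  fix z assume "z \<in> stolz_pair \<alpha>' \<beta>'"
  moreover have "\<alpha>' * \<bar>Im z\<bar> \<le> \<alpha> * \<bar>Im z\<bar>" using assms by (intro mult_right_mono) auto
  ultimately show "z \<in> stolz_pair \<alpha> \<beta>" using assms unfolding stolz_pair_iff by (meson less_le_trans)
qed

lemma is_R_transform_mono:
  assumes "is_R_transform m \<alpha> \<beta> R" "0 < \<alpha>'" "\<alpha>' \<le> \<alpha>" "0 < \<beta>'" "\<beta>' \<le> \<beta>"
  shows "is_R_transform m \<alpha>' \<beta>' R"
  using assms stolz_pair_mono[of \<alpha>' \<alpha> \<beta>' \<beta>] unfolding is_R_transform_def
  by (blast intro: holomorphic_on_subset tendsto_within_subset)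

text \<open>The nonreal points form two components and the identity theorem is applied in each, so
  the open set on which equality is known has to meet both.\<close>

lemma continuation_halfplanes:
  assumes f: "f holomorphic_on {z. Im z \<noteq> 0}" and g: "g holomorphic_on {z. Im z \<noteq> 0}"
    and U: "open U" "\<exists>z\<in>U. Im z > 0" "\<exists>z\<in>U. Im z < 0"
    and eq: "\<And>z. z \<in> U \<Longrightarrow> Im z \<noteq> 0 \<Longrightarrow> f z = g z" and z: "Im z \<noteq> 0"
  shows "f z = g z"
proof -
  consider "Im z > 0" | "Im z < 0" using z by linarith
  thus ?thesis
  proof cases
    case 1
    show ?thesis
    proof (rule analytic_continuation_open[of "U \<inter> {z. Im z > 0}" "{z. Im z > 0}" f g])
      show "f holomorphic_on {z. Im z > 0}" "g holomorphic_on {z. Im z > 0}"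
        using f g by (auto elim!: holomorphic_on_subset)
      show "connected {z. Im z > 0}" by (intro convex_connected convex_halfspace_Im_gt)
    qed (use U eq 1 in \<open>auto intro!: open_Int open_halfspace_Im_gt\<close>)
  next
    case 2
    show ?thesis
    proof (rule analytic_continuation_open[of "U \<inter> {z. Im z < 0}" "{z. Im z < 0}" f g])
      show "f holomorphic_on {z. Im z < 0}" "g holomorphic_on {z. Im z < 0}"
        using f g by (auto elim!: holomorphic_on_subset)
      show "connected {z. Im z < 0}" by (intro convex_connected convex_halfspace_Im_lt)
    qed (use U eq 2 in \<open>auto intro!: open_Int open_halfspace_Im_lt\<close>)
  qed
qed

text \<open>The ratio \<open>K / (K - x)\<close> tends to 1 and is dominated by
  \<open>norm K / \<bar>Im K\<bar> \<le> C\<close>: nontangential approach is exactly what provides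
  the dominating constant. A coefficient varying with \<open>n\<close> allows the product of two
  such ratios.\<close>

lemma kernel_ratio_limit:
  fixes X :: "'a \<Rightarrow> real" and c :: "nat \<Rightarrow> 'a \<Rightarrow> complex"
  assumes fin: "finite_measure M" and [measurable]: "X \<in> borel_measurable M" "\<And>n. c n \<in> borel_measurable M"
      "c0 \<in> borel_measurable M"
    and c: "\<forall>\<^sub>F n in sequentially. \<forall>x. norm (c n x) \<le> B" "\<And>x. (\<lambda>n. c n x) \<longlonglongrightarrow> c0 x"
    and K: "\<forall>\<^sub>F n in sequentially. Im (K n) \<noteq> 0 \<and> norm (K n) \<le> C * \<bar>Im (K n)\<bar>"
      "filterlim K at_infinity sequentially"
  shows "(\<lambda>n. \<integral>x. c n x * (K n / (K n - complex_of_real (X x))) \<partial>M) \<longlonglongrightarrow> (\<integral>x. c0 x \<partial>M)"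
proof -
  interpret finite_measure M by fact
  from eventually_conj[OF c(1) K(1)] obtain N where
    N: "\<And>n. n \<ge> N \<Longrightarrow> (\<forall>x. norm (c n x) \<le> B) \<and> Im (K n) \<noteq> 0 \<and> norm (K n) \<le> C * \<bar>Im (K n)\<bar>"
    by (auto simp: eventually_sequentially)
  \<comment> \<open>Dominated convergence asks for the bounds at every index, hence the shift by
    \<open>N\<close>.\<close>
  have "(\<lambda>n. \<integral>x. c (n + N) x * (K (n + N) / (K (n + N) - complex_of_real (X x))) \<partial>M) \<longlonglongrightarrow> (\<integral>x. c0 x \<partial>M)"
  proof (rule integral_dominated_convergence[where w="\<lambda>_. B * C"])
    show "AE x in M. (\<lambda>n. c (n + N) x * (K (n + N) / (K (n + N) - complex_of_real (X x)))) \<longlonglongrightarrow> c0 x"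
    proof (rule AE_I2)
      fix x
      have "((\<lambda>n. complex_of_real (X x) / K n) \<longlongrightarrow> 0) sequentially"
        by (rule tendsto_divide_0[OF tendsto_const K(2)])
      hence "(\<lambda>n. c n x * (1 / (1 - complex_of_real (X x) / K n))) \<longlonglongrightarrow> c0 x * (1 / (1 - 0))"
        by (intro tendsto_intros c) auto
      moreover have "\<forall>\<^sub>F n in sequentially. c n x * (1 / (1 - complex_of_real (X x) / K n)) = c n x * (K n / (K n - complex_of_real (X x)))"
        using K(1)
      proof eventually_elim
        case (elim n)
        hence "K n \<noteq> 0" by auto
        thus ?case by (simp add: field_simps)
      qed
      ultimately have "(\<lambda>n. c n x * (K n / (K n - complex_of_real (X x)))) \<longlonglongrightarrow> c0 x"
        using Lim_transform_eventually by fastforce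
      thus "(\<lambda>n. c (n + N) x * (K (n + N) / (K (n + N) - complex_of_real (X x)))) \<longlonglongrightarrow> c0 x"
        by (rule LIMSEQ_ignore_initial_segment)
    qed
    show "AE x in M. norm (c (n + N) x * (K (n + N) / (K (n + N) - complex_of_real (X x)))) \<le> B * C" for n
    proof (rule AE_I2)
      fix x
      have n: "norm (c (n + N) x) \<le> B" "Im (K (n + N)) \<noteq> 0" "norm (K (n + N)) \<le> C * \<bar>Im (K (n + N))\<bar>"
        using N[of "n + N"] by auto
      have "C \<ge> 0" using n(2,3) by (smt (verit) mult_neg_pos norm_ge_zero zero_less_abs_iff)
      have "norm (K (n + N) / (K (n + N) - complex_of_real (X x))) \<le> norm (K (n + N)) / \<bar>Im (K (n + N))\<bar>"
        unfolding norm_divide using n(2) Im_le_norm_diff[of "K (n + N)" "X x"]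
        by (intro divide_left_mono mult_pos_pos) auto
      also have "\<dots> \<le> C" using n by (simp add: divide_le_eq)
      finally show "norm (c (n + N) x * (K (n + N) / (K (n + N) - complex_of_real (X x)))) \<le> B * C"
        unfolding norm_mult using n(1) by (intro mult_mono) (auto intro: order_trans[OF norm_ge_zero])
    qed
  qed auto
  thus ?thesis by (rule LIMSEQ_offset)
qed

lemma cauchy_at_infinity:
  assumes m: "borel_prob m"
  shows "(\<lambda>n. \<i> * of_nat n * cauchy m (\<i> * of_nat n)) \<longlonglongrightarrow> 1"
proof -
  interpret prob_space m using m by (simp add: borel_prob_def)
  have lim: "(\<lambda>n. \<integral>x. 1 * (\<i> * of_nat n / (\<i> * of_nat n - complex_of_real x)) \<partial>m) \<longlonglongrightarrow> (\<integral>x. 1 \<partial>m)"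
  proof (rule kernel_ratio_limit[where B=1 and C=1])
    show "\<forall>\<^sub>F n in sequentially. Im (\<i> * of_nat n) \<noteq> 0 \<and> norm (\<i> * of_nat n) \<le> 1 * \<bar>Im (\<i> * of_nat n)\<bar>"
      using eventually_gt_at_top[of 0] by eventually_elim (auto simp: norm_mult)
    show "filterlim (\<lambda>n. \<i> * of_nat n) at_infinity sequentially"
      unfolding filterlim_at_infinity_conv_norm_at_top by (simp add: norm_mult filterlim_real_sequentially)
  qed (use borel_prob_id_measurable[OF m] borel_prob_finite[OF m] in auto)
  have "(\<integral>x. 1 * (\<i> * of_nat n / (\<i> * of_nat n - complex_of_real x)) \<partial>m) =
      \<i> * of_nat n * cauchy m (\<i> * of_nat n)" for n
    unfolding cauchy_def integral_mult_right_zero[symmetric] by simp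
  thus ?thesis using lim prob_space by simp
qed

text \<open>To be read with \<open>us n = z * R z\<close> at \<open>z = zs n\<close>, so that
  \<open>K n\<close> is \<open>1 / z + R z\<close>. The reciprocal of a point of the Stolz pair lies
  in a double sector around the imaginary axis, and a factor tending to 1 widens the sector only
  slightly.\<close>

lemma nontangential:
  assumes "\<And>n. zs n \<in> stolz_pair \<alpha> \<beta>" "zs \<longlonglongrightarrow> 0" "us \<longlonglongrightarrow> 0" "\<alpha> > 0"
  defines "K \<equiv> \<lambda>n. (1 + us n) / zs n"
  shows "\<forall>\<^sub>F n in sequentially. Im (K n) \<noteq> 0 \<and> norm (K n) \<le> 4 * (1 + \<alpha>) * \<bar>Im (K n)\<bar>"
    and "filterlim K at_infinity sequentially"
proof -
  have nz: "zs n \<noteq> 0" for n using assms(1)[of n] by (auto simp: stolz_pair_iff)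
  \<comment> \<open>In the Stolz pair \<open>\<bar>Im z\<bar> \<ge> 2 * e * norm z\<close>. A
    perturbation of norm below \<open>e\<close> uses up half of this; the other half gives
    \<open>\<bar>Im K\<bar> \<ge> e / norm z\<close>, against
    \<open>norm K \<le> 2 / norm z\<close>. Hence the constant
    \<open>2 / e = 4 * (1 + \<alpha>)\<close>.\<close>
  define e where "e = 1 / (2 * (1 + \<alpha>))"
  have e: "e > 0" "e \<le> 1" using assms(4) by (auto simp: e_def)
  have "\<forall>\<^sub>F n in sequentially. norm (us n) < e"
    by (rule order_tendstoD(2)[OF tendsto_norm_zero[OF assms(3)] e(1)])
  thus "\<forall>\<^sub>F n in sequentially. Im (K n) \<noteq> 0 \<and> norm (K n) \<le> 4 * (1 + \<alpha>) * \<bar>Im (K n)\<bar>"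
  proof eventually_elim
    case (elim n)
    let ?z = "zs n" and ?u = "us n"
    have zp: "norm ?z > 0" using nz by simp
    have "norm ?z \<le> \<bar>Re ?z\<bar> + \<bar>Im ?z\<bar>" by (rule cmod_le)
    also have "\<dots> \<le> (1 + \<alpha>) * \<bar>Im ?z\<bar>" using assms(1)[of n] by (auto simp: stolz_pair_iff algebra_simps)
    finally have z: "\<bar>Im ?z\<bar> \<ge> 2 * e * norm ?z" using assms(4) by (simp add: e_def field_simps)
    have "Im (K n) = Im ((1 + ?u) * cnj ?z) / (norm ?z)\<^sup>2"
      unfolding K_def complex_div_cnj[of "1 + ?u"] by (simp add: Im_divide_of_real flip: of_real_power)
    hence ImK: "\<bar>Im (K n)\<bar> = \<bar>Im ((1 + ?u) * cnj ?z)\<bar> / (norm ?z)\<^sup>2" by (simp add: abs_divide)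
    have "Im ((1 + ?u) * cnj ?z) = - Im ?z + Im (?u * cnj ?z)" by (simp add: algebra_simps)
    moreover have "\<bar>Im (?u * cnj ?z)\<bar> \<le> e * norm ?z"
    proof -
      have "\<bar>Im (?u * cnj ?z)\<bar> \<le> norm (?u * cnj ?z)" by (rule abs_Im_le_cmod)
      also have "\<dots> = norm ?u * norm ?z" by (simp add: norm_mult)
      also have "\<dots> \<le> e * norm ?z" using elim by (intro mult_right_mono) auto
      finally show ?thesis .
    qed
    ultimately have "\<bar>Im ((1 + ?u) * cnj ?z)\<bar> \<ge> e * norm ?z" using z by linarith
    hence I: "\<bar>Im (K n)\<bar> \<ge> e / norm ?z" unfolding ImK using zp by (simp add: field_simps power2_eq_square)
    have "norm (K n) = norm (1 + ?u) / norm ?z" by (simp add: K_def norm_divide)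
    also have "\<dots> \<le> 2 / norm ?z"
      using norm_triangle_ineq[of 1 ?u] elim e by (intro divide_right_mono) auto
    also have "2 / norm ?z = (4 * (1 + \<alpha>) * e) / norm ?z"
    proof -
      have "4 * (1 + \<alpha>) * e = 2" using assms(4) by (simp add: e_def field_simps)
      thus ?thesis by simp
    qed
    also have "\<dots> = 4 * (1 + \<alpha>) * (e / norm ?z)" by simp
    also have "\<dots> \<le> 4 * (1 + \<alpha>) * \<bar>Im (K n)\<bar>" using I assms(4) by (intro mult_left_mono) auto
    finally have "norm (K n) \<le> 4 * (1 + \<alpha>) * \<bar>Im (K n)\<bar>" .
    moreover have "e / norm ?z > 0" using e zp by simp
    ultimately show ?case using I by auto
  qed
  have "filterlim (\<lambda>n. inverse (zs n)) at_infinity sequentially"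
    using assms(2) nz by (intro filterlim_inverse_at_infinity[THEN filterlim_compose]) (auto simp: filterlim_at)
  moreover have "(\<lambda>n. 1 + us n) \<longlonglongrightarrow> 1 + 0" by (intro tendsto_intros assms(3))
  ultimately have "filterlim (\<lambda>n. (1 + us n) * inverse (zs n)) at_infinity sequentially"
    by (intro tendsto_mult_filterlim_at_infinity[where c="1 + 0"]) auto
  thus "filterlim K at_infinity sequentially" by (simp add: K_def divide_inverse)
qed

text \<open>The two inverses \<open>K\<close>, \<open>K'\<close> of the Cauchy transform satisfy
  \<open>0 = (K' - K) * \<integral> 1 / ((K - x) * (K' - x))\<close>, and the integral is asymptotic to \<open>1 / (K * K')\<close>.\<close>

lemma R_transform_agree_near_0:
  assumes m: "borel_prob m" and R: "is_R_transform m \<alpha> \<beta> R" "is_R_transform m \<alpha> \<beta> R'"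
  shows "\<forall>\<^sub>F z in at 0 within stolz_pair \<alpha> \<beta>. R z = R' z"
proof (rule sequentially_imp_eventually_within, intro allI impI)
  fix zs :: "nat \<Rightarrow> complex"
  assume "(\<forall>n. zs n \<in> stolz_pair \<alpha> \<beta> \<and> zs n \<noteq> 0) \<and> zs \<longlonglongrightarrow> 0"
  hence zs: "\<And>n. zs n \<in> stolz_pair \<alpha> \<beta>" "\<And>n. zs n \<noteq> 0" "zs \<longlonglongrightarrow> 0" by auto
  interpret prob_space m using m by (simp add: borel_prob_def)
  have \<alpha>: "\<alpha> > 0" using R by (simp add: is_R_transform_def)
  define K where "K n = (1 + zs n * R (zs n)) / zs n" for n
  define K' where "K' n = (1 + zs n * R' (zs n)) / zs n" for n
  have KR: "K n = 1 / zs n + R (zs n)" "K' n = 1 / zs n + R' (zs n)" for n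
    using zs(2)[of n] by (auto simp: K_def K'_def field_simps)
  have G: "Im (K n) \<noteq> 0" "Im (K' n) \<noteq> 0" "cauchy m (K n) = cauchy m (K' n)" for n
    using R zs(1)[of n] unfolding is_R_transform_def KR by (auto simp: complex_is_Real_iff)
  have u: "(\<lambda>n. zs n * Q (zs n)) \<longlonglongrightarrow> 0" if "is_R_transform m \<alpha> \<beta> Q" for Q
  proof -
    have "((\<lambda>z. z * Q z) \<longlongrightarrow> 0) (at 0 within stolz_pair \<alpha> \<beta>)" using that by (simp add: is_R_transform_def)
    thus ?thesis unfolding tendsto_at_iff_sequentially using zs by (auto simp: o_def)
  qed
  note nt = nontangential[OF zs(1,3) u[OF R(1)] \<alpha>, folded K_def] 
  note nt' = nontangential[OF zs(1,3) u[OF R(2)] \<alpha>, folded K'_def] 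
  note [measurable] = borel_prob_id_measurable[OF m]
  have "(\<lambda>n. \<integral>x. (K' n / (K' n - complex_of_real x)) * (K n / (K n - complex_of_real x)) \<partial>m) \<longlonglongrightarrow> (\<integral>x. 1 \<partial>m)"
  proof (rule kernel_ratio_limit[OF borel_prob_finite[OF m] borel_prob_id_measurable[OF m] _ _ _ _ nt, where B="4 * (1 + \<alpha>)"])
    show "\<forall>\<^sub>F n in sequentially. \<forall>x. norm (K' n / (K' n - complex_of_real x)) \<le> 4 * (1 + \<alpha>)"
      using nt'(1)
    proof eventually_elim
      case (elim n)
      show ?case
      proof
        fix x
        have "norm (K' n / (K' n - complex_of_real x)) \<le> norm (K' n) / \<bar>Im (K' n)\<bar>"
          unfolding norm_divide using elim Im_le_norm_diff[of "K' n" x]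
          by (intro divide_left_mono mult_pos_pos) auto
        also have "\<dots> \<le> 4 * (1 + \<alpha>)" using elim by (simp add: divide_le_eq)
        finally show "norm (K' n / (K' n - complex_of_real x)) \<le> 4 * (1 + \<alpha>)" .
      qed
    qed
    show "(\<lambda>n. K' n / (K' n - complex_of_real x)) \<longlonglongrightarrow> 1" for x
    proof -
      have "((\<lambda>n. complex_of_real x / K' n) \<longlongrightarrow> 0) sequentially"
        by (rule tendsto_divide_0[OF tendsto_const nt'(2)])
      hence "(\<lambda>n. 1 / (1 - complex_of_real x / K' n)) \<longlonglongrightarrow> 1 / (1 - 0)"
        by (intro tendsto_intros) auto
      moreover have "1 / (1 - complex_of_real x / K' n) = K' n / (K' n - complex_of_real x)" for n
      proof -
        have "K' n \<noteq> 0" using G(2)[of n] by auto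
        thus ?thesis by (simp add: field_simps)
      qed
      ultimately show ?thesis by simp
    qed
  qed measurable
  hence "(\<lambda>n. \<integral>x. (K' n / (K' n - complex_of_real x)) * (K n / (K n - complex_of_real x)) \<partial>m) \<longlonglongrightarrow> 1"
    using prob_space by simp
  hence "\<forall>\<^sub>F n in sequentially. norm (\<integral>x. (K' n / (K' n - complex_of_real x)) * (K n / (K n - complex_of_real x)) \<partial>m) > 0"
    by (intro order_tendstoD(1)[OF tendsto_norm]) auto
  thus "\<forall>\<^sub>F n in sequentially. R (zs n) = R' (zs n)"
  proof eventually_elim
    case (elim n)
    have "0 = cauchy m (K' n) - cauchy m (K n)" using G(3)[of n] by simp
    also have "\<dots> = (\<integral>x. 1 / (K' n - complex_of_real x) - 1 / (K n - complex_of_real x) \<partial>m)"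
      unfolding cauchy_def
      by (rule Bochner_Integration.integral_diff[symmetric]) (intro cauchy_integrable[OF m] G)+
    also have "\<dots> = (\<integral>x. (K n - K' n) / (K n * K' n) * ((K' n / (K' n - complex_of_real x)) * (K n / (K n - complex_of_real x))) \<partial>m)"
    proof (rule Bochner_Integration.integral_cong[OF refl])
      fix x
      have nz: "K n \<noteq> 0" "K' n \<noteq> 0" using G[of n] by auto
      show "1 / (K' n - complex_of_real x) - 1 / (K n - complex_of_real x) =
        (K n - K' n) / (K n * K' n) * ((K' n / (K' n - complex_of_real x)) * (K n / (K n - complex_of_real x)))"
        using nonreal_diff[OF G(1)[of n], of x] nonreal_diff[OF G(2)[of n], of x] nz
        by (simp add: diff_frac_eq)
    qed
    also have "\<dots> = (K n - K' n) / (K n * K' n) * (\<integral>x. ((K' n / (K' n - complex_of_real x)) * (K n / (K n - complex_of_real x))) \<partial>m)"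
      by (rule integral_mult_right_zero)
    finally have "K n = K' n" using elim G[of n] by auto
    thus ?case by (simp add: KR)
  qed
qed

text \<open>On the common Stolz pair the two functions agree near 0, in both of its components; each
  component is convex, so continuation carries the agreement to \<open>z\<close>.\<close>

lemma R_transform_unique:
  assumes m: "borel_prob m" and R: "is_R_transform m \<alpha> \<beta> R" and R': "is_R_transform m \<alpha>' \<beta>' R'"
    and z: "z \<in> stolz_pair \<alpha> \<beta>" "z \<in> stolz_pair \<alpha>' \<beta>'"
  shows "R z = R' z"
proof -
  define a where "a = min \<alpha> \<alpha>'"
  define b where "b = min \<beta> \<beta>'"
  have pos: "a > 0" "b > 0" using R R' by (auto simp: is_R_transform_def a_def b_def)
  have Rab: "is_R_transform m a b R" by (rule is_R_transform_mono[OF R]) (use pos in \<open>auto simp: a_def b_def\<close>)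
  have Rab': "is_R_transform m a b R'" by (rule is_R_transform_mono[OF R']) (use pos in \<open>auto simp: a_def b_def\<close>)
  have zab: "z \<in> stolz_pair a b" using z by (auto simp: stolz_pair_iff a_def b_def min_def)
  obtain d where d: "d > 0" "\<And>y. y \<in> stolz_pair a b \<Longrightarrow> y \<noteq> 0 \<Longrightarrow> dist y 0 < d \<Longrightarrow> R y = R' y"
    using R_transform_agree_near_0[OF m Rab Rab'] unfolding eventually_at by auto
  define s where "s = sgn (Im z)"
  have zi: "Im z \<noteq> 0" using zab by (simp add: stolz_pair_iff)
  have s: "s = 1 \<or> s = - 1" "s * Im z > 0" using zi by (auto simp: s_def sgn_real_def)
  \<comment> \<open>The component of the Stolz pair containing \<open>z\<close>, an open triangle;
    the sign \<open>s\<close> treats the upper and the lower one at once.\<close>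
  define S where "S = {y. s * Im y > 0 \<and> \<bar>Re y\<bar> < a * (s * Im y) \<and> s * Im y < b}"
  have Ssub: "S \<subseteq> stolz_pair a b" using s by (auto simp: S_def stolz_pair_iff)
  have zS: "z \<in> S" using zab s by (auto simp: S_def stolz_pair_iff)
  have S_eq: "S = {y. s * Im y > 0} \<inter> {y. Re y < a * (s * Im y)} \<inter> {y. - Re y < a * (s * Im y)} \<inter> {y. s * Im y < b}"
    by (auto simp: S_def)
  have op: "open S" unfolding S_eq by (intro open_Int open_Collect_less continuous_intros)
  have "convex S"
  proof -
    have "S = {y. inner (Complex 0 (- s)) y < 0} \<inter> {y. inner (Complex 1 (- a * s)) y < 0}
        \<inter> {y. inner (Complex (- 1) (- a * s)) y < 0} \<inter> {y. inner (Complex 0 s) y < b}"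
      unfolding S_eq by (auto simp: inner_complex_def algebra_simps)
    thus ?thesis by (simp only:) (intro convex_Int convex_halfspace_lt)
  qed
  hence conn: "connected S" by (rule convex_connected)
  show ?thesis
  proof (rule analytic_continuation_open[of "S \<inter> ball 0 d" S R R'])
    show "S \<inter> ball 0 d \<noteq> {}"
    proof -
      define t where "t = min b d / 2"
      have t: "0 < t" "t < b" "t < d" using pos d by (auto simp: t_def)
      have "s * s = 1" using s by auto
      hence "Complex 0 (s * t) \<in> S \<inter> ball 0 d"
        using t s pos by (auto simp: S_def complex_norm abs_mult)
      thus ?thesis by blast
    qed
    show "R holomorphic_on S" "R' holomorphic_on S"
      using Rab Rab' Ssub by (auto simp: is_R_transform_def elim!: holomorphic_on_subset)
    show "R y = R' y" if "y \<in> S \<inter> ball 0 d" for y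
    proof (rule d(2))
      show y: "y \<in> stolz_pair a b" using that Ssub by blast
      show "y \<noteq> 0" using y by (auto simp: stolz_pair_iff)
      show "dist y 0 < d" using that by (simp add: dist_commute)
    qed
  qed (use op conn zS in auto)
qed

lemma R_transform_eq:
  assumes m: "borel_prob m" and R: "is_R_transform m \<alpha> \<beta> R" and z: "z \<in> stolz_pair \<alpha> \<beta>"
  shows "R_transform m z = R z"
  unfolding R_transform_def
  by (rule the_equality) (use R z R_transform_unique[OF m] in blast)+

lemma R_transform_is_R_transform:
  assumes m: "borel_prob m" and R: "R_defined m \<alpha> \<beta>"
  shows "is_R_transform m \<alpha> \<beta> (R_transform m)"
proof -
  obtain R where R: "is_R_transform m \<alpha> \<beta> R" using R by (auto simp: R_defined_def)
  have eq: "R_transform m z = R z" if "z \<in> stolz_pair \<alpha> \<beta>" for z by (rule R_transform_eq[OF m R that])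
  have "R_transform m holomorphic_on stolz_pair \<alpha> \<beta>"
    using R unfolding is_R_transform_def by (metis eq holomorphic_cong)
  moreover have "((\<lambda>z. z * R_transform m z) \<longlongrightarrow> 0) (at 0 within stolz_pair \<alpha> \<beta>)"
  proof (rule Lim_transform_eventually)
    show "((\<lambda>z. z * R z) \<longlongrightarrow> 0) (at 0 within stolz_pair \<alpha> \<beta>)" using R by (simp add: is_R_transform_def)
    show "\<forall>\<^sub>F z in at 0 within stolz_pair \<alpha> \<beta>. z * R z = z * R_transform m z"
      using eq by (auto simp: eventually_at_filter)
  qed
  ultimately show ?thesis using R eq unfolding is_R_transform_def by auto
qed

section \<open>The inverse of the Cauchy transform\<close>

definition inverse_cauchy :: "real measure \<Rightarrow> complex \<Rightarrow> complex" where
  "inverse_cauchy m z = 1 / z + R_transform m z"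

lemma inverse_cauchy:
  assumes m: "borel_prob m" and R: "R_defined m \<alpha> \<beta>" and z: "z \<in> stolz_pair \<alpha> \<beta>"
  shows "Im (inverse_cauchy m z) \<noteq> 0" "cauchy m (inverse_cauchy m z) = z"
    "Im z < 0 \<Longrightarrow> Im (inverse_cauchy m z) > 0" "Im z > 0 \<Longrightarrow> Im (inverse_cauchy m z) < 0"
proof -
  show *: "Im (inverse_cauchy m z) \<noteq> 0" "cauchy m (inverse_cauchy m z) = z"
    using R_transform_is_R_transform[OF m R] z
    by (auto simp: is_R_transform_def inverse_cauchy_def complex_is_Real_iff)
  show "Im z < 0 \<Longrightarrow> Im (inverse_cauchy m z) > 0" "Im z > 0 \<Longrightarrow> Im (inverse_cauchy m z) < 0"
    using cauchy_Im_pos[OF m, of "inverse_cauchy m z"] cauchy_Im_le(2)[OF m, of "inverse_cauchy m z"] *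
    by (metis linorder_neqE_linordered_idom order_less_asym)+
qed

lemma open_stolz_pair: "open (stolz_pair \<alpha> \<beta>)"
proof -
  have eq: "stolz_pair \<alpha> \<beta> = {z. \<bar>Im z\<bar> > 0} \<inter> {z. \<bar>Re z\<bar> < \<alpha> * \<bar>Im z\<bar>} \<inter> {z. \<bar>Im z\<bar> < \<beta>}"
    by (auto simp: stolz_pair_iff)
  show ?thesis unfolding eq by (intro open_Int open_Collect_less continuous_intros)
qed

text \<open>Provides the open set for \<open>continuation_halfplanes\<close>. The image is open
  because the map is injective, the Cauchy transform being a left inverse, and it meets both
  half-planes because the map exchanges upper and lower.\<close>

lemma inverse_cauchy_image:
  assumes m: "borel_prob m" and R: "R_defined m \<alpha> \<beta>"
  shows "open (inverse_cauchy m ` stolz_pair \<alpha> \<beta>)"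
    "\<exists>z\<in>inverse_cauchy m ` stolz_pair \<alpha> \<beta>. Im z > 0" "\<exists>z\<in>inverse_cauchy m ` stolz_pair \<alpha> \<beta>. Im z < 0"
proof -
  note is_R = R_transform_is_R_transform[OF m R]
  have pos: "\<alpha> > 0" "\<beta> > 0" using is_R by (auto simp: is_R_transform_def)
  have "inj_on (inverse_cauchy m) (stolz_pair \<alpha> \<beta>)"
    by (rule inj_on_inverseI[of _ "cauchy m"]) (rule inverse_cauchy(2)[OF m R])
  moreover have "inverse_cauchy m holomorphic_on stolz_pair \<alpha> \<beta>"
    unfolding inverse_cauchy_def using is_R
    by (intro holomorphic_intros) (auto simp: is_R_transform_def stolz_pair_iff)
  ultimately show "open (inverse_cauchy m ` stolz_pair \<alpha> \<beta>)"
    using open_mapping_thm3 open_stolz_pair by blast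
  have "Complex 0 (- \<beta> / 2) \<in> stolz_pair \<alpha> \<beta>" "Complex 0 (\<beta> / 2) \<in> stolz_pair \<alpha> \<beta>"
    using pos by (auto simp: stolz_pair_iff)
  thus "\<exists>z\<in>inverse_cauchy m ` stolz_pair \<alpha> \<beta>. Im z > 0" "\<exists>z\<in>inverse_cauchy m ` stolz_pair \<alpha> \<beta>. Im z < 0"
    using inverse_cauchy(3,4)[OF m R] pos by fastforce+
qed

lemma R_defined_mono:
  assumes "R_defined m \<alpha> \<beta>" "0 < \<alpha>'" "\<alpha>' \<le> \<alpha>" "0 < \<beta>'" "\<beta>' \<le> \<beta>"
  shows "R_defined m \<alpha>' \<beta>'"
  using assms is_R_transform_mono unfolding R_defined_def by blast

lemma R_defined_pos: "R_defined m \<alpha> \<beta> \<Longrightarrow> \<alpha> > 0 \<and> \<beta> > 0"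
  by (auto simp: R_defined_def is_R_transform_def)

lemma measure_eqI_R_transform:
  assumes M: "borel_prob M" "borel_prob M'" and R: "R_defined M \<alpha> \<beta>" "R_defined M' \<alpha> \<beta>"
    and eq: "\<And>z. z \<in> stolz_pair \<alpha> \<beta> \<Longrightarrow> R_transform M z = R_transform M' z"
  shows "M = M'"
proof (rule cauchy_inject[OF M])
  fix z assume z: "Im z > 0"
  show "cauchy M z = cauchy M' z"
  proof (rule continuation_halfplanes[OF cauchy_holomorphic[OF M(1)] cauchy_holomorphic[OF M(2)]
        inverse_cauchy_image[OF M(1) R(1)]])
    fix \<zeta> assume "\<zeta> \<in> inverse_cauchy M ` stolz_pair \<alpha> \<beta>"
    then obtain w where w: "w \<in> stolz_pair \<alpha> \<beta>" "\<zeta> = inverse_cauchy M w" by blast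
    have "inverse_cauchy M w = inverse_cauchy M' w" using eq[OF w(1)] by (simp add: inverse_cauchy_def)
    thus "cauchy M \<zeta> = cauchy M' \<zeta>"
      using inverse_cauchy(2)[OF M(1) R(1) w(1)] inverse_cauchy(2)[OF M(2) R(2) w(1)] w by simp
  qed (use z in auto)
qed

text \<open>Makes the definite description usable: any competitor has the same R-transform as
  \<open>M\<close> on the intersection of the two Stolz pairs, and there the R-transform determines
  the measure.\<close>

lemma free_conv_power_eq:
  assumes m: "borel_prob m" "borel_prob M" and k: "k > 0"
    and R: "R_defined m \<alpha> \<beta>" "R_defined M \<alpha> \<beta>"
    and eq: "\<And>z. z \<in> stolz_pair \<alpha> \<beta> \<Longrightarrow> R_transform M z = of_nat k * R_transform m z"
  shows "free_conv_power m k = M"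
  unfolding free_conv_power_def free_conv_list_def
proof (rule the_equality)
  have "(\<Sum>m\<leftarrow>replicate k m. R_transform m z) = of_nat k * R_transform m z" for z
    by (simp add: sum_list_replicate map_replicate)
  note sum = this
  show "borel_prob M \<and> (\<exists>\<alpha> \<beta>. R_defined M \<alpha> \<beta> \<and> (\<forall>m\<in>set (replicate k m). R_defined m \<alpha> \<beta>) \<and>
      (\<forall>z\<in>stolz_pair \<alpha> \<beta>. R_transform M z = (\<Sum>m\<leftarrow>replicate k m. R_transform m z)))"
    using assms unfolding sum by auto
  fix M' assume "borel_prob M' \<and> (\<exists>\<alpha> \<beta>. R_defined M' \<alpha> \<beta> \<and> (\<forall>m\<in>set (replicate k m). R_defined m \<alpha> \<beta>) \<and>
      (\<forall>z\<in>stolz_pair \<alpha> \<beta>. R_transform M' z = (\<Sum>m\<leftarrow>replicate k m. R_transform m z)))"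
  then obtain a b where M': "borel_prob M'" "R_defined M' a b"
    "\<And>z. z \<in> stolz_pair a b \<Longrightarrow> R_transform M' z = of_nat k * R_transform m z"
    unfolding sum by blast
  have pos: "\<alpha> > 0" "\<beta> > 0" "a > 0" "b > 0" using R_defined_pos R(1) M'(2) by blast+
  show "M' = M"
  proof (rule measure_eqI_R_transform[OF M'(1) m(2)])
    show "R_defined M' (min \<alpha> a) (min \<beta> b)" by (rule R_defined_mono[OF M'(2)]) (use pos in auto)
    show "R_defined M (min \<alpha> a) (min \<beta> b)" by (rule R_defined_mono[OF R(2)]) (use pos in auto)
    fix z assume "z \<in> stolz_pair (min \<alpha> a) (min \<beta> b)"
    hence "z \<in> stolz_pair \<alpha> \<beta>" "z \<in> stolz_pair a b"
      using stolz_pair_mono[of "min \<alpha> a" \<alpha> "min \<beta> b" \<beta>] stolz_pair_mono[of "min \<alpha> a" a "min \<beta> b" b] by auto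
    thus "R_transform M' z = R_transform M z" using eq M'(3) by simp
  qed
qed

section \<open>Explicit subordination functions\<close>

definition subord :: "nat \<Rightarrow> real measure \<Rightarrow> complex \<Rightarrow> complex" where
  "subord k M z = z / of_nat k + (1 - 1 / of_nat k) * (1 / cauchy M z)"

text \<open>The value is a convex combination of \<open>z\<close> and \<open>1 / cauchy M z\<close>,
  neither of which is closer to the real axis than \<open>z\<close>. The bound does not involve
  \<open>k\<close>.\<close>

lemma Im_subord:
  assumes M: "borel_prob M" and k: "k > 0"
  shows "Im z > 0 \<Longrightarrow> Im (subord k M z) \<ge> Im z" "Im z < 0 \<Longrightarrow> Im (subord k M z) \<le> Im z"
    "Im z \<noteq> 0 \<Longrightarrow> Im (subord k M z) \<noteq> 0"
proof -
  have k1: "1 - 1 / real k \<ge> 0" using k by simp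
  have I: "Im (subord k M z) = Im z / real k + (1 - 1 / real k) * Im (1 / cauchy M z)"
  proof -
    have "subord k M z = complex_of_real (1 / real k) * z + complex_of_real (1 - 1 / real k) * (1 / cauchy M z)"
      by (simp add: subord_def)
    thus ?thesis by (simp only: plus_complex.sel Im_complex_of_real times_complex.sel Re_complex_of_real) simp
  qed
  have e: "Im z / real k + (1 - 1 / real k) * Im z = Im z" by (simp add: algebra_simps)
  show 1: "Im (subord k M z) \<ge> Im z" if "Im z > 0"
    using mult_left_mono[OF Im_recip_cauchy[OF M that] k1] e I by linarith
  show 2: "Im (subord k M z) \<le> Im z" if "Im z < 0"
    using mult_left_mono[OF Im_recip_cauchy_neg[OF M that] k1] e I by linarith
  show "Im (subord k M z) \<noteq> 0" if "Im z \<noteq> 0" using that 1 2 by linarith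
qed

lemma subord_holomorphic:
  assumes M: "borel_prob M"
  shows "subord k M holomorphic_on {z. Im z \<noteq> 0}"
  unfolding subord_def using cauchy_holomorphic[OF M] cauchy_nonzero[OF M]
  by (cases "k = 0") (auto intro!: holomorphic_intros)

text \<open>The origin of the formula for \<open>subord\<close>. Put
  \<open>v = inverse_cauchy M z\<close>, so \<open>v = 1 / z + k * R\<close> with \<open>R\<close>
  the R-transform of \<open>m\<close> at \<open>z\<close>, and
  \<open>1 / cauchy M v = 1 / z\<close>. Solving for \<open>R\<close> gives
  \<open>R = (v - 1 / z) / k\<close>, hence \<open>1 / z + R\<close> is \<open>v / k\<close> plus
  \<open>1 - 1 / k\<close> times \<open>1 / cauchy M v\<close>.\<close>

lemma subord_inverse_cauchy:
  assumes M: "borel_prob M" and k: "k > 0" and R: "R_defined M \<alpha> \<beta>" and z: "z \<in> stolz_pair \<alpha> \<beta>"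
    and eq: "R_transform M z = of_nat k * R_transform m z"
  shows "subord k M (inverse_cauchy M z) = inverse_cauchy m z"
proof -
  have z0: "z \<noteq> 0" using z by (auto simp: stolz_pair_iff)
  have "subord k M (inverse_cauchy M z) = (1 / z + of_nat k * R_transform m z) / of_nat k + (1 - 1 / of_nat k) * (1 / z)"
    unfolding subord_def inverse_cauchy(2)[OF M R z] unfolding inverse_cauchy_def eq ..
  also have "\<dots> = inverse_cauchy m z"
  proof -
    have "(1 / z + c * r) / c + (1 - 1 / c) * (1 / z) = 1 / z + r" if "c \<noteq> 0" for c r :: complex
      using that z0 by (simp add: field_simps)
    from this[of "of_nat k"] show ?thesis using k by (simp add: inverse_cauchy_def)
  qed
  finally show ?thesis .
qed

lemma cauchy_subord:
  assumes m: "borel_prob m" "borel_prob M" and k: "k > 0"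
    and R: "R_defined m \<alpha> \<beta>" "R_defined M \<alpha> \<beta>"
    and eq: "\<And>z. z \<in> stolz_pair \<alpha> \<beta> \<Longrightarrow> R_transform M z = of_nat k * R_transform m z"
    and z: "Im z \<noteq> 0"
  shows "cauchy m (subord k M z) = cauchy M z"
proof (rule continuation_halfplanes[OF _ cauchy_holomorphic[OF m(2)] inverse_cauchy_image[OF m(2) R(2)] _ z])
  show "(\<lambda>z. cauchy m (subord k M z)) holomorphic_on {z. Im z \<noteq> 0}"
    using holomorphic_on_compose_gen[OF subord_holomorphic[OF m(2), of k] cauchy_holomorphic[OF m(1)]]
      Im_subord(3)[OF m(2) k] by (auto simp: o_def)
  fix \<zeta> assume "\<zeta> \<in> inverse_cauchy M ` stolz_pair \<alpha> \<beta>"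
  then obtain w where w: "w \<in> stolz_pair \<alpha> \<beta>" "\<zeta> = inverse_cauchy M w" by blast
  show "cauchy m (subord k M \<zeta>) = cauchy M \<zeta>"
    unfolding w(2) subord_inverse_cauchy[OF m(2) k R(2) w(1) eq[OF w(1)]]
      inverse_cauchy(2)[OF m(1) R(1) w(1)] inverse_cauchy(2)[OF m(2) R(2) w(1)] ..
qed

section \<open>The bi-free identity\<close>

lemma borel_prob_coord_measurable:
  assumes "borel_prob (M :: (real \<times> real) measure)"
  shows "fst \<in> borel_measurable M" "snd \<in> borel_measurable M"
  using assms unfolding borel_prob_def
  by (blast intro: borel_measurable_sets_eq borel_measurable_fst_real borel_measurable_snd_real)+

lemma borel_prob_marginal:
  assumes "borel_prob M"
  shows "borel_prob (marginal1 M)" "borel_prob (marginal2 M)"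
proof -
  interpret prob_space M using assms by (simp add: borel_prob_def)
  show "borel_prob (marginal1 M)" "borel_prob (marginal2 M)"
    unfolding marginal1_def marginal2_def borel_prob_def
    using prob_space_distr[OF borel_prob_coord_measurable(1)[OF assms]]
      prob_space_distr[OF borel_prob_coord_measurable(2)[OF assms]] by simp_all
qed

lemma measure_marginal:
  assumes "borel_prob M"
  shows "measure (marginal1 M) {s. \<bar>s\<bar> > K} = measure M {x. \<bar>fst x\<bar> > K}"
    "measure (marginal2 M) {s. \<bar>s\<bar> > K} = measure M {x. \<bar>snd x\<bar> > K}"
proof -
  have "space M = UNIV" using assms sets_eq_imp_space_eq[of M borel] by (simp add: borel_prob_def)
  moreover have "{s :: real. \<bar>s\<bar> > K} \<in> sets borel" by measurable
  ultimately show "measure (marginal1 M) {s. \<bar>s\<bar> > K} = measure M {x. \<bar>fst x\<bar> > K}"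
    "measure (marginal2 M) {s. \<bar>s\<bar> > K} = measure M {x. \<bar>snd x\<bar> > K}"
    unfolding marginal1_def marginal2_def
    using measure_distr[OF borel_prob_coord_measurable(1)[OF assms]] measure_distr[OF borel_prob_coord_measurable(2)[OF assms]]
    by (simp_all add: vimage_def)
qed

lemma cauchy_marginal:
  assumes "borel_prob M"
  shows "cauchy (marginal1 M) z = (\<integral>x. 1 / (z - complex_of_real (fst x)) \<partial>M)"
    "cauchy (marginal2 M) z = (\<integral>x. 1 / (z - complex_of_real (snd x)) \<partial>M)"
  unfolding marginal1_def marginal2_def cauchy_def
  by (rule integral_distr[OF borel_prob_coord_measurable(1)[OF assms]]
        integral_distr[OF borel_prob_coord_measurable(2)[OF assms]]; measurable)+

text \<open>The pole \<open>1 / zs n + R (zs n)\<close> is asymptotic to \<open>1 / zs n\<close>, so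
  the kernel is asymptotic to \<open>zs n\<close>; nontangential approach lets this pass under the
  integral.\<close>

lemma kernel_const_limit:
  fixes X :: "'a \<Rightarrow> real" and c :: "'a \<Rightarrow> complex"
  assumes fin: "finite_measure M" and meas: "X \<in> borel_measurable M" "c \<in> borel_measurable M"
    and c: "\<And>x. norm (c x) \<le> B" and zs: "\<And>n. zs n \<in> stolz_pair \<alpha> \<beta>" "zs \<longlonglongrightarrow> 0" and \<alpha>: "\<alpha> > 0"
    and u: "(\<lambda>n. zs n * R (zs n)) \<longlonglongrightarrow> 0"
  shows "(\<lambda>n. (\<integral>x. c x / (1 / zs n + R (zs n) - complex_of_real (X x)) \<partial>M) / zs n) \<longlonglongrightarrow> (\<integral>x. c x \<partial>M)"
proof -
  define K where "K n = (1 + zs n * R (zs n)) / zs n" for n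
  have nz: "zs n \<noteq> 0" for n using zs(1)[of n] by (auto simp: stolz_pair_iff)
  have KR: "K n = 1 / zs n + R (zs n)" for n using nz[of n] by (simp add: K_def field_simps)
  note nt = nontangential[OF zs(1,2) u \<alpha>, folded K_def]
  have "(\<lambda>n. \<integral>x. c x * (K n / (K n - complex_of_real (X x))) \<partial>M) \<longlonglongrightarrow> (\<integral>x. c x \<partial>M)"
    by (rule kernel_ratio_limit[OF fin meas(1) meas(2) meas(2) _ _ nt]) (use c in auto)
  hence "(\<lambda>n. (\<integral>x. c x * (K n / (K n - complex_of_real (X x))) \<partial>M) / (1 + zs n * R (zs n))) \<longlonglongrightarrow> (\<integral>x. c x \<partial>M) / (1 + 0)"
    by (intro tendsto_intros u) auto
  moreover have "\<forall>\<^sub>F n in sequentially. (\<integral>x. c x * (K n / (K n - complex_of_real (X x))) \<partial>M) / (1 + zs n * R (zs n)) =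
      (\<integral>x. c x / (1 / zs n + R (zs n) - complex_of_real (X x)) \<partial>M) / zs n"
    using nt(1)
  proof eventually_elim
    case (elim n)
    hence "K n \<noteq> 0" by auto
    hence "1 + zs n * R (zs n) \<noteq> 0" using nz[of n] by (auto simp: K_def)
    have "(\<integral>x. c x * (K n / (K n - complex_of_real (X x))) \<partial>M) = (\<integral>x. K n * (c x / (K n - complex_of_real (X x))) \<partial>M)"
      by (simp add: mult_ac)
    also have "\<dots> = K n * (\<integral>x. c x / (K n - complex_of_real (X x)) \<partial>M)"
      by (rule integral_mult_right_zero)
    also have "\<dots> / (1 + zs n * R (zs n)) = (\<integral>x. c x / (K n - complex_of_real (X x)) \<partial>M) / zs n"
      using \<open>1 + zs n * R (zs n) \<noteq> 0\<close> by (simp add: K_def)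
    finally show ?case unfolding KR .
  qed
  ultimately show ?thesis using Lim_transform_eventually by fastforce
qed

lemma stolz_sequence:
  assumes "\<alpha> > 0" "\<beta> > 0"
  obtains zs where "\<And>n. zs n \<in> stolz_pair \<alpha> \<beta>" "zs \<longlonglongrightarrow> 0"
proof
  \<comment> \<open>With \<open>n + 2\<close> the imaginary part is strictly below
    \<open>\<beta>\<close> already at \<open>n = 0\<close>.\<close>
  show "Complex 0 (\<beta> / (real n + 2)) \<in> stolz_pair \<alpha> \<beta>" for n
    using assms by (auto simp: stolz_pair_iff divide_less_eq)
  have "(\<lambda>n. \<beta> / (real n + 2)) \<longlonglongrightarrow> 0" by real_asymp
  from tendsto_Complex[OF tendsto_const[of 0] this]
  show "(\<lambda>n. Complex 0 (\<beta> / (real n + 2))) \<longlonglongrightarrow> 0" by (simp add: zero_complex.code)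
qed

text \<open>With one argument \<open>z\<close> fixed and the other tending to 0, the double
  transform divided by the small argument tends to a marginal transform at its own inverse, which is
  \<open>z\<close>. So \<open>h_fun\<close> tends to 1, the bracket vanishes, and only one
  one-variable term survives.\<close>

lemma bifree_R_limits:
  assumes M: "borel_prob M" and R: "bifree_R_defined M \<alpha> \<beta>" and z: "z \<in> stolz_pair \<alpha> \<beta>"
    and zs: "\<And>n. zs n \<in> stolz_pair \<alpha> \<beta>" "zs \<longlonglongrightarrow> 0"
  shows "(\<lambda>n. bifree_R M z (zs n)) \<longlonglongrightarrow> z * R_transform (marginal1 M) z"
    and "(\<lambda>n. bifree_R M (zs n) z) \<longlonglongrightarrow> z * R_transform (marginal2 M) z"
proof -
  let ?R1 = "R_transform (marginal1 M)" and ?R2 = "R_transform (marginal2 M)"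
  have fin: "finite_measure M" and sM: "sets M = sets borel" using M borel_prob_finite by (auto simp: borel_prob_def)
  have Rd: "R_defined (marginal1 M) \<alpha> \<beta>" "R_defined (marginal2 M) \<alpha> \<beta>" using R by (auto simp: bifree_R_defined_def)
  have \<alpha>: "\<alpha> > 0" using R_defined_pos[OF Rd(1)] by simp
  note bm = borel_prob_marginal[OF M]
  have z0: "z \<noteq> 0" using z by (auto simp: stolz_pair_iff)
  have nz: "zs n \<noteq> 0" for n using zs(1)[of n] by (auto simp: stolz_pair_iff)
  have u: "(\<lambda>n. zs n * Q (zs n)) \<longlonglongrightarrow> 0" if "is_R_transform m \<alpha> \<beta> Q" for Q m
  proof -
    have "((\<lambda>z. z * Q z) \<longlongrightarrow> 0) (at 0 within stolz_pair \<alpha> \<beta>)" using that by (simp add: is_R_transform_def)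
    thus ?thesis unfolding tendsto_at_iff_sequentially using zs nz by (auto simp: o_def)
  qed
  note u1 = u[OF R_transform_is_R_transform[OF bm(1) Rd(1)]]
  note u2 = u[OF R_transform_is_R_transform[OF bm(2) Rd(2)]]
  have mf: "fst \<in> borel_measurable M" "snd \<in> borel_measurable M"
    by (rule borel_measurable_sets_eq[OF sM], measurable)+
  have kf: "(\<lambda>x. 1 / (a - complex_of_real (fst x))) \<in> borel_measurable M"
    "(\<lambda>x. 1 / (a - complex_of_real (snd x))) \<in> borel_measurable M" for a
    by (rule borel_measurable_sets_eq[OF sM], measurable)+
  note K1 = inverse_cauchy[OF bm(1) Rd(1) z, unfolded inverse_cauchy_def]
  note K2 = inverse_cauchy[OF bm(2) Rd(2) z, unfolded inverse_cauchy_def]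
  have "(\<lambda>n. (\<integral>x. 1 / (1 / z + ?R1 z - complex_of_real (fst x)) / (1 / zs n + ?R2 (zs n) - complex_of_real (snd x)) \<partial>M) / zs n) \<longlonglongrightarrow> z"
    using kernel_const_limit[OF fin mf(2) kf(1) kernel_le[OF K1(1)] zs \<alpha> u2] K1(2) by (simp add: cauchy_marginal[OF M])
  hence "(\<lambda>n. (\<integral>x. 1 / (1 / z + ?R1 z - complex_of_real (fst x)) / (1 / zs n + ?R2 (zs n) - complex_of_real (snd x)) \<partial>M) / zs n / z) \<longlonglongrightarrow> z / z"
    by (intro tendsto_intros z0)
  hence h1: "(\<lambda>n. h_fun M z (zs n)) \<longlonglongrightarrow> 1"
    using z0 by (simp add: h_fun_def cauchy2_eq mult.commute)
  have "(\<lambda>n. z * ?R1 z + zs n * ?R2 (zs n) + (1 - 1 / h_fun M z (zs n))) \<longlonglongrightarrow> z * ?R1 z + 0 + (1 - 1 / 1)"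
    by (intro tendsto_intros u2 h1) auto
  thus "(\<lambda>n. bifree_R M z (zs n)) \<longlonglongrightarrow> z * R_transform (marginal1 M) z" by (simp add: bifree_R_def)
  have "(\<lambda>n. (\<integral>x. 1 / (1 / z + ?R2 z - complex_of_real (snd x)) / (1 / zs n + ?R1 (zs n) - complex_of_real (fst x)) \<partial>M) / zs n) \<longlonglongrightarrow> z"
    using kernel_const_limit[OF fin mf(1) kf(2) kernel_le[OF K2(1)] zs \<alpha> u1] K2(2) by (simp add: cauchy_marginal[OF M])
  hence "(\<lambda>n. (\<integral>x. 1 / (1 / z + ?R2 z - complex_of_real (snd x)) / (1 / zs n + ?R1 (zs n) - complex_of_real (fst x)) \<partial>M) / zs n / z) \<longlonglongrightarrow> z / z"
    by (intro tendsto_intros z0)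
  hence h2: "(\<lambda>n. h_fun M (zs n) z) \<longlonglongrightarrow> 1"
    using z0 by (simp add: h_fun_def cauchy2_eq mult.commute)
  have "(\<lambda>n. zs n * ?R1 (zs n) + z * ?R2 z + (1 - 1 / h_fun M (zs n) z)) \<longlonglongrightarrow> 0 + z * ?R2 z + (1 - 1 / 1)"
    by (intro tendsto_intros u1 h2) auto
  thus "(\<lambda>n. bifree_R M (zs n) z) \<longlonglongrightarrow> z * R_transform (marginal2 M) z" by (simp add: bifree_R_def)
qed

locale bifree_power =
  fixes \<mu> \<nu> :: "(real \<times> real) measure" and k :: nat and \<alpha> \<beta> :: real
  assumes \<mu>: "borel_prob \<mu>" and \<nu>: "borel_prob \<nu>" and k: "k > 0"
    and R\<mu>: "bifree_R_defined \<mu> \<alpha> \<beta>" and R\<nu>: "bifree_R_defined \<nu> \<alpha> \<beta>"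
    and eq: "\<And>z w. z \<in> stolz_pair \<alpha> \<beta> \<Longrightarrow> w \<in> stolz_pair \<alpha> \<beta> \<Longrightarrow>
      of_nat k * bifree_R \<mu> z w = bifree_R \<nu> z w"
begin

lemma Rd: "R_defined (marginal1 \<mu>) \<alpha> \<beta>" "R_defined (marginal2 \<mu>) \<alpha> \<beta>"
  "R_defined (marginal1 \<nu>) \<alpha> \<beta>" "R_defined (marginal2 \<nu>) \<alpha> \<beta>"
  using R\<mu> R\<nu> by (auto simp: bifree_R_defined_def)

lemma marginal_R:
  assumes z: "z \<in> stolz_pair \<alpha> \<beta>"
  shows "R_transform (marginal1 \<nu>) z = of_nat k * R_transform (marginal1 \<mu>) z"
    and "R_transform (marginal2 \<nu>) z = of_nat k * R_transform (marginal2 \<mu>) z"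
proof -
  obtain zs where zs: "\<And>n. zs n \<in> stolz_pair \<alpha> \<beta>" "zs \<longlonglongrightarrow> 0"
    using stolz_sequence R_defined_pos[OF Rd(1)] by blast
  have z0: "z \<noteq> 0" using z by (auto simp: stolz_pair_iff)
  have "(\<lambda>n. bifree_R \<nu> z (zs n)) \<longlonglongrightarrow> of_nat k * (z * R_transform (marginal1 \<mu>) z)"
    using tendsto_mult_left[OF bifree_R_limits(1)[OF \<mu> R\<mu> z zs], of "of_nat k"] by (simp add: eq[OF z zs(1)])
  from LIMSEQ_unique[OF this bifree_R_limits(1)[OF \<nu> R\<nu> z zs]]
  show "R_transform (marginal1 \<nu>) z = of_nat k * R_transform (marginal1 \<mu>) z" using z0 by simp
  have "(\<lambda>n. bifree_R \<nu> (zs n) z) \<longlonglongrightarrow> of_nat k * (z * R_transform (marginal2 \<mu>) z)"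
    using tendsto_mult_left[OF bifree_R_limits(2)[OF \<mu> R\<mu> z zs], of "of_nat k"] by (simp add: eq[OF zs(1) z])
  from LIMSEQ_unique[OF this bifree_R_limits(2)[OF \<nu> R\<nu> z zs]]
  show "R_transform (marginal2 \<nu>) z = of_nat k * R_transform (marginal2 \<mu>) z" using z0 by simp
qed

lemma free_conv_power_marginal:
  "free_conv_power (marginal1 \<mu>) k = marginal1 \<nu>" "free_conv_power (marginal2 \<mu>) k = marginal2 \<nu>"
  using free_conv_power_eq[OF borel_prob_marginal(1)[OF \<mu>] borel_prob_marginal(1)[OF \<nu>] k Rd(1,3) marginal_R(1)]
    free_conv_power_eq[OF borel_prob_marginal(2)[OF \<mu>] borel_prob_marginal(2)[OF \<nu>] k Rd(2,4) marginal_R(2)]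
  by auto

abbreviation "\<omega>1 \<equiv> subord k (marginal1 \<nu>)"
abbreviation "\<omega>2 \<equiv> subord k (marginal2 \<nu>)"

lemma cauchy_\<omega>:
  assumes "Im z \<noteq> 0"
  shows "cauchy (marginal1 \<mu>) (\<omega>1 z) = cauchy (marginal1 \<nu>) z" "cauchy (marginal2 \<mu>) (\<omega>2 z) = cauchy (marginal2 \<nu>) z"
  using cauchy_subord[OF borel_prob_marginal(1)[OF \<mu>] borel_prob_marginal(1)[OF \<nu>] k Rd(1,3) marginal_R(1) assms]
    cauchy_subord[OF borel_prob_marginal(2)[OF \<mu>] borel_prob_marginal(2)[OF \<nu>] k Rd(2,4) marginal_R(2) assms]
  by auto

end

lemma cauchy2_holomorphic:
  assumes M: "borel_prob M"
  shows "Im w \<noteq> 0 \<Longrightarrow> (\<lambda>z. cauchy2 M z w) holomorphic_on {z. Im z \<noteq> 0}"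
    "Im z \<noteq> 0 \<Longrightarrow> (\<lambda>w. cauchy2 M z w) holomorphic_on {w. Im w \<noteq> 0}"
proof -
  have fin: "finite_measure M" and sM: "sets M = sets borel" using M borel_prob_finite by (auto simp: borel_prob_def)
  have mf: "fst \<in> borel_measurable M" "snd \<in> borel_measurable M"
    by (rule borel_measurable_sets_eq[OF sM], measurable)+
  have kf: "(\<lambda>x. 1 / (a - complex_of_real (fst x))) \<in> borel_measurable M"
    "(\<lambda>x. 1 / (a - complex_of_real (snd x))) \<in> borel_measurable M" for a
    by (rule borel_measurable_sets_eq[OF sM], measurable)+
  have le: "norm (1 / (a - complex_of_real s)) \<le> 1 / \<bar>Im a\<bar> * weight t" if "Im a \<noteq> 0" for a s t
    using order_trans[OF kernel_le[OF that, of s] mult_left_mono[OF weight_ge_1[of t], of "1 / \<bar>Im a\<bar>", simplified]] by simp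
  show "(\<lambda>z. cauchy2 M z w) holomorphic_on {z. Im z \<noteq> 0}" if w: "Im w \<noteq> 0"
    using kernel_holomorphic[OF fin mf(1) kf(2) le[OF w]] by (simp add: cauchy2_eq mult.commute)
  show "(\<lambda>w. cauchy2 M z w) holomorphic_on {w. Im w \<noteq> 0}" if z: "Im z \<noteq> 0"
    using kernel_holomorphic[OF fin mf(2) kf(1) le[OF z]] by (simp add: cauchy2_eq)
qed

context bifree_power
begin

text \<open>Stated without denominators, so that both sides are holomorphic off the real axis
  whether or not \<open>cauchy2\<close> has zeros there; on the Stolz pair its nonvanishing is part
  of \<open>bifree_R_defined\<close>. Continuation runs in \<open>z\<close> with \<open>w\<close> in
  the image of the inverse transform, and then in \<open>w\<close> for every nonreal
  \<open>z\<close>.\<close>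

lemma cauchy2_identity:
  assumes zw: "Im z \<noteq> 0" "Im w \<noteq> 0"
  defines "P \<equiv> \<lambda>z w. cauchy (marginal1 \<nu>) z * cauchy (marginal2 \<nu>) w"
  shows "P z w * cauchy2 \<mu> (\<omega>1 z) (\<omega>2 w) =
    cauchy2 \<nu> z w * ((1 - of_nat k) * cauchy2 \<mu> (\<omega>1 z) (\<omega>2 w) + of_nat k * P z w)"
    (is "?L z w = ?R z w")
proof -
  let ?S = "stolz_pair \<alpha> \<beta>"
  let ?K1 = "inverse_cauchy (marginal1 \<nu>)" and ?K2 = "inverse_cauchy (marginal2 \<nu>)"
  note bm = borel_prob_marginal[OF \<mu>] and bn = borel_prob_marginal[OF \<nu>]
  have base: "?L (?K1 z) (?K2 w) = ?R (?K1 z) (?K2 w)" if zw: "z \<in> ?S" "w \<in> ?S" for z w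
  proof -
    have nz: "z \<noteq> 0" "w \<noteq> 0" using zw by (auto simp: stolz_pair_iff)
    have P: "P (?K1 z) (?K2 w) = z * w"
      unfolding P_def inverse_cauchy(2)[OF bn(1) Rd(3) zw(1)] inverse_cauchy(2)[OF bn(2) Rd(4) zw(2)] ..
    have om: "\<omega>1 (?K1 z) = inverse_cauchy (marginal1 \<mu>) z" "\<omega>2 (?K2 w) = inverse_cauchy (marginal2 \<mu>) w"
      using subord_inverse_cauchy[OF bn(1) k Rd(3) zw(1) marginal_R(1)[OF zw(1)]]
        subord_inverse_cauchy[OF bn(2) k Rd(4) zw(2) marginal_R(2)[OF zw(2)]] by auto
    define gm where "gm = cauchy2 \<mu> (inverse_cauchy (marginal1 \<mu>) z) (inverse_cauchy (marginal2 \<mu>) w)"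
    define gn where "gn = cauchy2 \<nu> (?K1 z) (?K2 w)"
    have h: "h_fun \<mu> z w = gm / (z * w)" "h_fun \<nu> z w = gn / (z * w)"
      by (simp_all add: h_fun_def gm_def gn_def inverse_cauchy_def)
    have h0: "gm \<noteq> 0" "gn \<noteq> 0" using R\<mu> R\<nu> zw h nz unfolding bifree_R_defined_def by fastforce+
    \<comment> \<open>The one-variable terms cancel by \<open>marginal_R\<close>, which leaves only
      the brackets of the two partial R-transforms.\<close>
    have "of_nat k * (1 - 1 / h_fun \<mu> z w) = 1 - 1 / h_fun \<nu> z w"
      using eq[OF zw] unfolding bifree_R_def marginal_R(1)[OF zw(1)] marginal_R(2)[OF zw(2)]
      by (simp add: algebra_simps)
    hence "of_nat k * (1 - z * w / gm) = 1 - z * w / gn" unfolding h using nz by simp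
    hence "of_nat k * (1 - z * w / gm) * (gm * gn) = (1 - z * w / gn) * (gm * gn)" by simp
    moreover have "(1 - z * w / gm) * (gm * gn) = (gm - z * w) * gn" "(1 - z * w / gn) * (gm * gn) = (gn - z * w) * gm"
      using h0 by (simp_all add: left_diff_distrib)
    ultimately have "of_nat k * ((gm - z * w) * gn) = (gn - z * w) * gm" by (simp only: mult.assoc)
    hence "z * w * gm = gn * ((1 - of_nat k) * gm + of_nat k * (z * w))" by (simp add: algebra_simps)
    thus ?thesis unfolding P om gm_def[symmetric] gn_def[symmetric] .
  qed
  have c1: "cauchy (marginal1 \<nu>) holomorphic_on {z. Im z \<noteq> 0}" "cauchy (marginal2 \<nu>) holomorphic_on {z. Im z \<noteq> 0}"
    by (intro cauchy_holomorphic bn)+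
  have o1: "(\<lambda>z. cauchy2 \<mu> (\<omega>1 z) b) holomorphic_on {z. Im z \<noteq> 0}" if "Im b \<noteq> 0" for b
    using holomorphic_on_compose_gen[OF subord_holomorphic[OF bn(1), of k] cauchy2_holomorphic(1)[OF \<mu> that]]
      Im_subord(3)[OF bn(1) k] by (auto simp: o_def)
  have o2: "(\<lambda>w. cauchy2 \<mu> a (\<omega>2 w)) holomorphic_on {z. Im z \<noteq> 0}" if "Im a \<noteq> 0" for a
    using holomorphic_on_compose_gen[OF subord_holomorphic[OF bn(2), of k] cauchy2_holomorphic(2)[OF \<mu> that]]
      Im_subord(3)[OF bn(2) k] by (auto simp: o_def)
  have step1: "?L z (?K2 w) = ?R z (?K2 w)" if w: "w \<in> ?S" and z: "Im z \<noteq> 0" for z w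
  proof (rule continuation_halfplanes[OF _ _ inverse_cauchy_image[OF bn(1) Rd(3)] _ z])
    note Iw = inverse_cauchy(1)[OF bn(2) Rd(4) w]
    note h = c1 o1[OF Im_subord(3)[OF bn(2) k Iw]] cauchy2_holomorphic(1)[OF \<nu> Iw]
    show "(\<lambda>z. ?L z (?K2 w)) holomorphic_on {z. Im z \<noteq> 0}" unfolding P_def by (intro holomorphic_intros h)
    show "(\<lambda>z. ?R z (?K2 w)) holomorphic_on {z. Im z \<noteq> 0}" unfolding P_def by (intro holomorphic_intros h)
  qed (use base w in auto)
  show ?thesis
  proof (rule continuation_halfplanes[OF _ _ inverse_cauchy_image[OF bn(2) Rd(4)] _ zw(2)])
    note h = c1 o2[OF Im_subord(3)[OF bn(1) k zw(1)]] cauchy2_holomorphic(2)[OF \<nu> zw(1)]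
    show "(\<lambda>w. ?L z w) holomorphic_on {z. Im z \<noteq> 0}" unfolding P_def by (intro holomorphic_intros h)
    show "(\<lambda>w. ?R z w) holomorphic_on {z. Im z \<noteq> 0}" unfolding P_def by (intro holomorphic_intros h)
  qed (use step1 zw in auto)
qed

end

section \<open>Limits\<close>

lemma weak_conv_complex:
  fixes f :: "'a::topological_space \<Rightarrow> complex"
  assumes Ms: "\<And>n. finite_measure (Ms n)" "\<And>n. sets (Ms n) = sets borel"
    and M: "finite_measure M" "sets M = sets borel"
    and conv: "\<And>f :: 'a \<Rightarrow> real. continuous_on UNIV f \<Longrightarrow> bounded (range f) \<Longrightarrow> (\<lambda>n. \<integral>x. f x \<partial>Ms n) \<longlonglongrightarrow> (\<integral>x. f x \<partial>M)"
    and f: "continuous_on UNIV f" "\<And>x. norm (f x) \<le> B"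
  shows "(\<lambda>n. \<integral>x. f x \<partial>Ms n) \<longlonglongrightarrow> (\<integral>x. f x \<partial>M)"
proof -
  have fm: "f \<in> borel_measurable borel" by (rule borel_measurable_continuous_onI[OF f(1)])
  have bd: "bounded (range (\<lambda>x. Re (f x)))" "bounded (range (\<lambda>x. Im (f x)))"
    unfolding bounded_iff
    using f(2) abs_Re_le_cmod abs_Im_le_cmod by (auto intro!: exI[of _ B] intro: order_trans)
  have ct: "continuous_on UNIV (\<lambda>x. Re (f x))" "continuous_on UNIV (\<lambda>x. Im (f x))"
    by (rule continuous_on_Re[OF f(1)], rule continuous_on_Im[OF f(1)])
  have RI: "Re (\<integral>x. f x \<partial>N) = (\<integral>x. Re (f x) \<partial>N)" "Im (\<integral>x. f x \<partial>N) = (\<integral>x. Im (f x) \<partial>N)"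
    if "finite_measure N" "sets N = sets borel" for N
    using integrable_bounded[OF that fm f(2)] by (simp_all add: integral_Re integral_Im)
  show ?thesis
    unfolding tendsto_complex_iff RI[OF M] RI[OF Ms] using conv[OF ct(1) bd(1)] conv[OF ct(2) bd(2)] by simp
qed

lemma weak_conv_probD:
  assumes "weak_conv_prob Ms M" "continuous_on UNIV (f :: _ \<Rightarrow> real)" "bounded (range f)"
  shows "(\<lambda>n. \<integral>x. f x \<partial>Ms n) \<longlonglongrightarrow> (\<integral>x. f x \<partial>M)"
  using assms by (auto simp: weak_conv_prob_def)

lemma weak_conv_prob_complex:
  fixes f :: "'a::topological_space \<Rightarrow> complex"
  assumes w: "weak_conv_prob Ms M" and Ms: "\<And>n. borel_prob (Ms n)"
    and f: "continuous_on UNIV f" "\<And>x. norm (f x) \<le> B"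
  shows "(\<lambda>n. \<integral>x. f x \<partial>Ms n) \<longlonglongrightarrow> (\<integral>x. f x \<partial>M)"
proof (rule weak_conv_complex[OF _ _ _ _ _ f])
  have M: "borel_prob M" using w by (simp add: weak_conv_prob_def)
  show "finite_measure (Ms n)" "sets (Ms n) = sets borel" "finite_measure M" "sets M = sets borel" for n
    using M Ms[of n] by (auto simp: borel_prob_def prob_space_def)
qed (rule weak_conv_probD[OF w])

lemma weak_conv_cauchy:
  assumes w: "weak_conv_prob Ms M" and Ms: "\<And>n. borel_prob (Ms n)" and z: "Im z \<noteq> 0"
  shows "(\<lambda>n. cauchy (Ms n) z) \<longlonglongrightarrow> cauchy M z"
  unfolding cauchy_def
proof (rule weak_conv_prob_complex[OF w Ms _ kernel_le[OF z]])
  show "continuous_on UNIV (\<lambda>x. 1 / (z - complex_of_real x))"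
    using nonreal_diff[OF z] by (intro continuous_intros) auto
qed

lemma weak_conv_cauchy2:
  assumes w: "weak_conv_prob Ms M" and Ms: "\<And>n. borel_prob (Ms n)" and z: "Im z \<noteq> 0" "Im w \<noteq> 0"
  shows "(\<lambda>n. cauchy2 (Ms n) z w) \<longlonglongrightarrow> cauchy2 M z w"
  unfolding cauchy2_eq
proof (rule weak_conv_prob_complex[OF w Ms _ kernel2_le[OF z]])
  show "continuous_on UNIV (\<lambda>x. 1 / ((z - complex_of_real (fst x)) * (w - complex_of_real (snd x))))"
    using nonreal_diff[OF z(1)] nonreal_diff[OF z(2)] by (intro continuous_intros) auto
qed

lemma continuous_wkernel:
  assumes "Im z \<noteq> 0" "Im w \<noteq> 0"
  shows "continuous_on UNIV (wkernel z w)"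
  unfolding wkernel_def using nonreal_diff[OF assms(1)] nonreal_diff[OF assms(2)]
  by (intro continuous_intros continuous_on_compose2[OF continuous_weight]) auto

lemma weak_conv_prob_unique:
  assumes w: "weak_conv_prob Ms M" "weak_conv_prob Ms M'" and Ms: "\<And>n. borel_prob (Ms n)"
  shows "M = (M' :: real measure)"
proof (rule cauchy_inject)
  show "borel_prob M" "borel_prob M'" using w by (auto simp: weak_conv_prob_def)
  fix z assume "Im z > 0"
  hence "Im z \<noteq> 0" by simp
  from LIMSEQ_unique[OF weak_conv_cauchy[OF w(1) Ms this] weak_conv_cauchy[OF w(2) Ms this]]
  show "cauchy M z = cauchy M' z" .
qed

lemma weak_conv_marginal:
  assumes w: "weak_conv_prob Ms M" and Ms: "\<And>n. borel_prob (Ms n)"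
  shows "weak_conv_prob (\<lambda>n. marginal1 (Ms n)) (marginal1 M)" "weak_conv_prob (\<lambda>n. marginal2 (Ms n)) (marginal2 M)"
proof -
  have M: "borel_prob M" using w by (simp add: weak_conv_prob_def)
  have i1: "(\<integral>x. f x \<partial>marginal1 N) = (\<integral>x. f (fst x) \<partial>N)" and i2: "(\<integral>x. f x \<partial>marginal2 N) = (\<integral>x. f (snd x) \<partial>N)"
    if N: "borel_prob N" and f: "continuous_on UNIV f" for f :: "real \<Rightarrow> real" and N
    unfolding marginal1_def marginal2_def
    by (intro integral_distr borel_prob_coord_measurable[OF N] borel_measurable_continuous_onI[OF f])+
  have b: "bounded (range (\<lambda>x. f (fst x)))" "bounded (range (\<lambda>x. f (snd x)))" if "bounded (range f)"
    for f :: "real \<Rightarrow> real"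
    using that unfolding bounded_iff by auto
  have c: "continuous_on UNIV (\<lambda>x::real\<times>real. f (fst x))" "continuous_on UNIV (\<lambda>x::real\<times>real. f (snd x))"
    if "continuous_on UNIV f" for f :: "real \<Rightarrow> real"
    by (intro continuous_on_compose2[OF that] continuous_intros; auto)+
  have "(\<lambda>n. \<integral>x. f (fst x) \<partial>Ms n) \<longlonglongrightarrow> (\<integral>x. f (fst x) \<partial>M)" "(\<lambda>n. \<integral>x. f (snd x) \<partial>Ms n) \<longlonglongrightarrow> (\<integral>x. f (snd x) \<partial>M)"
    if "continuous_on UNIV f" "bounded (range f)" for f :: "real \<Rightarrow> real"
    by (rule weak_conv_probD[OF w c(1)[OF that(1)] b(1)[OF that(2)]],
        rule weak_conv_probD[OF w c(2)[OF that(1)] b(2)[OF that(2)]])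
  thus "weak_conv_prob (\<lambda>n. marginal1 (Ms n)) (marginal1 M)" "weak_conv_prob (\<lambda>n. marginal2 (Ms n)) (marginal2 M)"
    unfolding weak_conv_prob_def[of "\<lambda>n. marginal1 (Ms n)"] weak_conv_prob_def[of "\<lambda>n. marginal2 (Ms n)"]
    using borel_prob_marginal[OF M]
    by (simp_all add: i1[OF M] i2[OF M] i1[OF Ms] i2[OF Ms])
qed

text \<open>From \<open>\<omega> * G = z * G / k + 1 - 1 / k\<close>, where \<open>\<omega>\<close>
  is the subordinated point. This is how the factor \<open>k\<close> is absorbed: the right-hand
  side converges along the array.\<close>

lemma subord_mult:
  assumes M: "borel_prob M" and k: "k > 0" and z: "Im z \<noteq> 0"
  shows "of_nat k * (subord k M z * cauchy M z - 1) = cauchy M z * z - 1"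
proof -
  have "of_nat k \<noteq> (0::complex)" using k by simp
  thus ?thesis unfolding subord_def using cauchy_nonzero[OF M z] by (simp add: field_simps)
qed

text \<open>The mass that \<open>x\<^sup>2 d m\<close> gives to the kernel \<open>1 / \<bar>a - x\<bar>\<^sup>2\<close> at a subordinated point \<open>a\<close> is read
  off the imaginary part of \<open>a\<^sup>2 / (a - x) - a = x + x\<^sup>2 / (a - x)\<close>.\<close>

lemma subord_second_moment:
  assumes m: "borel_prob m" and M: "borel_prob M" and k: "k > 0" and z: "Im z > 0"
    and sub: "cauchy m (subord k M z) = cauchy M z"
  defines "a \<equiv> subord k M z"
  shows "real k * (\<integral>s. s\<^sup>2 / (norm (a - complex_of_real s))\<^sup>2 \<partial>m) = - Im (a * (cauchy M z * z - 1)) / Im a"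
proof -
  have a: "Im a > 0" "Im a \<noteq> 0" using Im_subord(1)[OF M k z] z by (auto simp: a_def)
  interpret prob_space m using m by (simp add: borel_prob_def)
  have ap: "of_nat k * (a * cauchy m a - 1) = cauchy M z * z - 1"
    unfolding a_def sub using subord_mult[OF M k] z by simp
  have pt: "Im (a * (a * (1 / (a - complex_of_real s)) - 1)) = - Im a * (s\<^sup>2 / (norm (a - complex_of_real s))\<^sup>2)" for s
  proof -
    have "a * (a * (1 / (a - complex_of_real s)) - 1) = complex_of_real s + complex_of_real (s\<^sup>2) * (1 / (a - complex_of_real s))"
      using nonreal_diff[OF a(2), of s] by (simp add: field_simps power2_eq_square)
    hence "Im (a * (a * (1 / (a - complex_of_real s)) - 1)) = s\<^sup>2 * Im (1 / (a - complex_of_real s))"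
      by (simp only: plus_complex.sel Im_complex_of_real times_complex.sel Re_complex_of_real mult_zero_left add_0 add_0_right)
    thus ?thesis unfolding Im_kernel by simp
  qed
  have i: "integrable m (\<lambda>s. 1 / (a - complex_of_real s))" by (rule cauchy_integrable[OF m a(2)])
  have "a * (a * cauchy m a - 1) = (\<integral>s. a * (a * (1 / (a - complex_of_real s)) - 1) \<partial>m)"
  proof -
    have "(\<integral>s. a * (a * (1 / (a - complex_of_real s)) - 1) \<partial>m) = a * (\<integral>s. a * (1 / (a - complex_of_real s)) - 1 \<partial>m)"
      by (rule integral_mult_right_zero)
    also have "(\<integral>s. a * (1 / (a - complex_of_real s)) - 1 \<partial>m) = (\<integral>s. a * (1 / (a - complex_of_real s)) \<partial>m) - (\<integral>s. 1 \<partial>m)"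
      by (rule Bochner_Integration.integral_diff) (intro integrable_mult_right i integrable_const)+
    also have "(\<integral>s. a * (1 / (a - complex_of_real s)) \<partial>m) = a * cauchy m a"
      unfolding cauchy_def by (rule integral_mult_right_zero)
    also have "(\<integral>s. 1 \<partial>m) = (1 :: complex)" using prob_space by simp
    finally show ?thesis by (rule sym)
  qed
  hence "Im (a * (a * cauchy m a - 1)) = (\<integral>s. Im (a * (a * (1 / (a - complex_of_real s)) - 1)) \<partial>m)"
    using i by (simp only: integral_Im integrable_mult_right Bochner_Integration.integrable_diff integrable_const)
  also have "\<dots> = - Im a * (\<integral>s. s\<^sup>2 / (norm (a - complex_of_real s))\<^sup>2 \<partial>m)"
    unfolding pt by (rule integral_mult_right_zero)
  finally have "real k * Im (a * (a * cauchy m a - 1)) = - Im a * (real k * (\<integral>s. s\<^sup>2 / (norm (a - complex_of_real s))\<^sup>2 \<partial>m))"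
    by simp
  moreover have "real k * Im (a * (a * cauchy m a - 1)) = Im (a * (of_nat k * (a * cauchy m a - 1)))"
  proof -
    have "a * (of_nat k * (a * cauchy m a - 1)) = complex_of_real (real k) * (a * (a * cauchy m a - 1))" by simp
    thus ?thesis by (simp only: times_complex.sel Re_complex_of_real Im_complex_of_real)
  qed
  ultimately have "Im (a * (cauchy M z * z - 1)) = - Im a * (real k * (\<integral>s. s\<^sup>2 / (norm (a - complex_of_real s))\<^sup>2 \<partial>m))"
    unfolding ap by simp
  thus ?thesis using a by simp
qed

lemma second_moment_integrable:
  assumes m: "borel_prob m" and a: "Im a \<noteq> 0"
  shows "integrable m (\<lambda>s. s\<^sup>2 / (norm (a - complex_of_real s))\<^sup>2)"
proof (rule integrable_bounded)
  show "finite_measure m" "sets m = sets borel" using m borel_prob_finite by (auto simp: borel_prob_def)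
  show "norm (s\<^sup>2 / (norm (a - complex_of_real s))\<^sup>2) \<le> (kernel_bound a)\<^sup>2" for s
  proof -
    have "\<bar>s\<bar> / norm (a - complex_of_real s) \<le> weight s / norm (a - complex_of_real s)"
      by (intro divide_right_mono abs_le_weight) simp
    also have "\<dots> \<le> kernel_bound a" by (rule weight_kernel_le[OF a])
    finally have "(\<bar>s\<bar> / norm (a - complex_of_real s))\<^sup>2 \<le> (kernel_bound a)\<^sup>2" by (intro power_mono) auto
    thus ?thesis by (simp add: power_divide)
  qed
qed measurable

section \<open>One-dimensional arrays: second moments and tails\<close>

locale subord_array =
  fixes m M :: "nat \<Rightarrow> real measure" and k :: "nat \<Rightarrow> nat" and M0 :: "real measure"
  assumes m: "\<And>n. borel_prob (m n)" and M: "\<And>n. borel_prob (M n)" and k: "\<And>n. k n > 0"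
    and sub: "\<And>n z. Im z \<noteq> 0 \<Longrightarrow> cauchy (m n) (subord (k n) (M n) z) = cauchy (M n) z"
    and k_lim: "filterlim k at_top sequentially" and conv: "weak_conv_prob M M0"
begin

lemma M0: "borel_prob M0" using conv by (simp add: weak_conv_prob_def)

lemma inverse_k_lim: "(\<lambda>n. 1 / complex_of_nat (k n)) \<longlonglongrightarrow> 0"
proof -
  have "(\<lambda>n. 1 / real (k n)) \<longlonglongrightarrow> 0"
    by (rule tendsto_divide_0[OF tendsto_const filterlim_at_top_imp_at_infinity])
       (rule filterlim_compose[OF filterlim_real_sequentially k_lim])
  hence "(\<lambda>n. complex_of_real (1 / real (k n))) \<longlonglongrightarrow> complex_of_real 0" by (rule tendsto_of_real)
  thus ?thesis by simp
qed

lemma cauchy_lim: "Im z \<noteq> 0 \<Longrightarrow> (\<lambda>n. cauchy (M n) z) \<longlonglongrightarrow> cauchy M0 z"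
  by (rule weak_conv_cauchy[OF conv M])

lemma subord_lim:
  assumes z: "Im z \<noteq> 0"
  shows "(\<lambda>n. subord (k n) (M n) z) \<longlonglongrightarrow> 1 / cauchy M0 z"
proof -
  have "(\<lambda>n. z * (1 / of_nat (k n)) + (1 - 1 / of_nat (k n)) * (1 / cauchy (M n) z)) \<longlonglongrightarrow> z * 0 + (1 - 0) * (1 / cauchy M0 z)"
    by (intro tendsto_intros inverse_k_lim cauchy_lim z cauchy_nonzero[OF M0])
  thus ?thesis by (simp add: subord_def)
qed

definition moment :: "complex \<Rightarrow> nat \<Rightarrow> real" where
  "moment z n = real (k n) * (\<integral>s. s\<^sup>2 / (norm (subord (k n) (M n) z - complex_of_real s))\<^sup>2 \<partial>m n)"

text \<open>The exact formula of \<open>subord_second_moment\<close> passes to the limit because the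
  subordinated points tend to \<open>F = 1 / G\<close>, and \<open>F\<close> times
  \<open>G * z - 1\<close> equals \<open>z - F\<close>.\<close>

lemma moment_lim:
  assumes z: "Im z > 0"
  shows "moment z \<longlonglongrightarrow> 1 - Im z / Im (1 / cauchy M0 z)"
proof -
  have z0: "Im z \<noteq> 0" using z by simp
  let ?G = "cauchy M0 z"
  have G: "?G \<noteq> 0" by (rule cauchy_nonzero[OF M0 z0])
  have F: "Im (1 / ?G) > 0" using Im_recip_cauchy[OF M0 z] z by linarith
  have "(\<lambda>n. - Im (subord (k n) (M n) z * (cauchy (M n) z * z - 1)) / Im (subord (k n) (M n) z))
      \<longlonglongrightarrow> - Im (1 / ?G * (?G * z - 1)) / Im (1 / ?G)"
    using F by (intro tendsto_intros subord_lim[OF z0] cauchy_lim[OF z0]) auto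
  moreover have "1 / ?G * (?G * z - 1) = z - 1 / ?G" using G by (simp add: field_simps)
  hence "- Im (1 / ?G * (?G * z - 1)) / Im (1 / ?G) = (Im (1 / ?G) - Im z) / Im (1 / ?G)"
    by (simp only: minus_complex.sel) simp
  hence "- Im (1 / ?G * (?G * z - 1)) / Im (1 / ?G) = 1 - Im z / Im (1 / ?G)"
    using F by (simp add: diff_divide_distrib)
  ultimately show ?thesis
    unfolding moment_def subord_second_moment[OF m M k z sub[OF z0]] by simp
qed

lemma subord_bounded:
  assumes z: "Im z \<noteq> 0"
  shows "\<forall>\<^sub>F n in sequentially. norm (subord (k n) (M n) z) < norm (1 / cauchy M0 z) + 1"
  by (rule order_tendstoD(2)[OF tendsto_norm[OF subord_lim[OF z]]]) simp

text \<open>The convergent quantity \<open>moment\<close> at \<open>z = \<i>\<close> dominates, up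
  to a constant: its poles are bounded by \<open>A\<close>, so the square of their distance to
  \<open>s\<close> is at most a multiple of \<open>1 + s\<^sup>2\<close>.\<close>

lemma second_moment_bounded:
  "\<exists>B. \<forall>\<^sub>F n in sequentially. real (k n) * (\<integral>s. s\<^sup>2 / (weight s)\<^sup>2 \<partial>m n) \<le> B"
proof -
  have i: "Im \<i> > 0" "Im \<i> \<noteq> 0" by auto
  define A where "A = norm (1 / cauchy M0 \<i>) + 1"
  \<comment> \<open>The square of \<open>A + \<bar>s\<bar>\<close> is at most
    \<open>2 * A\<^sup>2 + 2 * s\<^sup>2\<close>, hence at most \<open>D\<close> times
    \<open>1 + s\<^sup>2\<close>.\<close>
  define D where "D = 2 * A\<^sup>2 + 2"
  have D: "D > 0" by (simp add: D_def add_nonneg_pos)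
  have "1 - Im \<i> / Im (1 / cauchy M0 \<i>) < 2"
    using Im_recip_cauchy[OF M0 i(1)] by (smt (verit) divide_nonneg_nonneg imaginary_unit.simps(2))
  from order_tendstoD(2)[OF moment_lim[OF i(1)] this] subord_bounded[OF i(2)]
  have "\<forall>\<^sub>F n in sequentially. real (k n) * (\<integral>s. s\<^sup>2 / (weight s)\<^sup>2 \<partial>m n) \<le> D * 2"
  proof eventually_elim
    case (elim n)
    define a where "a = subord (k n) (M n) \<i>"
    have a: "Im a \<noteq> 0" using Im_subord(3)[OF M k i(2), of n n] by (simp add: a_def)
    have fin: "finite_measure (m n)" "sets (m n) = sets borel"
      using borel_prob_finite[OF m] m[of n] by (simp_all add: borel_prob_def)
    have "(\<integral>s. s\<^sup>2 / (weight s)\<^sup>2 \<partial>m n) \<le> (\<integral>s. D * (s\<^sup>2 / (norm (a - complex_of_real s))\<^sup>2) \<partial>m n)"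
    proof (rule integral_mono)
      show "integrable (m n) (\<lambda>s. s\<^sup>2 / (weight s)\<^sup>2)"
      proof (rule integrable_bounded[OF fin])
        show "norm (s\<^sup>2 / (weight s)\<^sup>2) \<le> 1" for s
          using zero_le_power2[of s] by (simp add: weight_sq divide_le_eq add_nonneg_pos not_less)
      qed measurable
      show "integrable (m n) (\<lambda>s. D * (s\<^sup>2 / (norm (a - complex_of_real s))\<^sup>2))"
        by (intro integrable_mult_right second_moment_integrable m a)
      fix s
      have pos: "(norm (a - complex_of_real s))\<^sup>2 > 0" using nonreal_diff[OF a, of s] by simp
      have "norm (a - complex_of_real s) \<le> norm a + \<bar>s\<bar>"
        using norm_triangle_ineq4[of a "complex_of_real s"] by simp
      also have "\<dots> \<le> A + \<bar>s\<bar>" using elim(2) by (simp add: a_def A_def)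
      finally have "(norm (a - complex_of_real s))\<^sup>2 \<le> (A + \<bar>s\<bar>)\<^sup>2" by (intro power_mono) auto
      also have "\<dots> \<le> 2 * A\<^sup>2 + 2 * s\<^sup>2"
        using sum_squares_bound[of A "\<bar>s\<bar>"] by (simp add: power2_sum)
      also have "\<dots> \<le> D * (weight s)\<^sup>2" by (simp add: weight_sq D_def algebra_simps)
      finally have le: "(norm (a - complex_of_real s))\<^sup>2 \<le> D * (weight s)\<^sup>2" .
      have w: "(weight s)\<^sup>2 > 0" using weight_pos[of s] by simp
      have "s\<^sup>2 / (weight s)\<^sup>2 = D * (s\<^sup>2 / (D * (weight s)\<^sup>2))" using D by simp
      also have "\<dots> \<le> D * (s\<^sup>2 / (norm (a - complex_of_real s))\<^sup>2)"
        using le pos D w by (intro mult_left_mono divide_left_mono) auto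
      finally show "s\<^sup>2 / (weight s)\<^sup>2 \<le> D * (s\<^sup>2 / (norm (a - complex_of_real s))\<^sup>2)" .
    qed
    also have "\<dots> = D * (\<integral>s. s\<^sup>2 / (norm (a - complex_of_real s))\<^sup>2 \<partial>m n)" by (rule integral_mult_right_zero)
    finally have "real (k n) * (\<integral>s. s\<^sup>2 / (weight s)\<^sup>2 \<partial>m n) \<le> D * moment \<i> n"
      using mult_left_mono[of _ _ "real (k n)"] by (fastforce simp: moment_def a_def mult.left_commute)
    also have "\<dots> \<le> D * 2" using elim(1) D by (intro mult_left_mono) auto
    finally show ?case .
  qed
  thus ?thesis by blast
qed

text \<open>High on the imaginary axis \<open>1 / cauchy M0 z\<close> is asymptotic to
  \<open>z\<close>, so the ratio of the imaginary parts tends to 1 and the limit of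
  \<open>moment\<close> becomes small.\<close>

lemma moment_small:
  assumes "\<epsilon> > 0"
  shows "\<exists>z. Im z > 0 \<and> 1 - Im z / Im (1 / cauchy M0 z) < \<epsilon>"
proof -
  have lim: "(\<lambda>n. 1 / (\<i> * of_nat n * cauchy M0 (\<i> * of_nat n))) \<longlonglongrightarrow> 1 / 1"
    by (intro tendsto_intros cauchy_at_infinity[OF M0]) auto
  have "(\<lambda>n. 1 - 1 / Re (1 / (\<i> * of_nat n * cauchy M0 (\<i> * of_nat n)))) \<longlonglongrightarrow> 1 - 1 / Re (1 / 1)"
    by (intro tendsto_intros lim) auto
  hence "(\<lambda>n. 1 - 1 / Re (1 / (\<i> * of_nat n * cauchy M0 (\<i> * of_nat n)))) \<longlonglongrightarrow> 0" by simp
  from eventually_conj[OF order_tendstoD(2)[OF this assms] eventually_gt_at_top[of 0]]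
  obtain n where n: "1 - 1 / Re (1 / (\<i> * of_nat n * cauchy M0 (\<i> * of_nat n))) < \<epsilon>" "n > 0"
    by (auto simp: eventually_sequentially)
  define F where "F = 1 / cauchy M0 (\<i> * of_nat n)"
  have e: "1 / (\<i> * of_nat n * cauchy M0 (\<i> * of_nat n)) = F / (\<i> * of_nat n)" by (simp add: F_def)
  have "Re (F / (\<i> * of_nat n)) = Im F / real n"
    using n(2) by (simp add: Re_divide power2_eq_square)
  hence "1 - Im (\<i> * of_nat n) / Im F < \<epsilon>" using n unfolding e by simp
  thus ?thesis using n(2) by (intro exI[of _ "\<i> * of_nat n"]) (simp add: F_def)
qed

text \<open>A point \<open>z\<close> with small limit of \<open>moment\<close> is fixed before
  \<open>K\<close>, which bounds the subordinated points \<open>a\<close> of \<open>z\<close>. If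
  \<open>\<bar>s\<bar> > K\<close>, then \<open>norm (a - s) \<le> 2 * \<bar>s\<bar>\<close>, so the
  integrand of \<open>moment\<close> is at least 1/4 on the tail; hence the factor 4.\<close>

lemma tail_small:
  assumes "\<epsilon> > 0"
  shows "\<exists>K. \<forall>\<^sub>F n in sequentially. real (k n) * measure (m n) {s. \<bar>s\<bar> > K} < \<epsilon>"
proof -
  have "\<epsilon> / 4 > 0" using assms by simp
  then obtain z where z: "Im z > 0" "1 - Im z / Im (1 / cauchy M0 z) < \<epsilon> / 4"
    using moment_small by blast
  have z0: "Im z \<noteq> 0" using z by simp
  define K where "K = norm (1 / cauchy M0 z) + 1"
  from order_tendstoD(2)[OF moment_lim[OF z(1)] z(2)] subord_bounded[OF z0]
  have "\<forall>\<^sub>F n in sequentially. real (k n) * measure (m n) {s. \<bar>s\<bar> > K} < \<epsilon>"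
  proof eventually_elim
    case (elim n)
    define a where "a = subord (k n) (M n) z"
    have a: "Im a \<noteq> 0" using Im_subord(3)[OF M k z0, of n n] by (simp add: a_def)
    interpret prob_space "m n" using m by (simp add: borel_prob_def)
    have sm: "sets (m n) = sets borel" using m by (simp add: borel_prob_def)
    have A: "{s :: real. \<bar>s\<bar> > K} \<in> sets (m n)" unfolding sm by measurable
    have "measure (m n) {s. \<bar>s\<bar> > K} = (\<integral>s. indicator {s. \<bar>s\<bar> > K} s \<partial>m n)" using A by simp
    also have "\<dots> \<le> (\<integral>s. 4 * (s\<^sup>2 / (norm (a - complex_of_real s))\<^sup>2) \<partial>m n)"
    proof (rule integral_mono)
      show "integrable (m n) (indicator {s. \<bar>s\<bar> > K} :: real \<Rightarrow> real)"
        using A by (intro integrable_real_indicator) (auto simp: emeasure_eq_measure)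
      show "integrable (m n) (\<lambda>s. 4 * (s\<^sup>2 / (norm (a - complex_of_real s))\<^sup>2))"
        by (intro integrable_mult_right second_moment_integrable m a)
      fix s
      show "indicator {s. \<bar>s\<bar> > K} s \<le> 4 * (s\<^sup>2 / (norm (a - complex_of_real s))\<^sup>2)"
      proof (cases "\<bar>s\<bar> > K")
        case True
        have pos: "(norm (a - complex_of_real s))\<^sup>2 > 0" using nonreal_diff[OF a, of s] by simp
        have "norm (a - complex_of_real s) \<le> norm a + \<bar>s\<bar>"
          using norm_triangle_ineq4[of a "complex_of_real s"] by simp
        also have "\<dots> \<le> 2 * \<bar>s\<bar>" using True elim(2) by (simp add: a_def K_def)
        finally have "(norm (a - complex_of_real s))\<^sup>2 \<le> (2 * \<bar>s\<bar>)\<^sup>2" by (intro power_mono) auto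
        thus ?thesis using True pos by (simp add: field_simps power_mult_distrib)
      qed simp
    qed
    also have "\<dots> = 4 * (\<integral>s. s\<^sup>2 / (norm (a - complex_of_real s))\<^sup>2 \<partial>m n)" by (rule integral_mult_right_zero)
    finally have "real (k n) * measure (m n) {s. \<bar>s\<bar> > K} \<le> 4 * moment z n"
      using mult_left_mono[of _ _ "real (k n)"] by (fastforce simp: moment_def a_def mult.left_commute)
    also have "\<dots> < \<epsilon>" using elim(1) by simp
    finally show ?case .
  qed
  thus ?thesis by blast
qed

end

section \<open>The limit theorem\<close>

definition rho_density :: "nat \<Rightarrow> real \<times> real \<Rightarrow> real" where
  "rho_density k x = real k * (fst x * snd x / (weight (fst x) * weight (snd x)))"

lemma rho_density_measurable [measurable]: "rho_density k \<in> borel_measurable borel"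
  unfolding rho_density_def by measurable

lemma square_over_weight_le: "x\<^sup>2 / (weight x)\<^sup>2 \<le> 1"
proof -
  have "1 + x\<^sup>2 > 0" by (simp add: add_pos_nonneg)
  thus ?thesis unfolding weight_sq by (simp add: divide_le_eq_1)
qed

lemma kernel_bound_nonneg: "0 \<le> kernel_bound z"
  using kernel_bound_ge_1[of z] by linarith

text \<open>The inequality of the means with a free factor \<open>c\<close>. The freedom matters on
  the tails: the share of the large coordinate has small integral there, while that of the other
  coordinate is only bounded and has to be damped by \<open>1 / c\<close>.\<close>

lemma abs_rho_density_le:
  assumes "c > 0"
  shows "\<bar>rho_density k x\<bar> \<le> real k * (c * ((fst x)\<^sup>2 / (weight (fst x))\<^sup>2) + ((snd x)\<^sup>2 / (weight (snd x))\<^sup>2) / c) / 2"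
proof -
  define u where "u = \<bar>fst x\<bar> / weight (fst x)"
  define v where "v = \<bar>snd x\<bar> / weight (snd x)"
  have "\<bar>rho_density k x\<bar> = real k * (u * v)"
    using weight_pos[of "fst x"] weight_pos[of "snd x"]
    by (simp add: rho_density_def u_def v_def abs_mult abs_divide)
  also have "u * v \<le> (c * u\<^sup>2 + v\<^sup>2 / c) / 2"
    using assms zero_le_power2[of "c * u - v"] by (simp add: field_simps power2_eq_square)
  finally have "\<bar>rho_density k x\<bar> \<le> real k * ((c * u\<^sup>2 + v\<^sup>2 / c) / 2)" by (simp add: mult_left_mono)
  thus ?thesis by (simp add: u_def v_def power_divide)
qed

lemma abs_rho_density_le_const: "\<bar>rho_density k x\<bar> \<le> real k"
proof -
  have "\<bar>rho_density k x\<bar> \<le> real k * (1 * ((fst x)\<^sup>2 / (weight (fst x))\<^sup>2) + ((snd x)\<^sup>2 / (weight (snd x))\<^sup>2) / 1) / 2"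
    by (rule abs_rho_density_le) simp
  also have "\<dots> \<le> real k * (1 * 1 + 1 / 1) / 2"
    by (intro divide_right_mono mult_left_mono add_mono square_over_weight_le) auto
  finally show ?thesis by simp
qed

lemma rho_measure_eq: "rho_measure k M A = (LINT x:A|M. rho_density k x)"
  unfolding rho_measure_def rho_density_def weight_def by (simp add: case_prod_unfold)

lemma rho_density_integrable:
  assumes "borel_prob M"
  shows "integrable M (rho_density k)"
proof (rule integrable_bounded)
  show "finite_measure M" "sets M = sets borel"
    using borel_prob_finite[OF assms] assms by (simp_all add: borel_prob_def)
  show "norm (rho_density k x) \<le> real k" for x using abs_rho_density_le_const by simp
qed simp

lemma signed_integral_rho:
  fixes f :: "real \<times> real \<Rightarrow> 'b::{banach, second_countable_topology}"
  assumes "borel_prob M" "f \<in> borel_measurable borel" "\<And>x. norm (f x) \<le> B"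
  shows "signed_integral (rho_measure k M) f = (\<integral>x. rho_density k x *\<^sub>R f x \<partial>M)"
  by (rule signed_integral_density[OF _ rho_density_integrable[OF assms(1)] rho_measure_eq assms(2,3)])
     (use assms(1) in \<open>simp add: borel_prob_def\<close>)

lemma cauchy2_weighted_eq: "cauchy2_weighted \<rho> z w = signed_integral \<rho> (wkernel z w)"
proof -
  have "(\<lambda>(s, t). complex_of_real (sqrt (1 + s\<^sup>2) * sqrt (1 + t\<^sup>2)) /
        ((z - complex_of_real s) * (w - complex_of_real t))) = wkernel z w"
    by (auto simp: fun_eq_iff wkernel_def weight_def)
  thus ?thesis by (simp add: cauchy2_weighted_def)
qed

lemma cauchy2_weighted_rho:
  assumes M: "borel_prob M" and z: "Im z \<noteq> 0" "Im w \<noteq> 0"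
  shows "cauchy2_weighted (rho_measure k M) z w = (\<integral>x. rho_density k x *\<^sub>R wkernel z w x \<partial>M)"
  unfolding cauchy2_weighted_eq by (rule signed_integral_rho[OF M wkernel_measurable wkernel_le[OF z]])

text \<open>The weights of density and kernel cancel, and
  \<open>s / (z - s) = z / (z - s) - 1\<close> in both coordinates. Integration thus expresses the
  weighted transform through \<open>cauchy2\<close> and the transforms of the marginals.\<close>

lemma rho_wkernel:
  assumes "Im z \<noteq> 0" "Im w \<noteq> 0"
  shows "rho_density k x *\<^sub>R wkernel z w x = of_nat k *
    (z * w * (1 / ((z - complex_of_real (fst x)) * (w - complex_of_real (snd x))))
      - z * (1 / (z - complex_of_real (fst x))) - w * (1 / (w - complex_of_real (snd x))) + 1)"
proof -
  define s t where "s = complex_of_real (fst x)" and "t = complex_of_real (snd x)"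
  have nz: "z - s \<noteq> 0" "w - t \<noteq> 0" using nonreal_diff assms by (auto simp: s_def t_def)
  have W: "complex_of_real (weight (fst x) * weight (snd x)) \<noteq> 0"
    using weight_pos[of "fst x"] weight_pos[of "snd x"] by simp
  have "rho_density k x *\<^sub>R wkernel z w x = of_nat k * (s * t / ((z - s) * (w - t)))"
    using W by (simp add: rho_density_def wkernel_def scaleR_conv_of_real s_def t_def)
  also have "s * t / ((z - s) * (w - t)) = (z * (1 / (z - s)) - 1) * (w * (1 / (w - t)) - 1)"
  proof -
    have "z * (1 / (z - s)) - 1 = s / (z - s)" "w * (1 / (w - t)) - 1 = t / (w - t)"
      using nz by (simp_all add: field_simps)
    thus ?thesis by simp
  qed
  also have "\<dots> = z * w * (1 / ((z - s) * (w - t))) - z * (1 / (z - s)) - w * (1 / (w - t)) + 1"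
    by (simp add: algebra_simps)
  finally show ?thesis by (simp add: s_def t_def)
qed

context bifree_power
begin

definition covariance :: "complex \<Rightarrow> complex \<Rightarrow> complex" where
  "covariance z w = cauchy2_weighted (rho_measure k \<mu>) (\<omega>1 z) (\<omega>2 w)"

text \<open>The limit equation before the limit, as an exact identity with its errors collected over
  \<open>of_nat k\<close>. By \<open>subord_mult\<close> the terms \<open>G1 * z - 1\<close> and
  \<open>G2 * w - 1\<close> are \<open>k\<close> times \<open>\<omega> * G - 1\<close> in the
  respective coordinate, the size at which the marginals enter the weighted transform.\<close>

lemma covariance_identity:
  assumes zw: "Im z \<noteq> 0" "Im w \<noteq> 0"
  defines "G1 \<equiv> cauchy (marginal1 \<nu>) z" and "G2 \<equiv> cauchy (marginal2 \<nu>) w"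
  shows "G1 * G2 * (1 + (G1 * z - 1 + (G2 * w - 1) + covariance z w) / of_nat k) =
    cauchy2 \<nu> z w * (1 - covariance z w +
      (G1 * z - 1 + (G2 * w - 1) + covariance z w + (G1 * z - 1) * (G2 * w - 1)) / of_nat k)"
proof -
  note bm = borel_prob_marginal[OF \<mu>] and bn = borel_prob_marginal[OF \<nu>]
  define K :: complex where "K = of_nat k"
  have K: "K \<noteq> 0" using k by (simp add: K_def)
  define a b where "a = \<omega>1 z" and "b = \<omega>2 w"
  have ab: "Im a \<noteq> 0" "Im b \<noteq> 0"
    using Im_subord(3)[OF bn(1) k zw(1)] Im_subord(3)[OF bn(2) k zw(2)] by (auto simp: a_def b_def)
  define g h C where "g = cauchy2 \<mu> a b" and "h = cauchy2 \<nu> z w" and "C = covariance z w"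
  define p q where "p = G1 * z - 1" and "q = G2 * w - 1"
  have p: "K * (a * G1 - 1) = p" and q: "K * (b * G2 - 1) = q"
    using subord_mult[OF bn(1) k zw(1)] subord_mult[OF bn(2) k zw(2)]
    by (simp_all add: K_def a_def b_def p_def q_def G1_def G2_def)
  have fin: "finite_measure \<mu>" "sets \<mu> = sets borel" using borel_prob_finite[OF \<mu>] \<mu> by (simp_all add: borel_prob_def)
  interpret prob_space \<mu> using \<mu> by (simp add: borel_prob_def)
  have C: "C = K * (a * b * g - a * G1 - b * G2 + 1)"
  proof -
    let ?e = "\<lambda>x. 1 / ((a - complex_of_real (fst x)) * (b - complex_of_real (snd x)))"
    let ?e1 = "\<lambda>x. 1 / (a - complex_of_real (fst x))" and ?e2 = "\<lambda>x. 1 / (b - complex_of_real (snd x))"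
    have i: "integrable \<mu> ?e" by (rule kernel2_integrable[OF fin ab])
    have i1: "integrable \<mu> ?e1"
      by (rule integrable_bounded[OF fin _ kernel_le[OF ab(1)]]) measurable
    have i2: "integrable \<mu> ?e2"
      by (rule integrable_bounded[OF fin _ kernel_le[OF ab(2)]]) measurable
    have "C = (\<integral>x. K * (a * b * ?e x - a * ?e1 x - b * ?e2 x + 1) \<partial>\<mu>)"
      unfolding C_def covariance_def a_def[symmetric] b_def[symmetric] cauchy2_weighted_rho[OF \<mu> ab] rho_wkernel[OF ab] K_def ..
    also have "\<dots> = K * (\<integral>x. a * b * ?e x - a * ?e1 x - b * ?e2 x + 1 \<partial>\<mu>)"
      by (rule integral_mult_right_zero)
    also have "(\<integral>x. a * b * ?e x - a * ?e1 x - b * ?e2 x + 1 \<partial>\<mu>) =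
        (\<integral>x. a * b * ?e x \<partial>\<mu>) - (\<integral>x. a * ?e1 x \<partial>\<mu>) - (\<integral>x. b * ?e2 x \<partial>\<mu>) + (\<integral>x. 1 \<partial>\<mu>)"
    proof -
      have "(\<integral>x. f1 x - f2 x - f3 x + f4 x \<partial>\<mu>) = (\<integral>x. f1 x \<partial>\<mu>) - (\<integral>x. f2 x \<partial>\<mu>) - (\<integral>x. f3 x \<partial>\<mu>) + (\<integral>x. f4 x \<partial>\<mu>)"
        if "integrable \<mu> f1" "integrable \<mu> f2" "integrable \<mu> f3" "integrable \<mu> f4" for f1 f2 f3 f4 :: "real \<times> real \<Rightarrow> complex"
        using that by simp
      thus ?thesis by this (intro integrable_mult_right i i1 i2 integrable_const)+
    qed
    also have "(\<integral>x. a * b * ?e x \<partial>\<mu>) = a * b * g" unfolding g_def cauchy2_eq by (rule integral_mult_right_zero)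
    also have "(\<integral>x. a * ?e1 x \<partial>\<mu>) = a * G1"
      unfolding G1_def cauchy_\<omega>(1)[OF zw(1), symmetric] a_def[symmetric] cauchy_marginal(1)[OF \<mu>]
      by (rule integral_mult_right_zero)
    also have "(\<integral>x. b * ?e2 x \<partial>\<mu>) = b * G2"
      unfolding G2_def cauchy_\<omega>(2)[OF zw(2), symmetric] b_def[symmetric] cauchy_marginal(2)[OF \<mu>]
      by (rule integral_mult_right_zero)
    also have "(\<integral>x. 1 \<partial>\<mu>) = (1::complex)" using prob_space by simp
    finally show ?thesis .
  qed
  have id: "G1 * G2 * g = h * ((1 - K) * g + K * (G1 * G2))"
    using cauchy2_identity[OF zw] by (simp add: G1_def G2_def g_def h_def K_def a_def b_def)
  \<comment> \<open>After division by \<open>K\<close> the marginal terms \<open>a * G1\<close> and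
    \<open>b * G2\<close> in \<open>p\<close>, \<open>q\<close> and \<open>C\<close> cancel.\<close>
  have e: "(p + q + C) / K = a * b * g - 1"
    unfolding p[symmetric] q[symmetric] C using K by (simp add: field_simps)
  have "h * (1 - C + (p + q + C + p * q) / K) = h * (1 - C + (a * b * g - 1) + p * q / K)"
    unfolding add_divide_distrib[of "p + q + C"] e by (simp add: add.assoc)
  also have "p * q / K = K * (a * G1 - 1) * (b * G2 - 1)"
    unfolding p[symmetric] q[symmetric] using K by simp
  also have "h * (1 - C + (a * b * g - 1) + K * (a * G1 - 1) * (b * G2 - 1)) =
      a * b * (h * ((1 - K) * g + K * (G1 * G2)))"
    unfolding C by (simp add: algebra_simps)
  also have "\<dots> = G1 * G2 * (1 + (p + q + C) / K)"
    unfolding id[symmetric] e by (simp add: algebra_simps)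
  finally show ?thesis unfolding p_def q_def C_def K_def h_def by (rule sym)
qed

end

section \<open>A priori bounds and the limit identity\<close>

lemma density_measure_le:
  assumes g: "integrable Q g" and A: "A \<in> sets Q"
  shows "finite_measure (density Q (\<lambda>x. ennreal (g x)))"
    "measure (density Q (\<lambda>x. ennreal (g x))) A \<le> (\<integral>x. \<bar>g x\<bar> * indicator A x \<partial>Q)"
proof -
  have le: "emeasure (density Q (\<lambda>x. ennreal (g x))) B \<le> ennreal (\<integral>x. \<bar>g x\<bar> * indicator B x \<partial>Q)" if B: "B \<in> sets Q" for B
  proof -
    have "emeasure (density Q (\<lambda>x. ennreal (g x))) B = (\<integral>\<^sup>+x. ennreal (g x) * indicator B x \<partial>Q)"
      using g B by (intro emeasure_density) auto
    also have "\<dots> \<le> (\<integral>\<^sup>+x. ennreal (\<bar>g x\<bar> * indicator B x) \<partial>Q)"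
      by (intro nn_integral_mono) (auto simp: indicator_def intro: ennreal_leI)
    also have "\<dots> = ennreal (\<integral>x. \<bar>g x\<bar> * indicator B x \<partial>Q)"
      using g B by (intro nn_integral_eq_integral integrable_real_mult_indicator) auto
    finally show ?thesis .
  qed
  show "finite_measure (density Q (\<lambda>x. ennreal (g x)))"
  proof (rule finite_measureI)
    have "emeasure (density Q (\<lambda>x. ennreal (g x))) (space Q) < \<infinity>"
      by (rule le_less_trans[OF le]) auto
    thus "emeasure (density Q (\<lambda>x. ennreal (g x))) (space (density Q (\<lambda>x. ennreal (g x)))) \<noteq> \<infinity>"
      by simp
  qed
  show "measure (density Q (\<lambda>x. ennreal (g x))) A \<le> (\<integral>x. \<bar>g x\<bar> * indicator A x \<partial>Q)"
    using le[OF A] by (simp add: measure_def enn2real_leI)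
qed

text \<open>The resolvent identity in each pole separately. The bound does not contain
  \<open>x\<close>, so it can be integrated against the total variation of the signed
  measures.\<close>

lemma wkernel_diff_le:
  assumes "Im a \<noteq> 0" "Im b \<noteq> 0" "Im a' \<noteq> 0" "Im b' \<noteq> 0"
  shows "norm (wkernel a' b' x - wkernel a b x) \<le>
    norm (a' - a) * (1 / \<bar>Im a'\<bar>) * kernel_bound a * kernel_bound b' + kernel_bound a * (norm (b' - b) * (1 / \<bar>Im b'\<bar>) * kernel_bound b)"
proof -
  define \<phi> where "\<phi> c s = complex_of_real (weight s) / (c - complex_of_real s)" for c s
  have \<phi>: "norm (\<phi> c s) \<le> kernel_bound c" if "Im c \<noteq> 0" for c s
    using weight_kernel_le[OF that, of s] weight_pos[of s] by (simp add: \<phi>_def norm_divide)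
  have d: "norm (\<phi> c' s - \<phi> c s) \<le> norm (c' - c) * (1 / \<bar>Im c'\<bar>) * kernel_bound c" if "Im c \<noteq> 0" "Im c' \<noteq> 0" for c c' s
  proof -
    have "\<phi> c' s - \<phi> c s = - (c' - c) * (1 / (c' - complex_of_real s)) * \<phi> c s"
      using nonreal_diff[OF that(1), of s] nonreal_diff[OF that(2), of s] by (simp add: \<phi>_def field_simps)
    hence "norm (\<phi> c' s - \<phi> c s) = norm (c' - c) * norm (1 / (c' - complex_of_real s)) * norm (\<phi> c s)"
      by (simp only: norm_mult norm_minus_cancel)
    also have "\<dots> \<le> norm (c' - c) * (1 / \<bar>Im c'\<bar>) * kernel_bound c"
      by (intro mult_mono kernel_le that \<phi>) auto
    finally show ?thesis .
  qed
  have wk: "wkernel c e x = \<phi> c (fst x) * \<phi> e (snd x)" for c e by (simp add: wkernel_def \<phi>_def)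
  have "wkernel a' b' x - wkernel a b x = (\<phi> a' (fst x) - \<phi> a (fst x)) * \<phi> b' (snd x) + \<phi> a (fst x) * (\<phi> b' (snd x) - \<phi> b (snd x))"
    unfolding wk by (simp add: algebra_simps)
  also have "norm \<dots> \<le> norm (\<phi> a' (fst x) - \<phi> a (fst x)) * norm (\<phi> b' (snd x)) + norm (\<phi> a (fst x)) * norm (\<phi> b' (snd x) - \<phi> b (snd x))"
    by (rule order_trans[OF norm_triangle_ineq]) (simp add: norm_mult)
  also have "\<dots> \<le> norm (a' - a) * (1 / \<bar>Im a'\<bar>) * kernel_bound a * kernel_bound b' + kernel_bound a * (norm (b' - b) * (1 / \<bar>Im b'\<bar>) * kernel_bound b)"
    using kernel_bound_ge_1[of a] kernel_bound_ge_1[of b'] kernel_bound_ge_1[of b]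
    by (intro add_mono mult_mono d \<phi> assms mult_nonneg_nonneg) auto
  finally show ?thesis .
qed

lemma cauchy2_bound:
  assumes M: "borel_prob M" and "Im z \<noteq> 0" "Im w \<noteq> 0"
  shows "norm (cauchy2 M z w) \<le> 1 / \<bar>Im z\<bar> * (1 / \<bar>Im w\<bar>)"
proof -
  interpret prob_space M using M by (simp add: borel_prob_def)
  have fin: "finite_measure M" "sets M = sets borel" using borel_prob_finite[OF M] M by (simp_all add: borel_prob_def)
  have "norm (cauchy2 M z w) \<le> (\<integral>x. norm (1 / ((z - complex_of_real (fst x)) * (w - complex_of_real (snd x)))) \<partial>M)"
    unfolding cauchy2_eq by (rule integral_norm_bound)
  also have "\<dots> \<le> (\<integral>x. 1 / \<bar>Im z\<bar> * (1 / \<bar>Im w\<bar>) \<partial>M)"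
    by (intro integral_mono integrable_norm kernel2_integrable fin assms kernel2_le integrable_const)
  finally show ?thesis using prob_space by simp
qed

locale bifree_array =
  fixes \<mu> \<nu> :: "nat \<Rightarrow> (real \<times> real) measure" and k :: "nat \<Rightarrow> nat" and \<alpha> \<beta> :: "nat \<Rightarrow> real"
    and m1 m2 :: "real measure"
  assumes bp: "\<And>n. bifree_power (\<mu> n) (\<nu> n) (k n) (\<alpha> n) (\<beta> n)"
    and k_lim: "filterlim k at_top sequentially"
    and conv1: "weak_conv_prob (\<lambda>n. marginal1 (\<nu> n)) m1"
    and conv2: "weak_conv_prob (\<lambda>n. marginal2 (\<nu> n)) m2"
begin

lemma b\<mu>: "borel_prob (\<mu> n)" and b\<nu>: "borel_prob (\<nu> n)" and kpos: "k n > 0"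
  using bp[of n] by (simp_all add: bifree_power_def)

lemma fin\<mu>: "finite_measure (\<mu> n)" and sets\<mu>: "sets (\<mu> n) = sets borel"
  using borel_prob_finite[OF b\<mu>] b\<mu>[of n] by (simp_all add: borel_prob_def)

sublocale L1: subord_array "\<lambda>n. marginal1 (\<mu> n)" "\<lambda>n. marginal1 (\<nu> n)" k m1
  by unfold_locales
    (auto intro!: borel_prob_marginal b\<mu> b\<nu> kpos k_lim conv1 bifree_power.cauchy_\<omega>(1)[OF bp])

sublocale L2: subord_array "\<lambda>n. marginal2 (\<mu> n)" "\<lambda>n. marginal2 (\<nu> n)" k m2
  by unfold_locales
    (auto intro!: borel_prob_marginal b\<mu> b\<nu> kpos k_lim conv2 bifree_power.cauchy_\<omega>(2)[OF bp])

abbreviation "F1 z \<equiv> 1 / cauchy m1 z"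
abbreviation "F2 w \<equiv> 1 / cauchy m2 w"

definition U :: "real \<times> real \<Rightarrow> real" where "U x = (fst x)\<^sup>2 / (weight (fst x))\<^sup>2"
definition V :: "real \<times> real \<Rightarrow> real" where "V x = (snd x)\<^sup>2 / (weight (snd x))\<^sup>2"

lemma UV_measurable [measurable]: "U \<in> borel_measurable borel" "V \<in> borel_measurable borel"
  unfolding U_def V_def by measurable

lemma UV_bounds: "0 \<le> U x" "U x \<le> 1" "0 \<le> V x" "V x \<le> 1"
  using square_over_weight_le by (auto simp: U_def V_def)

lemma UV_integrable: "integrable (\<mu> n) U" "integrable (\<mu> n) V"
  by (rule integrable_bounded[OF fin\<mu> sets\<mu>, where B=1]; use UV_bounds in simp)+

lemma UV_moment:
  "(\<integral>s. s\<^sup>2 / (weight s)\<^sup>2 \<partial>marginal1 (\<mu> n)) = (\<integral>x. U x \<partial>\<mu> n)"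
  "(\<integral>s. s\<^sup>2 / (weight s)\<^sup>2 \<partial>marginal2 (\<mu> n)) = (\<integral>x. V x \<partial>\<mu> n)"
  unfolding U_def V_def marginal1_def marginal2_def
  by (rule integral_distr[OF borel_prob_coord_measurable(1)[OF b\<mu>]], measurable,
      rule integral_distr[OF borel_prob_coord_measurable(2)[OF b\<mu>]], measurable)

text \<open>The total variation of \<open>rho_measure (k n) (\<mu> n)\<close>, computed from its
  density.\<close>

definition total :: "nat \<Rightarrow> real" where "total n = (\<integral>x. \<bar>rho_density (k n) x\<bar> \<partial>\<mu> n)"

lemma rho_integrable: "integrable (\<mu> n) (rho_density (k n))"
  by (rule rho_density_integrable[OF b\<mu>])

lemma moments_bounded:
  obtains B where "B > 0" "\<forall>\<^sub>F n in sequentially. real (k n) * (\<integral>x. U x \<partial>\<mu> n) \<le> B \<and> real (k n) * (\<integral>x. V x \<partial>\<mu> n) \<le> B"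
proof -
  obtain B1 where B1: "\<forall>\<^sub>F n in sequentially. real (k n) * (\<integral>x. U x \<partial>\<mu> n) \<le> B1"
    using L1.second_moment_bounded unfolding UV_moment by blast
  obtain B2 where B2: "\<forall>\<^sub>F n in sequentially. real (k n) * (\<integral>x. V x \<partial>\<mu> n) \<le> B2"
    using L2.second_moment_bounded unfolding UV_moment by blast
  have "\<forall>\<^sub>F n in sequentially. real (k n) * (\<integral>x. U x \<partial>\<mu> n) \<le> \<bar>B1\<bar> + \<bar>B2\<bar> + 1 \<and> real (k n) * (\<integral>x. V x \<partial>\<mu> n) \<le> \<bar>B1\<bar> + \<bar>B2\<bar> + 1"
    using B1 B2 by eventually_elim auto
  thus ?thesis by (rule that[rotated]) simp
qed

lemma total_bounded: "\<exists>B>0. \<forall>\<^sub>F n in sequentially. total n \<le> B"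
proof -
  obtain B where B: "B > 0" "\<forall>\<^sub>F n in sequentially. real (k n) * (\<integral>x. U x \<partial>\<mu> n) \<le> B \<and> real (k n) * (\<integral>x. V x \<partial>\<mu> n) \<le> B"
    using moments_bounded by blast
  have "total n \<le> real (k n) * ((\<integral>x. U x \<partial>\<mu> n) + (\<integral>x. V x \<partial>\<mu> n)) / 2" for n
  proof -
    have "total n \<le> (\<integral>x. real (k n) / 2 * (U x + V x) \<partial>\<mu> n)"
      unfolding total_def
    proof (rule integral_mono)
      show "integrable (\<mu> n) (\<lambda>x. \<bar>rho_density (k n) x\<bar>)" using rho_integrable by simp
      show "integrable (\<mu> n) (\<lambda>x. real (k n) / 2 * (U x + V x))"
        by (intro integrable_mult_right Bochner_Integration.integrable_add UV_integrable)
      show "\<bar>rho_density (k n) x\<bar> \<le> real (k n) / 2 * (U x + V x)" for x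
        using abs_rho_density_le[of 1 "k n" x] by (simp add: U_def V_def)
    qed
    also have "\<dots> = real (k n) / 2 * (\<integral>x. U x + V x \<partial>\<mu> n)" by (rule integral_mult_right_zero)
    also have "(\<integral>x. U x + V x \<partial>\<mu> n) = (\<integral>x. U x \<partial>\<mu> n) + (\<integral>x. V x \<partial>\<mu> n)"
      by (rule Bochner_Integration.integral_add) (rule UV_integrable)+
    finally show ?thesis by simp
  qed
  note le = this
  have "\<forall>\<^sub>F n in sequentially. total n \<le> B"
    using B(2)
  proof eventually_elim
    case (elim n)
    hence "real (k n) * (\<integral>x. U x \<partial>\<mu> n) \<le> B" "real (k n) * (\<integral>x. V x \<partial>\<mu> n) \<le> B" by auto
    moreover have "(p + q) / 2 \<le> B" if "p \<le> B" "q \<le> B" for p q :: real using that by simp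
    ultimately show ?case using order_trans[OF le[of n, unfolded distrib_left]] by blast
  qed
  thus ?thesis using B(1) by blast
qed

lemma outside_sets: "outside K \<in> sets (\<mu> n)"
  unfolding sets\<mu> by (rule outside_borel)

text \<open>Outside the box one coordinate is large. The inequality of the means gives that
  coordinate the factor \<open>c\<close> and the other one \<open>1 / c\<close>: the first share is
  at most \<open>c\<close> times an indicator and falls under \<open>tail_small\<close>, the second
  is a bounded moment divided by the large \<open>c\<close>.\<close>

lemma total_tail:
  assumes \<epsilon>: "\<epsilon> > 0"
  shows "\<exists>K. \<forall>\<^sub>F n in sequentially. (\<integral>x. \<bar>rho_density (k n) x\<bar> * indicator (outside K) x \<partial>\<mu> n) < \<epsilon>"
proof -
  obtain B where B: "B > 0" "\<forall>\<^sub>F n in sequentially. real (k n) * (\<integral>x. U x \<partial>\<mu> n) \<le> B \<and> real (k n) * (\<integral>x. V x \<partial>\<mu> n) \<le> B"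
    using moments_bounded by blast
  \<comment> \<open>The moments contribute \<open>(B + B) / (2 * c) = \<epsilon> / 2\<close>, and
    each of the two tails, bounded by \<open>\<epsilon> / (2 * c)\<close> and multiplied by
    \<open>c / 2\<close>, contributes \<open>\<epsilon> / 4\<close>.\<close>
  define c where "c = 2 * B / \<epsilon>"
  have c: "c > 0" using B \<epsilon> by (simp add: c_def)
  have \<epsilon>': "\<epsilon> / (2 * c) > 0" using \<epsilon> c by simp
  obtain K1 where K1: "\<forall>\<^sub>F n in sequentially. real (k n) * measure (marginal1 (\<mu> n)) {s. \<bar>s\<bar> > K1} < \<epsilon> / (2 * c)"
    using L1.tail_small[OF \<epsilon>'] by blast
  obtain K2 where K2: "\<forall>\<^sub>F n in sequentially. real (k n) * measure (marginal2 (\<mu> n)) {s. \<bar>s\<bar> > K2} < \<epsilon> / (2 * c)"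
    using L2.tail_small[OF \<epsilon>'] by blast
  define A1 where "A1 = {x :: real \<times> real. \<bar>fst x\<bar> > K1}"
  define A2 where "A2 = {x :: real \<times> real. \<bar>snd x\<bar> > K2}"
  have A: "A1 \<in> sets (\<mu> n)" "A2 \<in> sets (\<mu> n)" for n unfolding A1_def A2_def sets\<mu> by measurable
  note mm = measure_marginal[OF b\<mu>, of _ K1, folded A1_def] measure_marginal[OF b\<mu>, of _ K2, folded A2_def]
  define K where "K = max K1 K2"
  have "\<forall>\<^sub>F n in sequentially. (\<integral>x. \<bar>rho_density (k n) x\<bar> * indicator (outside K) x \<partial>\<mu> n) < \<epsilon>"
    using K1 K2 B(2)
  proof eventually_elim
    case (elim n)
    interpret finite_measure "\<mu> n" by (rule fin\<mu>)
    let ?f = "\<lambda>x. real (k n) / 2 * (c * indicator A1 x + c * indicator A2 x + (U x + V x) / c)"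
    have ia: "integrable (\<mu> n) (indicator A1 :: _ \<Rightarrow> real)" "integrable (\<mu> n) (indicator A2 :: _ \<Rightarrow> real)"
      using A by (auto intro!: integrable_real_indicator simp: emeasure_eq_measure)
    have iall: "integrable (\<mu> n) (\<lambda>x. c * indicator A1 x + c * indicator A2 x + (U x + V x) / c)"
      by (intro Bochner_Integration.integrable_add integrable_mult_right ia integrable_divide UV_integrable)
    have "(\<integral>x. \<bar>rho_density (k n) x\<bar> * indicator (outside K) x \<partial>\<mu> n) \<le> (\<integral>x. ?f x \<partial>\<mu> n)"
    proof (rule integral_mono)
      show "integrable (\<mu> n) (\<lambda>x. \<bar>rho_density (k n) x\<bar> * indicator (outside K) x)"
        using rho_integrable outside_sets by (intro integrable_real_mult_indicator) auto
      show "integrable (\<mu> n) ?f" by (intro integrable_mult_right iall)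
      fix x
      have f0: "?f x \<ge> 0" using c UV_bounds[of x] by (intro mult_nonneg_nonneg add_nonneg_nonneg) auto
      have r1: "\<bar>rho_density (k n) x\<bar> \<le> real (k n) / 2 * (c * U x + V x / c)"
        using abs_rho_density_le[OF c, of "k n" x] by (simp add: U_def V_def)
      have r2: "\<bar>rho_density (k n) x\<bar> \<le> real (k n) / 2 * (U x / c + c * V x)"
        using abs_rho_density_le[of "1 / c" "k n" x] c by (simp add: U_def V_def mult.commute)
      have cU: "c * U x \<le> c" "c * V x \<le> c" using c UV_bounds[of x] by (simp_all add: mult_left_le)
      have dU: "0 \<le> U x / c" "0 \<le> V x / c" using c UV_bounds[of x] by simp_all
      have ci: "0 \<le> c * indicator A1 x" "0 \<le> c * indicator A2 x" using c by simp_all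
      have "x \<in> outside K \<Longrightarrow> x \<in> A1 \<or> x \<in> A2"
        by (auto simp: outside_def A1_def A2_def K_def)
      then consider "x \<notin> outside K" | "x \<in> A1" | "x \<in> A2" "x \<notin> A1" by blast
      thus "\<bar>rho_density (k n) x\<bar> * indicator (outside K) x \<le> ?f x"
      proof cases
        case 1 thus ?thesis using f0 by simp
      next
        case 2
        have "real (k n) / 2 * (c * U x + V x / c) \<le> ?f x"
        proof (rule mult_left_mono)
          have "c * U x + V x / c \<le> c * 1 + c * indicator A2 x + (U x / c + V x / c)"
            using cU(1) dU ci(2) by linarith
          thus "c * U x + V x / c \<le> c * indicator A1 x + c * indicator A2 x + (U x + V x) / c"
            using 2 by (simp add: add_divide_distrib)
        qed simp
        thus ?thesis using r1 f0 by (auto simp: indicator_def)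
      next
        case 3
        have "real (k n) / 2 * (U x / c + c * V x) \<le> ?f x"
        proof (rule mult_left_mono)
          have "U x / c + c * V x \<le> c * indicator A1 x + c * 1 + (U x / c + V x / c)"
            using cU(2) dU ci(1) by linarith
          thus "U x / c + c * V x \<le> c * indicator A1 x + c * indicator A2 x + (U x + V x) / c"
            using 3(1) by (simp add: add_divide_distrib)
        qed simp
        thus ?thesis using r2 f0 by (auto simp: indicator_def)
      qed
    qed
    also have "\<dots> = real (k n) / 2 * (c * measure (\<mu> n) A1 + c * measure (\<mu> n) A2 + ((\<integral>x. U x \<partial>\<mu> n) + (\<integral>x. V x \<partial>\<mu> n)) / c)"
    proof -
      have "(\<integral>x. c * indicator A1 x + c * indicator A2 x + (U x + V x) / c \<partial>\<mu> n) =
          c * measure (\<mu> n) A1 + c * measure (\<mu> n) A2 + ((\<integral>x. U x \<partial>\<mu> n) + (\<integral>x. V x \<partial>\<mu> n)) / c"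
        using ia UV_integrable A by simp
      thus ?thesis by (simp only: integral_mult_right_zero)
    qed
    also have "\<dots> = c / 2 * (real (k n) * measure (\<mu> n) A1) + c / 2 * (real (k n) * measure (\<mu> n) A2)
        + (real (k n) * (\<integral>x. U x \<partial>\<mu> n) + real (k n) * (\<integral>x. V x \<partial>\<mu> n)) / (2 * c)"
      using c by (simp add: field_simps)
    also have "\<dots> < c / 2 * (\<epsilon> / (2 * c)) + c / 2 * (\<epsilon> / (2 * c)) + (B + B) / (2 * c)"
      using elim c unfolding mm
      by (intro add_less_le_mono add_strict_mono mult_strict_left_mono divide_right_mono add_mono) auto
    also have "\<dots> = \<epsilon>" using c \<epsilon> B(1) by (simp add: c_def field_simps)
    finally show ?case .
  qed
  thus ?thesis by blast
qed

text \<open>The poles are the limits \<open>F1 z\<close>, \<open>F2 w\<close> rather than the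
  subordinated points, so that the test function is the same for all \<open>n\<close>;
  \<open>cov\<close> is the version with moving poles that occurs in the exact identity.\<close>

definition C :: "complex \<Rightarrow> complex \<Rightarrow> nat \<Rightarrow> complex" where
  "C z w n = cauchy2_weighted (rho_measure (k n) (\<mu> n)) (F1 z) (F2 w)"

definition cov :: "complex \<Rightarrow> complex \<Rightarrow> nat \<Rightarrow> complex" where
  "cov z w n = bifree_power.covariance (\<mu> n) (\<nu> n) (k n) z w"

lemma weighted_le:
  assumes "Im a \<noteq> 0" "Im b \<noteq> 0"
  shows "norm (cauchy2_weighted (rho_measure (k n) (\<mu> n)) a b) \<le> kernel_bound a * kernel_bound b * total n"
proof -
  have "norm (cauchy2_weighted (rho_measure (k n) (\<mu> n)) a b) \<le> (\<integral>x. norm (rho_density (k n) x *\<^sub>R wkernel a b x) \<partial>\<mu> n)"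
    unfolding cauchy2_weighted_rho[OF b\<mu> assms] by (rule integral_norm_bound)
  also have "\<dots> \<le> (\<integral>x. kernel_bound a * kernel_bound b * \<bar>rho_density (k n) x\<bar> \<partial>\<mu> n)"
  proof (rule integral_mono')
    show "integrable (\<mu> n) (\<lambda>x. kernel_bound a * kernel_bound b * \<bar>rho_density (k n) x\<bar>)" using rho_integrable by simp
    show "norm (rho_density (k n) x *\<^sub>R wkernel a b x) \<le> kernel_bound a * kernel_bound b * \<bar>rho_density (k n) x\<bar>" for x
      using wkernel_le[OF assms, of x] by (simp add: mult.commute mult_left_mono)
  qed (intro mult_nonneg_nonneg kernel_bound_nonneg abs_ge_zero)
  finally show ?thesis by (simp add: total_def)
qed

lemma weighted_diff_le:
  assumes "Im a \<noteq> 0" "Im b \<noteq> 0" "Im a' \<noteq> 0" "Im b' \<noteq> 0"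
  shows "norm (cauchy2_weighted (rho_measure (k n) (\<mu> n)) a' b' - cauchy2_weighted (rho_measure (k n) (\<mu> n)) a b)
    \<le> (norm (a' - a) * (1 / \<bar>Im a'\<bar>) * kernel_bound a * kernel_bound b' + kernel_bound a * (norm (b' - b) * (1 / \<bar>Im b'\<bar>) * kernel_bound b)) * total n"
    (is "_ \<le> ?E * _")
proof -
  note i = integrable_scaleR_bounded[OF rho_integrable sets\<mu> wkernel_measurable wkernel_le]
  have "cauchy2_weighted (rho_measure (k n) (\<mu> n)) a' b' - cauchy2_weighted (rho_measure (k n) (\<mu> n)) a b =
      (\<integral>x. rho_density (k n) x *\<^sub>R wkernel a' b' x - rho_density (k n) x *\<^sub>R wkernel a b x \<partial>\<mu> n)"
    unfolding cauchy2_weighted_rho[OF b\<mu> assms(1,2)] cauchy2_weighted_rho[OF b\<mu> assms(3,4)]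
    by (rule Bochner_Integration.integral_diff[symmetric]) (intro i assms)+
  also have "norm \<dots> \<le> (\<integral>x. norm (rho_density (k n) x *\<^sub>R wkernel a' b' x - rho_density (k n) x *\<^sub>R wkernel a b x) \<partial>\<mu> n)"
    by (rule integral_norm_bound)
  also have "\<dots> \<le> (\<integral>x. ?E * \<bar>rho_density (k n) x\<bar> \<partial>\<mu> n)"
  proof (rule integral_mono')
    show "integrable (\<mu> n) (\<lambda>x. ?E * \<bar>rho_density (k n) x\<bar>)" using rho_integrable by simp
    fix x
    have "norm (rho_density (k n) x *\<^sub>R wkernel a' b' x - rho_density (k n) x *\<^sub>R wkernel a b x) =
        norm (wkernel a' b' x - wkernel a b x) * \<bar>rho_density (k n) x\<bar>"
      unfolding scaleR_right_diff_distrib[symmetric] by simp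
    also have "\<dots> \<le> ?E * \<bar>rho_density (k n) x\<bar>"
      by (intro mult_right_mono wkernel_diff_le assms) simp
    finally show "norm (rho_density (k n) x *\<^sub>R wkernel a' b' x - rho_density (k n) x *\<^sub>R wkernel a b x) \<le> ?E * \<bar>rho_density (k n) x\<bar>" .
    show "0 \<le> ?E * \<bar>rho_density (k n) x\<bar>"
      by (intro mult_nonneg_nonneg add_nonneg_nonneg kernel_bound_nonneg) auto
  qed
  also have "\<dots> = ?E * total n" unfolding total_def by (rule integral_mult_right_zero)
  finally show ?thesis .
qed

lemma recip_nonreal:
  assumes "Im z \<noteq> 0"
  shows "Im (F1 z) \<noteq> 0" "Im (F2 z) \<noteq> 0"
  using Im_recip_cauchy_abs[OF L1.M0 assms] Im_recip_cauchy_abs[OF L2.M0 assms] assms by auto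

lemma C_bounded:
  assumes "Im z \<noteq> 0" "Im w \<noteq> 0"
  shows "\<exists>B. \<forall>\<^sub>F n in sequentially. norm (C z w n) \<le> B"
proof -
  let ?a = "F1 z" and ?b = "F2 w"
  obtain B where B: "B > 0" "\<forall>\<^sub>F n in sequentially. total n \<le> B" using total_bounded by blast
  have "\<forall>\<^sub>F n in sequentially. norm (C z w n) \<le> kernel_bound ?a * kernel_bound ?b * B"
    using B(2)
  proof eventually_elim
    case (elim n)
    have "norm (C z w n) \<le> kernel_bound ?a * kernel_bound ?b * total n"
      unfolding C_def by (rule weighted_le[OF recip_nonreal(1)[OF assms(1)] recip_nonreal(2)[OF assms(2)]])
    also have "\<dots> \<le> kernel_bound ?a * kernel_bound ?b * B"
      using elim kernel_bound_ge_1[of ?a] kernel_bound_ge_1[of ?b] by (intro mult_left_mono) auto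
    finally show ?case .
  qed
  thus ?thesis by blast
qed

text \<open>The moving poles converge to nonreal limits, so the uniform bound on the difference of
  kernels tends to 0, and \<open>total\<close> stays bounded.\<close>

lemma cov_C_lim:
  assumes zw: "Im z \<noteq> 0" "Im w \<noteq> 0"
  shows "(\<lambda>n. cov z w n - C z w n) \<longlonglongrightarrow> 0"
proof -
  define a b where "a = F1 z" and "b = F2 w"
  define an where "an n = subord (k n) (marginal1 (\<nu> n)) z" for n
  define bn where "bn n = subord (k n) (marginal2 (\<nu> n)) w" for n
  have ab: "Im a \<noteq> 0" "Im b \<noteq> 0" using recip_nonreal zw by (auto simp: a_def b_def)
  have abn: "Im (an n) \<noteq> 0" "Im (bn n) \<noteq> 0" for n
    using Im_subord(3)[OF L1.M kpos zw(1)] Im_subord(3)[OF L2.M kpos zw(2)] by (auto simp: an_def bn_def)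
  have lim: "an \<longlonglongrightarrow> a" "bn \<longlonglongrightarrow> b"
    using L1.subord_lim[OF zw(1)] L2.subord_lim[OF zw(2)] by (auto simp: an_def[abs_def] bn_def[abs_def] a_def b_def)
  define E where "E n = norm (an n - a) * (1 / \<bar>Im (an n)\<bar>) * kernel_bound a * kernel_bound (bn n) + kernel_bound a * (norm (bn n - b) * (1 / \<bar>Im (bn n)\<bar>) * kernel_bound b)" for n
  have "(\<lambda>n. norm (an n - a) * (1 / \<bar>Im (an n)\<bar>) * kernel_bound a * (1 + (1 + norm (bn n)) / \<bar>Im (bn n)\<bar>) + kernel_bound a * (norm (bn n - b) * (1 / \<bar>Im (bn n)\<bar>) * kernel_bound b))
      \<longlonglongrightarrow> norm (a - a) * (1 / \<bar>Im a\<bar>) * kernel_bound a * (1 + (1 + norm b) / \<bar>Im b\<bar>) + kernel_bound a * (norm (b - b) * (1 / \<bar>Im b\<bar>) * kernel_bound b)"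
    using ab by (intro tendsto_intros lim) auto
  hence E: "E \<longlonglongrightarrow> 0" by (simp add: E_def[abs_def] kernel_bound_def[of "bn _"])
  obtain B where B: "B > 0" "\<forall>\<^sub>F n in sequentially. total n \<le> B" using total_bounded by blast
  have "(\<lambda>n. E n * B) \<longlonglongrightarrow> 0" using tendsto_mult_left_zero[OF E] .
  moreover have "\<forall>\<^sub>F n in sequentially. norm (cov z w n - C z w n) \<le> E n * B"
    using B(2)
  proof eventually_elim
    case (elim n)
    have "E n \<ge> 0" using kernel_bound_ge_1[of a] kernel_bound_ge_1[of b] kernel_bound_ge_1[of "bn n"]
      unfolding E_def by (intro add_nonneg_nonneg mult_nonneg_nonneg) auto
    have "cov z w n - C z w n = cauchy2_weighted (rho_measure (k n) (\<mu> n)) (an n) (bn n) - cauchy2_weighted (rho_measure (k n) (\<mu> n)) a b"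
      unfolding cov_def C_def bifree_power.covariance_def[OF bp] a_def b_def an_def bn_def ..
    hence "norm (cov z w n - C z w n) \<le> E n * total n"
      using weighted_diff_le[OF ab abn] by (simp add: E_def)
    also have "\<dots> \<le> E n * B" using elim \<open>E n \<ge> 0\<close> by (intro mult_left_mono)
    finally show ?case .
  qed
  ultimately show ?thesis by (rule Lim_null_comparison[rotated])
qed

lemma bounded_mult_null:
  fixes f g :: "nat \<Rightarrow> complex"
  assumes "\<forall>\<^sub>F n in sequentially. norm (f n) \<le> B" "g \<longlonglongrightarrow> 0"
  shows "(\<lambda>n. f n * g n) \<longlonglongrightarrow> 0"
proof (rule Lim_null_comparison)
  show "\<forall>\<^sub>F n in sequentially. norm (f n * g n) \<le> B * norm (g n)"
    using assms(1) by eventually_elim (simp add: norm_mult mult_right_mono)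
  show "(\<lambda>n. B * norm (g n)) \<longlonglongrightarrow> 0" using tendsto_mult_right_zero[OF tendsto_norm_zero[OF assms(2)]] .
qed

text \<open>Only the product is shown to converge. The boundedness of \<open>cauchy2\<close> and of
  \<open>C\<close> is enough to make the error terms vanish, without convergence of either.\<close>

lemma limit_identity:
  assumes zw: "Im z \<noteq> 0" "Im w \<noteq> 0"
  shows "(\<lambda>n. cauchy2 (\<nu> n) z w * (1 - C z w n)) \<longlonglongrightarrow> cauchy m1 z * cauchy m2 w"
proof -
  define h where "h n = cauchy2 (\<nu> n) z w" for n
  define G1 G2 where "G1 n = cauchy (marginal1 (\<nu> n)) z" and "G2 n = cauchy (marginal2 (\<nu> n)) w" for n
  define d where "d n = cov z w n - C z w n" for n
  define K where "K n = 1 / complex_of_nat (k n)" for n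
  define e where "e n = (G1 n * z - 1) * K n + (G2 n * w - 1) * K n + (C z w n * K n + d n * K n)" for n
  define e' where "e' n = (G1 n * z - 1) * (G2 n * w - 1) * K n" for n
  have hb: "\<forall>\<^sub>F n in sequentially. norm (h n) \<le> 1 / \<bar>Im z\<bar> * (1 / \<bar>Im w\<bar>)"
    unfolding h_def by (intro always_eventually allI cauchy2_bound b\<nu> zw)
  have K: "K \<longlonglongrightarrow> 0" unfolding K_def by (rule L1.inverse_k_lim)
  have d: "d \<longlonglongrightarrow> 0" unfolding d_def by (rule cov_C_lim[OF zw])
  have G: "G1 \<longlonglongrightarrow> cauchy m1 z" "G2 \<longlonglongrightarrow> cauchy m2 w"
    unfolding G1_def G2_def by (rule L1.cauchy_lim[OF zw(1)], rule L2.cauchy_lim[OF zw(2)])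
  obtain B where B: "\<forall>\<^sub>F n in sequentially. norm (C z w n) \<le> B" using C_bounded[OF zw] by blast
  have "(\<lambda>n. (G1 n * z - 1) * K n + (G2 n * w - 1) * K n + (C z w n * K n + d n * K n)) \<longlonglongrightarrow>
      (cauchy m1 z * z - 1) * 0 + (cauchy m2 w * w - 1) * 0 + (0 + 0 * 0)"
    by (intro tendsto_intros G K d bounded_mult_null[OF B K])
  hence e: "e \<longlonglongrightarrow> 0" by (simp add: e_def[abs_def])
  have "(\<lambda>n. (G1 n * z - 1) * (G2 n * w - 1) * K n) \<longlonglongrightarrow> (cauchy m1 z * z - 1) * (cauchy m2 w * w - 1) * 0"
    by (intro tendsto_intros G K)
  hence e': "e' \<longlonglongrightarrow> 0" by (simp add: e'_def[abs_def])
  have "h n * (1 - C z w n) = G1 n * G2 n * (1 + e n) + h n * d n - h n * (e n + e' n)" for n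
  proof -
    have "G1 n * G2 n * (1 + (G1 n * z - 1 + (G2 n * w - 1) + cov z w n) / of_nat (k n)) =
      h n * (1 - cov z w n + (G1 n * z - 1 + (G2 n * w - 1) + cov z w n + (G1 n * z - 1) * (G2 n * w - 1)) / of_nat (k n))"
      using bifree_power.covariance_identity[OF bp zw] by (simp add: G1_def G2_def h_def cov_def)
    moreover have "(G1 n * z - 1 + (G2 n * w - 1) + cov z w n) / of_nat (k n) = e n"
      by (simp add: e_def d_def K_def add_divide_distrib diff_divide_distrib)
    moreover have "(G1 n * z - 1 + (G2 n * w - 1) + cov z w n + (G1 n * z - 1) * (G2 n * w - 1)) / of_nat (k n) = e n + e' n"
      unfolding add_divide_distrib[of "G1 n * z - 1 + (G2 n * w - 1) + cov z w n"] calculation(2) by (simp add: e'_def K_def)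
    ultimately have "G1 n * G2 n * (1 + e n) = h n * (1 - cov z w n + (e n + e' n))" by simp
    moreover have "cov z w n = C z w n + d n" by (simp add: d_def)
    ultimately show ?thesis by (simp add: algebra_simps)
  qed
  moreover have "(\<lambda>n. G1 n * G2 n * (1 + e n) + h n * d n - h n * (e n + e' n)) \<longlonglongrightarrow>
      cauchy m1 z * cauchy m2 w * (1 + 0) + 0 - 0"
    by (intro tendsto_intros G e bounded_mult_null[OF hb] d tendsto_add_zero e e')
  ultimately show ?thesis by (simp add: h_def)
qed

lemma rhs_nonzero: "Im z \<noteq> 0 \<Longrightarrow> Im w \<noteq> 0 \<Longrightarrow> cauchy m1 z * cauchy m2 w \<noteq> 0"
  using cauchy_nonzero[OF L1.M0] cauchy_nonzero[OF L2.M0] by simp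

text \<open>The limit \<open>g\<close> cannot be 0: since \<open>C\<close> is bounded, the product
  in \<open>limit_identity\<close> would tend to 0, whereas its limit is a product of nonzero Cauchy
  transforms. So division by \<open>g\<close> is legitimate.\<close>

lemma C_limit:
  assumes zw: "Im z \<noteq> 0" "Im w \<noteq> 0" and h: "(\<lambda>n. cauchy2 (\<nu> n) z w) \<longlonglongrightarrow> g"
  shows "C z w \<longlonglongrightarrow> 1 - cauchy m1 z * cauchy m2 w / g"
proof -
  obtain B where B: "\<forall>\<^sub>F n in sequentially. norm (C z w n) \<le> B" using C_bounded[OF zw] by blast
  have B1: "\<forall>\<^sub>F n in sequentially. norm (1 - C z w n) \<le> 1 + B"
    using B by eventually_elim (rule order_trans[OF norm_triangle_ineq4], simp)
  have g: "g \<noteq> 0"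
  proof
    assume "g = 0"
    hence "(\<lambda>n. (1 - C z w n) * cauchy2 (\<nu> n) z w) \<longlonglongrightarrow> 0" using bounded_mult_null[OF B1] h by simp
    hence "cauchy m1 z * cauchy m2 w = 0"
      using LIMSEQ_unique[OF limit_identity[OF zw]] by (simp add: mult.commute)
    thus False using rhs_nonzero[OF zw] by simp
  qed
  have "(\<lambda>n. 1 - cauchy2 (\<nu> n) z w * (1 - C z w n) / cauchy2 (\<nu> n) z w) \<longlonglongrightarrow> 1 - cauchy m1 z * cauchy m2 w / g"
    by (intro tendsto_intros limit_identity[OF zw] h g)
  moreover have "\<forall>\<^sub>F n in sequentially. 1 - cauchy2 (\<nu> n) z w * (1 - C z w n) / cauchy2 (\<nu> n) z w = C z w n"
    using tendsto_imp_eventually_ne[OF h g] by eventually_elim simp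
  ultimately show ?thesis by (rule Lim_transform_eventually)
qed

text \<open>The same argument with the roles exchanged: \<open>cauchy2\<close> is bounded, so
  \<open>1 - c = 0\<close> would again force the product to tend to 0.\<close>

lemma cauchy2_limit:
  assumes zw: "Im z \<noteq> 0" "Im w \<noteq> 0" and c: "C z w \<longlonglongrightarrow> c"
  shows "(\<lambda>n. cauchy2 (\<nu> n) z w) \<longlonglongrightarrow> cauchy m1 z * cauchy m2 w / (1 - c)"
proof -
  have lim: "(\<lambda>n. 1 - C z w n) \<longlonglongrightarrow> 1 - c" by (intro tendsto_intros c)
  have hb: "\<forall>\<^sub>F n in sequentially. norm (cauchy2 (\<nu> n) z w) \<le> 1 / \<bar>Im z\<bar> * (1 / \<bar>Im w\<bar>)"
    by (intro always_eventually allI cauchy2_bound b\<nu> zw)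
  have ne: "1 - c \<noteq> 0"
  proof
    assume "1 - c = 0"
    hence "(\<lambda>n. cauchy2 (\<nu> n) z w * (1 - C z w n)) \<longlonglongrightarrow> 0" using bounded_mult_null[OF hb] lim by simp
    from LIMSEQ_unique[OF limit_identity[OF zw] this] show False using rhs_nonzero[OF zw] by simp
  qed
  have "(\<lambda>n. cauchy2 (\<nu> n) z w * (1 - C z w n) / (1 - C z w n)) \<longlonglongrightarrow> cauchy m1 z * cauchy m2 w / (1 - c)"
    by (intro tendsto_intros limit_identity[OF zw] lim ne)
  moreover have "\<forall>\<^sub>F n in sequentially. cauchy2 (\<nu> n) z w * (1 - C z w n) / (1 - C z w n) = cauchy2 (\<nu> n) z w"
    using tendsto_imp_eventually_ne[OF lim ne] by eventually_elim simp
  ultimately show ?thesis by (rule Lim_transform_eventually)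
qed

end

section \<open>Subsequences and the two implications\<close>

lemma LIMSEQ_subsubseq:
  fixes X :: "nat \<Rightarrow> real"
  assumes sub: "\<And>r :: nat \<Rightarrow> nat. strict_mono r \<Longrightarrow> \<exists>s. strict_mono s \<and> (\<lambda>n. X (r (s n))) \<longlonglongrightarrow> l"
  shows "X \<longlonglongrightarrow> l"
proof (rule ccontr)
  assume "\<not> X \<longlonglongrightarrow> l"
  then obtain e where e: "e > 0" "\<not> (\<forall>\<^sub>F n in sequentially. dist (X n) l < e)"
    unfolding tendsto_iff by blast
  hence "infinite {n. \<not> dist (X n) l < e}"
    unfolding cofinite_eq_sequentially[symmetric] eventually_cofinite by simp
  then obtain r :: "nat \<Rightarrow> nat" where r: "strict_mono r" "\<And>n. \<not> dist (X (r n)) l < e"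
    using infinite_enumerate[of "{n. \<not> dist (X n) l < e}"] by blast
  obtain s where "strict_mono s" "(\<lambda>n. X (r (s n))) \<longlonglongrightarrow> l" using sub[OF r(1)] by blast
  hence "\<forall>\<^sub>F n in sequentially. dist (X (r (s n))) l < e" using e(1) by (auto simp: tendsto_iff)
  thus False using r(2) by (auto simp: eventually_sequentially)
qed

lemma weak_conv_tail:
  fixes Ms :: "nat \<Rightarrow> real measure"
  assumes w: "weak_conv_prob Ms M" and Ms: "\<And>n. borel_prob (Ms n)" and \<epsilon>: "\<epsilon> > 0"
  shows "\<exists>K. \<forall>\<^sub>F n in sequentially. measure (Ms n) {s. \<bar>s\<bar> > K} < \<epsilon>"
proof -
  have M: "borel_prob M" using w by (simp add: weak_conv_prob_def)
  have fin: "finite_measure N" "sets N = sets borel" if "borel_prob N" for N :: "real measure"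
    using borel_prob_finite[OF that] that by (simp_all add: borel_prob_def)
  \<comment> \<open>A continuous cutoff rising from 0 to 1 as \<open>\<bar>s\<bar>\<close> goes from
    \<open>K\<close> to \<open>K + 1\<close>; hence the tail bound is obtained at
    \<open>K + 1\<close>.\<close>
  define \<psi> where "\<psi> K s = max 0 (min 1 (\<bar>s\<bar> - K))" for K s :: real
  have c\<psi>: "continuous_on UNIV (\<psi> K)" for K unfolding \<psi>_def by (intro continuous_intros)
  have \<psi>m: "\<psi> K \<in> borel_measurable borel" for K by (rule borel_measurable_continuous_onI[OF c\<psi>])
  have \<psi>b: "norm (\<psi> K s) \<le> 1" for K s by (auto simp: \<psi>_def)
  have \<psi>i: "integrable N (\<psi> K)" if "borel_prob N" for N K
    by (rule integrable_bounded[OF fin[OF that] \<psi>m \<psi>b])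
  have "(\<lambda>n. \<integral>s. \<psi> (real n) s \<partial>M) \<longlonglongrightarrow> (\<integral>s. 0 \<partial>M)"
  proof (rule integral_dominated_convergence[where w="\<lambda>_. 1"])
    show "integrable M (\<lambda>_. 1 :: real)" using finite_measure.integrable_const[OF fin(1)[OF M]] by blast
    show "AE s in M. (\<lambda>n. \<psi> (real n) s) \<longlonglongrightarrow> 0"
    proof (rule AE_I2)
      fix s
      have "\<forall>\<^sub>F n in sequentially. real n > \<bar>s\<bar>"
        using filterlim_real_sequentially filterlim_at_top_dense by blast
      hence "\<forall>\<^sub>F n in sequentially. \<psi> (real n) s = 0" by eventually_elim (simp add: \<psi>_def)
      thus "(\<lambda>n. \<psi> (real n) s) \<longlonglongrightarrow> 0" by (rule tendsto_eventually)
    qed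
    show "\<psi> (real n) \<in> borel_measurable M" for n by (rule borel_measurable_sets_eq[OF fin(2)[OF M] \<psi>m])
  qed (use \<psi>b in auto)
  hence "\<forall>\<^sub>F n in sequentially. (\<integral>s. \<psi> (real n) s \<partial>M) < \<epsilon>" using \<epsilon> by (intro order_tendstoD(2)) auto
  then obtain K where K: "(\<integral>s. \<psi> (real K) s \<partial>M) < \<epsilon>" by (auto simp: eventually_sequentially)
  have "bounded (range (\<psi> (real K)))" using \<psi>b by (auto simp: bounded_iff)
  from order_tendstoD(2)[OF weak_conv_probD[OF w c\<psi> this] K]
  have "\<forall>\<^sub>F n in sequentially. measure (Ms n) {s. \<bar>s\<bar> > real K + 1} < \<epsilon>"
  proof eventually_elim
    case (elim n)
    interpret finite_measure "Ms n" by (rule fin(1)[OF Ms])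
    have A: "{s. \<bar>s\<bar> > real K + 1} \<in> sets (Ms n)" unfolding fin(2)[OF Ms] by measurable
    have "measure (Ms n) {s. \<bar>s\<bar> > real K + 1} = (\<integral>s. indicator {s. \<bar>s\<bar> > real K + 1} s \<partial>Ms n)" using A by simp
    also have "\<dots> \<le> (\<integral>s. \<psi> (real K) s \<partial>Ms n)"
    proof (rule integral_mono)
      show "integrable (Ms n) (indicator {s. \<bar>s\<bar> > real K + 1} :: real \<Rightarrow> real)"
        using A by (intro integrable_real_indicator) (auto simp: emeasure_eq_measure)
      show "integrable (Ms n) (\<psi> (real K))" by (rule \<psi>i[OF Ms])
    qed (auto simp: \<psi>_def indicator_def)
    finally show ?case using elim by simp
  qed
  thus ?thesis by blast
qed

lemma weak_conv_prob_subseq: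
  assumes "weak_conv_prob Ms M" "strict_mono r"
  shows "weak_conv_prob (\<lambda>n. Ms (r n)) M"
  using assms LIMSEQ_subseq_LIMSEQ[OF _ assms(2)] unfolding weak_conv_prob_def by (fastforce simp: o_def)

lemma wkernel_holomorphic:
  assumes M: "finite_measure M" "sets M = sets borel"
  shows "Im b \<noteq> 0 \<Longrightarrow> (\<lambda>a. \<integral>x. wkernel a b x \<partial>M) holomorphic_on {z. Im z \<noteq> 0}"
    "Im a \<noteq> 0 \<Longrightarrow> (\<lambda>b. \<integral>x. wkernel a b x \<partial>M) holomorphic_on {z. Im z \<noteq> 0}"
proof -
  have mf: "fst \<in> borel_measurable M" "snd \<in> borel_measurable M"
    by (rule borel_measurable_sets_eq[OF M(2)], measurable)+
  show "(\<lambda>a. \<integral>x. wkernel a b x \<partial>M) holomorphic_on {z. Im z \<noteq> 0}" if b: "Im b \<noteq> 0"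
  proof -
    let ?c = "\<lambda>x. complex_of_real (weight (fst x)) * (complex_of_real (weight (snd x)) / (b - complex_of_real (snd x)))"
    have "(\<lambda>a. \<integral>x. ?c x / (a - complex_of_real (fst x)) \<partial>M) holomorphic_on {z. Im z \<noteq> 0}"
    proof (rule kernel_holomorphic[OF M(1) mf(1)])
      show "?c \<in> borel_measurable M" by (rule borel_measurable_sets_eq[OF M(2)]) measurable
      show "norm (?c x) \<le> kernel_bound b * weight (fst x)" for x
        using mult_left_mono[OF weight_kernel_le[OF b, of "snd x"], of "weight (fst x)"] weight_pos[of "fst x"] weight_pos[of "snd x"]
        by (simp add: norm_mult norm_divide mult.commute)
    qed
    moreover have "wkernel a b x = ?c x / (a - complex_of_real (fst x))" for a x by (simp add: wkernel_def)
    ultimately show ?thesis by simp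
  qed
  show "(\<lambda>b. \<integral>x. wkernel a b x \<partial>M) holomorphic_on {z. Im z \<noteq> 0}" if a: "Im a \<noteq> 0"
  proof -
    let ?c = "\<lambda>x. complex_of_real (weight (snd x)) * (complex_of_real (weight (fst x)) / (a - complex_of_real (fst x)))"
    have "(\<lambda>b. \<integral>x. ?c x / (b - complex_of_real (snd x)) \<partial>M) holomorphic_on {z. Im z \<noteq> 0}"
    proof (rule kernel_holomorphic[OF M(1) mf(2)])
      show "?c \<in> borel_measurable M" by (rule borel_measurable_sets_eq[OF M(2)]) measurable
      show "norm (?c x) \<le> kernel_bound a * weight (snd x)" for x
        using mult_left_mono[OF weight_kernel_le[OF a, of "fst x"], of "weight (snd x)"] weight_pos[of "fst x"] weight_pos[of "snd x"]
        by (simp add: norm_mult norm_divide mult.commute)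
    qed
    moreover have "wkernel a b x = ?c x / (b - complex_of_real (snd x))" for b x by (simp add: wkernel_def mult.commute)
    ultimately show ?thesis by simp
  qed
qed

text \<open>Weighted transforms will be known only at poles of the form \<open>F z\<close>; these
  form an open set meeting both half-planes. Openness is the open mapping theorem: \<open>F\<close>
  cannot be a constant \<open>c\<close>, as the imaginary part of its value at a point high enough
  exceeds \<open>\<bar>Im c\<bar>\<close>.\<close>

lemma recip_cauchy_image:
  assumes m: "borel_prob m"
  defines "F \<equiv> \<lambda>z. 1 / cauchy m z"
  shows "open (F ` {z. Im z \<noteq> 0})" "\<exists>z\<in>F ` {z. Im z \<noteq> 0}. Im z > 0" "\<exists>z\<in>F ` {z. Im z \<noteq> 0}. Im z < 0"
proof -
  have hol: "F holomorphic_on {z. Im z \<noteq> 0}"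
    unfolding F_def using cauchy_holomorphic[OF m] cauchy_nonzero[OF m] by (auto intro!: holomorphic_intros)
  have "open (F ` {z. Im z > 0})"
  proof (rule open_mapping_thm[of F "{z. Im z > 0}"])
    show "F holomorphic_on {z. Im z > 0}" by (rule holomorphic_on_subset[OF hol]) auto
    show "connected {z. Im z > 0}" by (intro convex_connected convex_halfspace_Im_gt)
    show "\<not> F constant_on {z. Im z > 0}"
    proof
      assume "F constant_on {z. Im z > 0}"
      then obtain c where c: "\<And>z. Im z > 0 \<Longrightarrow> F z = c" by (auto simp: constant_on_def)
      have "Im (Complex 0 (\<bar>Im c\<bar> + 1)) > 0" by simp
      from Im_recip_cauchy[OF m this] c[OF this] show False by (simp add: F_def)
    qed
  qed (auto intro: open_halfspace_Im_gt)
  moreover have "open (F ` {z. Im z < 0})"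
  proof (rule open_mapping_thm[of F "{z. Im z < 0}"])
    show "F holomorphic_on {z. Im z < 0}" by (rule holomorphic_on_subset[OF hol]) auto
    show "connected {z. Im z < 0}" by (intro convex_connected convex_halfspace_Im_lt)
    show "\<not> F constant_on {z. Im z < 0}"
    proof
      assume "F constant_on {z. Im z < 0}"
      then obtain c where c: "\<And>z. Im z < 0 \<Longrightarrow> F z = c" by (auto simp: constant_on_def)
      have "Im (Complex 0 (- \<bar>Im c\<bar> - 1)) < 0" by simp
      from Im_recip_cauchy_neg[OF m this] c[OF this] show False by (simp add: F_def)
    qed
  qed (auto intro: open_halfspace_Im_lt)
  moreover have "{z. Im z \<noteq> 0} = {z. Im z > 0} \<union> {z. Im z < 0}" by auto
  ultimately show "open (F ` {z. Im z \<noteq> 0})" by (simp only: image_Un open_Un)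
  have "Im (F \<i>) \<ge> Im \<i>" "Im (F (- \<i>)) \<le> Im (- \<i>)"
    unfolding F_def by (rule Im_recip_cauchy[OF m], simp, rule Im_recip_cauchy_neg[OF m], simp)
  hence "Im (F \<i>) > 0" "Im (F (- \<i>)) < 0" by auto
  moreover have "F \<i> \<in> F ` {z. Im z \<noteq> 0}" "F (- \<i>) \<in> F ` {z. Im z \<noteq> 0}" by simp_all
  ultimately show "\<exists>z\<in>F ` {z. Im z \<noteq> 0}. Im z > 0" "\<exists>z\<in>F ` {z. Im z \<noteq> 0}. Im z < 0"
    by blast+
qed

context bifree_array
begin

definition Pos :: "nat \<Rightarrow> (real \<times> real) measure" where "Pos n = pos_variation (rho_measure (k n) (\<mu> n))"
definition Neg :: "nat \<Rightarrow> (real \<times> real) measure" where "Neg n = neg_variation (rho_measure (k n) (\<mu> n))"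

lemma Pos_Neg_density:
  "Pos n = density (\<mu> n) (\<lambda>x. ennreal (rho_density (k n) x))"
  "Neg n = density (\<mu> n) (\<lambda>x. ennreal (- rho_density (k n) x))"
proof -
  show "Pos n = density (\<mu> n) (\<lambda>x. ennreal (rho_density (k n) x))"
    unfolding Pos_def by (rule pos_variation_density[OF sets\<mu> rho_integrable rho_measure_eq])
  show "Neg n = density (\<mu> n) (\<lambda>x. ennreal (- rho_density (k n) x))"
    unfolding Neg_def neg_variation_def
    by (rule pos_variation_density[OF sets\<mu>])
       (use rho_integrable in \<open>simp_all add: rho_measure_eq set_lebesgue_integral_def\<close>)
qed

lemma Pos_Neg:
  "finite_measure (Pos n)" "finite_measure (Neg n)" "sets (Pos n) = sets borel" "sets (Neg n) = sets borel"
  "A \<in> sets borel \<Longrightarrow> measure (Pos n) A \<le> (\<integral>x. \<bar>rho_density (k n) x\<bar> * indicator A x \<partial>\<mu> n)"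
  "A \<in> sets borel \<Longrightarrow> measure (Neg n) A \<le> (\<integral>x. \<bar>rho_density (k n) x\<bar> * indicator A x \<partial>\<mu> n)"
proof -
  have i: "integrable (\<mu> n) (\<lambda>x. - rho_density (k n) x)" using rho_integrable by simp
  show "finite_measure (Pos n)" "finite_measure (Neg n)" "sets (Pos n) = sets borel" "sets (Neg n) = sets borel"
    unfolding Pos_Neg_density
    using density_measure_le(1)[OF rho_integrable sets.empty_sets] density_measure_le(1)[OF i sets.empty_sets] sets\<mu>
    by simp_all
  assume "A \<in> sets borel"
  hence A: "A \<in> sets (\<mu> n)" using sets\<mu> by simp
  show "measure (Pos n) A \<le> (\<integral>x. \<bar>rho_density (k n) x\<bar> * indicator A x \<partial>\<mu> n)"
    "measure (Neg n) A \<le> (\<integral>x. \<bar>rho_density (k n) x\<bar> * indicator A x \<partial>\<mu> n)"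
    unfolding Pos_Neg_density
    using density_measure_le(2)[OF rho_integrable A] density_measure_le(2)[OF i A] by simp_all
qed

lemma Pos_Neg_bounded:
  "\<exists>B. \<forall>\<^sub>F n in sequentially. measure (Pos n) UNIV \<le> B" "\<exists>B. \<forall>\<^sub>F n in sequentially. measure (Neg n) UNIV \<le> B"
proof -
  obtain B where B: "\<forall>\<^sub>F n in sequentially. total n \<le> B" using total_bounded by blast
  have "\<forall>\<^sub>F n in sequentially. measure (Pos n) UNIV \<le> B"
    using B by eventually_elim (use Pos_Neg(5)[of UNIV] in \<open>auto simp: total_def intro: order_trans\<close>)
  thus "\<exists>B. \<forall>\<^sub>F n in sequentially. measure (Pos n) UNIV \<le> B" by blast
  have "\<forall>\<^sub>F n in sequentially. measure (Neg n) UNIV \<le> B"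
    using B by eventually_elim (use Pos_Neg(6)[of UNIV] in \<open>auto simp: total_def intro: order_trans\<close>)
  thus "\<exists>B. \<forall>\<^sub>F n in sequentially. measure (Neg n) UNIV \<le> B" by blast
qed

lemma Pos_Neg_tight: "tight2 Pos" "tight2 Neg"
proof -
  have *: "tight2 Q" if "\<And>n A. A \<in> sets borel \<Longrightarrow> measure (Q n) A \<le> (\<integral>x. \<bar>rho_density (k n) x\<bar> * indicator A x \<partial>\<mu> n)" for Q
    unfolding tight2_def
  proof (intro allI impI)
    fix \<epsilon> :: real assume "\<epsilon> > 0"
    from total_tail[OF this] obtain K where
      "\<forall>\<^sub>F n in sequentially. (\<integral>x. \<bar>rho_density (k n) x\<bar> * indicator (outside K) x \<partial>\<mu> n) < \<epsilon>" by blast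
    hence "\<forall>\<^sub>F n in sequentially. measure (Q n) (outside K) < \<epsilon>"
      by eventually_elim (rule le_less_trans[OF that[OF outside_borel]])
    thus "\<exists>K. \<forall>\<^sub>F n in sequentially. measure (Q n) (outside K) < \<epsilon>" by blast
  qed
  show "tight2 Pos" "tight2 Neg" using *[of Pos, OF Pos_Neg(5)] *[of Neg, OF Pos_Neg(6)] by blast+
qed

lemma C_eq: "C z w n = wtransform (Pos n) (F1 z) (F2 w) - wtransform (Neg n) (F1 z) (F2 w)"
  unfolding C_def cauchy2_weighted_eq signed_integral_def Pos_def Neg_def ..

lemma subseq_array:
  assumes "strict_mono r"
  shows "bifree_array (\<lambda>n. \<mu> (r n)) (\<lambda>n. \<nu> (r n)) (\<lambda>n. k (r n)) (\<lambda>n. \<alpha> (r n)) (\<lambda>n. \<beta> (r n)) m1 m2"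
  unfolding bifree_array_def
  using bp filterlim_compose[OF k_lim filterlim_subseq[OF assms]]
    weak_conv_prob_subseq[OF conv1 assms] weak_conv_prob_subseq[OF conv2 assms] by blast

text \<open>Two successive extractions, one for each Jordan part. Mass may cancel in the limit, so
  \<open>P\<close> and \<open>N\<close> are in general not the Jordan parts of the limiting signed
  measure.\<close>

lemma signed_subsequence:
  obtains s P N where "strict_mono s" "finite_measure P" "sets P = sets borel" "finite_measure N" "sets N = sets borel"
    "\<And>f :: real \<times> real \<Rightarrow> real. continuous_on UNIV f \<Longrightarrow> bounded (range f) \<Longrightarrow> (\<lambda>n. \<integral>x. f x \<partial>Pos (s n)) \<longlonglongrightarrow> (\<integral>x. f x \<partial>P)"
    "\<And>f :: real \<times> real \<Rightarrow> real. continuous_on UNIV f \<Longrightarrow> bounded (range f) \<Longrightarrow> (\<lambda>n. \<integral>x. f x \<partial>Neg (s n)) \<longlonglongrightarrow> (\<integral>x. f x \<partial>N)"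
proof -
  obtain B where B: "\<forall>\<^sub>F n in sequentially. measure (Pos n) UNIV \<le> B" using Pos_Neg_bounded(1) by blast
  obtain B' where B': "\<forall>\<^sub>F n in sequentially. measure (Neg n) UNIV \<le> B'" using Pos_Neg_bounded(2) by blast
  obtain s1 P where P: "strict_mono s1" "finite_measure P" "sets P = sets borel"
    "\<And>f :: real \<times> real \<Rightarrow> real. continuous_on UNIV f \<and> bounded (range f) \<longrightarrow> (\<lambda>n. \<integral>x. f x \<partial>Pos (s1 n)) \<longlonglongrightarrow> (\<integral>x. f x \<partial>P)"
    using prokhorov_finite[OF Pos_Neg(1,3) B Pos_Neg_tight(1)] by blast
  have "tight2 (\<lambda>n. Neg (s1 n))"
    using Pos_Neg_tight(2) eventually_subseq[OF P(1)] unfolding tight2_def by blast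
  from prokhorov_finite[of "\<lambda>n. Neg (s1 n)", OF Pos_Neg(2,4) eventually_subseq[OF P(1) B'] this]
  obtain s2 N where N: "strict_mono s2" "finite_measure N" "sets N = sets borel"
    "\<And>f :: real \<times> real \<Rightarrow> real. continuous_on UNIV f \<and> bounded (range f) \<longrightarrow> (\<lambda>n. \<integral>x. f x \<partial>Neg (s1 (s2 n))) \<longlonglongrightarrow> (\<integral>x. f x \<partial>N)"
    by blast
  show ?thesis
  proof (rule that[of "\<lambda>n. s1 (s2 n)" P N])
    show "strict_mono (\<lambda>n. s1 (s2 n))" using strict_mono_o[OF P(1) N(1)] by (simp add: o_def)
    show "(\<lambda>n. \<integral>x. f x \<partial>Pos (s1 (s2 n))) \<longlonglongrightarrow> (\<integral>x. f x \<partial>P)" if "continuous_on UNIV f" "bounded (range f)" for f :: "real \<times> real \<Rightarrow> real"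
      using LIMSEQ_subseq_LIMSEQ[OF _ N(1)] P(4)[of f] that by (fastforce simp: o_def)
    show "(\<lambda>n. \<integral>x. f x \<partial>Neg (s1 (s2 n))) \<longlonglongrightarrow> (\<integral>x. f x \<partial>N)" if "continuous_on UNIV f" "bounded (range f)" for f :: "real \<times> real \<Rightarrow> real"
      using N(4)[of f] that by blast
  qed (use P N in auto)
qed

lemma C_subsequence_limit:
  assumes s: "strict_mono s" and P: "finite_measure P" "sets P = sets borel" and N: "finite_measure N" "sets N = sets borel"
    and lim: "\<And>f :: real \<times> real \<Rightarrow> real. continuous_on UNIV f \<Longrightarrow> bounded (range f) \<Longrightarrow> (\<lambda>n. \<integral>x. f x \<partial>Pos (s n)) \<longlonglongrightarrow> (\<integral>x. f x \<partial>P)"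
    "\<And>f :: real \<times> real \<Rightarrow> real. continuous_on UNIV f \<Longrightarrow> bounded (range f) \<Longrightarrow> (\<lambda>n. \<integral>x. f x \<partial>Neg (s n)) \<longlonglongrightarrow> (\<integral>x. f x \<partial>N)"
    and zw: "Im z \<noteq> 0" "Im w \<noteq> 0" and g: "C z w \<longlonglongrightarrow> c"
  shows "wtransform P (F1 z) (F2 w) - wtransform N (F1 z) (F2 w) = c"
proof -
  note ab = recip_nonreal(1)[OF zw(1)] recip_nonreal(2)[OF zw(2)]
  have "(\<lambda>n. C z w (s n)) \<longlonglongrightarrow> wtransform P (F1 z) (F2 w) - wtransform N (F1 z) (F2 w)"
    unfolding C_eq
    by (intro tendsto_diff weak_conv_complex[OF Pos_Neg(1,3) P lim(1) continuous_wkernel[OF ab] wkernel_le[OF ab]]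
        weak_conv_complex[OF Pos_Neg(2,4) N lim(2) continuous_wkernel[OF ab] wkernel_le[OF ab]])
  moreover have "(\<lambda>n. C z w (s n)) \<longlonglongrightarrow> c" using LIMSEQ_subseq_LIMSEQ[OF g s] by (simp add: o_def)
  ultimately show ?thesis by (rule LIMSEQ_unique)
qed

text \<open>Equality at the poles \<open>F1 z\<close>, \<open>F2 w\<close> spreads to all nonreal
  poles by continuation, in the first variable with the second still a value of \<open>F2\<close>,
  then in the second.\<close>

lemma wkernel_determined:
  assumes P: "finite_measure P" "sets P = sets borel" and N: "finite_measure N" "sets N = sets borel"
    and P': "finite_measure P'" "sets P' = sets borel" and N': "finite_measure N'" "sets N' = sets borel"
    and eq: "\<And>z w. Im z \<noteq> 0 \<Longrightarrow> Im w \<noteq> 0 \<Longrightarrow>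
      wtransform P (F1 z) (F2 w) - wtransform N (F1 z) (F2 w) =
      wtransform P' (F1 z) (F2 w) - wtransform N' (F1 z) (F2 w)"
    and ab: "Im a \<noteq> 0" "Im b \<noteq> 0"
  shows "wtransform P a b - wtransform N a b = wtransform P' a b - wtransform N' a b"
proof -
  note hol = wkernel_holomorphic[OF P] wkernel_holomorphic[OF N] wkernel_holomorphic[OF P'] wkernel_holomorphic[OF N']
  have step: "wtransform P a b - wtransform N a b = wtransform P' a b - wtransform N' a b"
    if a: "Im a \<noteq> 0" and b: "b \<in> (\<lambda>w. 1 / cauchy m2 w) ` {w. Im w \<noteq> 0}" for a b
  proof -
    have ib: "Im b \<noteq> 0" using b recip_nonreal(2) by auto
    show ?thesis
    proof (rule continuation_halfplanes[OF _ _ recip_cauchy_image[OF L1.M0] _ a])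
      show "(\<lambda>a. wtransform P a b - wtransform N a b) holomorphic_on {z. Im z \<noteq> 0}"
        "(\<lambda>a. wtransform P' a b - wtransform N' a b) holomorphic_on {z. Im z \<noteq> 0}"
        by (intro holomorphic_on_diff hol ib)+
    qed (use b eq in auto)
  qed
  show ?thesis
  proof (rule continuation_halfplanes[OF _ _ recip_cauchy_image[OF L2.M0] _ ab(2)])
    show "(\<lambda>b. wtransform P a b - wtransform N a b) holomorphic_on {z. Im z \<noteq> 0}"
      "(\<lambda>b. wtransform P' a b - wtransform N' a b) holomorphic_on {z. Im z \<noteq> 0}"
      by (intro holomorphic_on_diff hol ab)+
  qed (use step ab in auto)
qed

text \<open>Convergence of the laws fixes the limit of \<open>C\<close>. Every subsequence has a
  further one along which the Jordan parts converge, and the difference of their limits has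
  transforms prescribed by that limit; so all these differences integrate each test function
  alike.\<close>

lemma rho_converges:
  assumes conv: "weak_conv_prob \<nu> \<nu>0"
  shows "\<exists>\<rho>. weak_conv_signed (\<lambda>n. rho_measure (k n) (\<mu> n)) \<rho>"
proof -
  define c where "c z w = 1 - cauchy m1 z * cauchy m2 w / cauchy2 \<nu>0 z w" for z w
  have C: "C z w \<longlonglongrightarrow> c z w" if "Im z \<noteq> 0" "Im w \<noteq> 0" for z w
    unfolding c_def by (rule C_limit[OF that weak_conv_cauchy2[OF conv b\<nu> that]])
  obtain s P N where PN: "strict_mono s" "finite_measure P" "sets P = sets borel" "finite_measure N" "sets N = sets borel"
    "\<And>f :: real \<times> real \<Rightarrow> real. continuous_on UNIV f \<Longrightarrow> bounded (range f) \<Longrightarrow> (\<lambda>n. \<integral>x. f x \<partial>Pos (s n)) \<longlonglongrightarrow> (\<integral>x. f x \<partial>P)"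
    "\<And>f :: real \<times> real \<Rightarrow> real. continuous_on UNIV f \<Longrightarrow> bounded (range f) \<Longrightarrow> (\<lambda>n. \<integral>x. f x \<partial>Neg (s n)) \<longlonglongrightarrow> (\<integral>x. f x \<partial>N)"
    using signed_subsequence by metis
  note wPN = C_subsequence_limit[OF PN _ _ C]
  obtain \<rho> where \<rho>: "finite_signed_measure \<rho>"
    "\<And>(f :: real \<times> real \<Rightarrow> real) B. f \<in> borel_measurable borel \<Longrightarrow> (\<And>x. norm (f x) \<le> B) \<Longrightarrow>
       signed_integral \<rho> f = (\<integral>x. f x \<partial>P) - (\<integral>x. f x \<partial>N)"
    using difference_signed_measure[OF PN(2-5)] by metis
  have "(\<lambda>n. signed_integral (rho_measure (k n) (\<mu> n)) f) \<longlonglongrightarrow> signed_integral \<rho> f"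
    if f: "continuous_on UNIV f" "bounded (range f)" for f :: "real \<times> real \<Rightarrow> real"
  proof (rule LIMSEQ_subsubseq)
    fix r :: "nat \<Rightarrow> nat" assume r: "strict_mono r"
    \<comment> \<open>A subsequence is again such an array with the same limiting marginals, so
      compactness is available along it as well.\<close>
    interpret S: bifree_array "\<lambda>n. \<mu> (r n)" "\<lambda>n. \<nu> (r n)" "\<lambda>n. k (r n)" "\<lambda>n. \<alpha> (r n)" "\<lambda>n. \<beta> (r n)" m1 m2
      by (rule subseq_array[OF r])
    obtain B where B: "\<And>x. norm (f x) \<le> B" using f(2) by (auto simp: bounded_iff)
    have fm: "f \<in> borel_measurable borel" by (rule borel_measurable_continuous_onI[OF f(1)])
    obtain s' P' N' where PN': "strict_mono s'" "finite_measure P'" "sets P' = sets borel" "finite_measure N'" "sets N' = sets borel"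
      "\<And>f :: real \<times> real \<Rightarrow> real. continuous_on UNIV f \<Longrightarrow> bounded (range f) \<Longrightarrow> (\<lambda>n. \<integral>x. f x \<partial>S.Pos (s' n)) \<longlonglongrightarrow> (\<integral>x. f x \<partial>P')"
      "\<And>f :: real \<times> real \<Rightarrow> real. continuous_on UNIV f \<Longrightarrow> bounded (range f) \<Longrightarrow> (\<lambda>n. \<integral>x. f x \<partial>S.Neg (s' n)) \<longlonglongrightarrow> (\<integral>x. f x \<partial>N')"
      using S.signed_subsequence by metis
    have SC: "S.C z w \<longlonglongrightarrow> c z w" if "Im z \<noteq> 0" "Im w \<noteq> 0" for z w
      using LIMSEQ_subseq_LIMSEQ[OF C[OF that] r] by (simp add: o_def C_def S.C_def[abs_def])
    note wPN' = S.C_subsequence_limit[OF PN' _ _ SC]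
    have eq: "(\<integral>x. f x \<partial>P') - (\<integral>x. f x \<partial>N') = (\<integral>x. f x \<partial>P) - (\<integral>x. f x \<partial>N)"
    proof (rule signed_determined_by_wkernel[OF PN'(2-5) PN(2-5) _ fm B])
      fix a b assume ab: "Im a \<noteq> 0" "Im b \<noteq> 0"
      show "wtransform P' a b - wtransform N' a b = wtransform P a b - wtransform N a b"
        by (rule wkernel_determined[OF PN'(2-5) PN(2-5) _ ab]) (simp add: wPN wPN')
    qed
    have "(\<lambda>n. (\<integral>x. f x \<partial>S.Pos (s' n)) - (\<integral>x. f x \<partial>S.Neg (s' n))) \<longlonglongrightarrow> (\<integral>x. f x \<partial>P') - (\<integral>x. f x \<partial>N')"
      by (intro tendsto_diff PN' f)
    hence "(\<lambda>n. signed_integral (rho_measure (k (r (s' n))) (\<mu> (r (s' n)))) f) \<longlonglongrightarrow> signed_integral \<rho> f"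
      unfolding eq \<rho>(2)[OF fm B, symmetric] by (simp add: signed_integral_def S.Pos_def S.Neg_def)
    thus "\<exists>s. strict_mono s \<and> (\<lambda>n. signed_integral (rho_measure (k (r (s n))) (\<mu> (r (s n)))) f) \<longlonglongrightarrow> signed_integral \<rho> f"
      using PN'(1) by blast
  qed
  thus ?thesis using \<rho>(1) unfolding weak_conv_signed_def by blast
qed

lemma C_weak_limit:
  assumes \<rho>: "weak_conv_signed (\<lambda>n. rho_measure (k n) (\<mu> n)) \<rho>" and zw: "Im z \<noteq> 0" "Im w \<noteq> 0"
  shows "C z w \<longlonglongrightarrow> cauchy2_weighted \<rho> (F1 z) (F2 w)"
proof -
  let ?f = "wkernel (F1 z) (F2 w)"
  note ab = recip_nonreal(1)[OF zw(1)] recip_nonreal(2)[OF zw(2)]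
  have fs: "finite_signed_measure \<rho>" using \<rho> by (simp add: weak_conv_signed_def)
  have fsn: "finite_signed_measure (rho_measure (k n) (\<mu> n))" for n
    by (rule finite_signed_measure_density[OF sets\<mu> rho_integrable rho_measure_eq])
  have lim: "(\<lambda>n. signed_integral (rho_measure (k n) (\<mu> n)) f) \<longlonglongrightarrow> signed_integral \<rho> f"
    if "continuous_on UNIV f" "bounded (range f)" for f :: "real \<times> real \<Rightarrow> real"
    using \<rho> that by (simp add: weak_conv_signed_def)
  have bd: "bounded (range (\<lambda>x. Re (?f x)))" "bounded (range (\<lambda>x. Im (?f x)))"
    using order_trans[OF abs_Re_le_cmod wkernel_le[OF ab]] order_trans[OF abs_Im_le_cmod wkernel_le[OF ab]]
    unfolding bounded_iff real_norm_def by blast+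
  note ct = continuous_on_Re[OF continuous_wkernel[OF ab]] continuous_on_Im[OF continuous_wkernel[OF ab]]
  note RI = signed_integral_Re_Im[OF _ wkernel_measurable wkernel_le[OF ab]]
  have "(\<lambda>n. signed_integral (rho_measure (k n) (\<mu> n)) ?f) \<longlonglongrightarrow> signed_integral \<rho> ?f"
    unfolding tendsto_complex_iff RI[OF fs] RI[OF fsn] using lim[OF ct(1) bd(1)] lim[OF ct(2) bd(2)] by simp
  thus ?thesis unfolding C_def[abs_def] cauchy2_weighted_eq .
qed

text \<open>The mass outside a square is at most the sum of two marginal tails, which are small by
  convergence of the marginals.\<close>

lemma nu_tight: "tight2 \<nu>"
  unfolding tight2_def
proof (intro allI impI)
  fix \<epsilon> :: real assume "\<epsilon> > 0"
  hence e: "\<epsilon> / 2 > 0" by simp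
  obtain K1 where K1: "\<forall>\<^sub>F n in sequentially. measure (marginal1 (\<nu> n)) {s. \<bar>s\<bar> > K1} < \<epsilon> / 2"
    using weak_conv_tail[OF conv1 L1.M e] by blast
  obtain K2 where K2: "\<forall>\<^sub>F n in sequentially. measure (marginal2 (\<nu> n)) {s. \<bar>s\<bar> > K2} < \<epsilon> / 2"
    using weak_conv_tail[OF conv2 L2.M e] by blast
  define K where "K = max K1 K2"
  have "\<forall>\<^sub>F n in sequentially. measure (\<nu> n) (outside K) < \<epsilon>"
    using K1 K2
  proof eventually_elim
    case (elim n)
    interpret finite_measure "\<nu> n" by (rule borel_prob_finite[OF b\<nu>])
    have sn: "sets (\<nu> n) = sets borel" using b\<nu>[of n] by (simp add: borel_prob_def)
    let ?A1 = "{x :: real \<times> real. \<bar>fst x\<bar> > K1}" and ?A2 = "{x :: real \<times> real. \<bar>snd x\<bar> > K2}"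
    have A: "?A1 \<in> sets (\<nu> n)" "?A2 \<in> sets (\<nu> n)" unfolding sn by measurable
    have "measure (\<nu> n) (outside K) \<le> measure (\<nu> n) (?A1 \<union> ?A2)"
      using A by (intro finite_measure_mono) (auto simp: K_def outside_def)
    also have "\<dots> \<le> measure (\<nu> n) ?A1 + measure (\<nu> n) ?A2" by (rule measure_Un_le[OF A])
    also have "\<dots> < \<epsilon>" using elim unfolding measure_marginal[OF b\<nu>] by linarith
    finally show ?case .
  qed
  thus "\<exists>K. \<forall>\<^sub>F n in sequentially. measure (\<nu> n) (outside K) < \<epsilon>" by blast
qed

text \<open>The laws are tight, and \<open>cauchy2\<close> of every limit point is the function
  \<open>g\<close> dictated by the marginals and \<open>\<rho>\<close>. By injectivity of
  \<open>cauchy2\<close> there is only one limit point.\<close>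

lemma nu_converges:
  assumes \<rho>: "weak_conv_signed (\<lambda>n. rho_measure (k n) (\<mu> n)) \<rho>"
  shows "\<exists>\<nu>0. weak_conv_prob \<nu> \<nu>0"
proof -
  define g where "g z w = cauchy m1 z * cauchy m2 w / (1 - cauchy2_weighted \<rho> (F1 z) (F2 w))" for z w
  have g: "(\<lambda>n. cauchy2 (\<nu> n) z w) \<longlonglongrightarrow> g z w" if "Im z \<noteq> 0" "Im w \<noteq> 0" for z w
    unfolding g_def by (rule cauchy2_limit[OF that C_weak_limit[OF \<rho> that]])
  have sub: "\<exists>s M. strict_mono s \<and> weak_conv_prob (\<lambda>n. \<nu> (r (s n))) M \<and> (\<forall>z w. Im z \<noteq> 0 \<longrightarrow> Im w \<noteq> 0 \<longrightarrow> cauchy2 M z w = g z w)"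
    if r: "strict_mono r" for r :: "nat \<Rightarrow> nat"
  proof -
    have "tight2 (\<lambda>n. \<nu> (r n))" using nu_tight eventually_subseq[OF r] unfolding tight2_def by blast
    from prokhorov_prob[of "\<lambda>n. \<nu> (r n)", OF b\<nu> this]
    obtain s M where s: "strict_mono s" "weak_conv_prob (\<lambda>n. \<nu> (r (s n))) M" by blast
    have "cauchy2 M z w = g z w" if zw: "Im z \<noteq> 0" "Im w \<noteq> 0" for z w
    proof (rule LIMSEQ_unique[OF weak_conv_cauchy2[OF s(2) b\<nu> zw]])
      show "(\<lambda>n. cauchy2 (\<nu> (r (s n))) z w) \<longlonglongrightarrow> g z w"
        using LIMSEQ_subseq_LIMSEQ[OF g[OF zw] strict_mono_o[OF r s(1)]] by (simp add: o_def)
    qed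
    thus ?thesis using s by blast
  qed
  obtain s0 M where M: "weak_conv_prob (\<lambda>n. \<nu> (s0 n)) M" "\<And>z w. Im z \<noteq> 0 \<Longrightarrow> Im w \<noteq> 0 \<Longrightarrow> cauchy2 M z w = g z w"
    using sub[OF strict_mono_id] unfolding id_apply by blast
  have bM: "borel_prob M" using M(1) by (simp add: weak_conv_prob_def)
  have "(\<lambda>n. \<integral>x. f x \<partial>\<nu> n) \<longlonglongrightarrow> (\<integral>x. f x \<partial>M)" if f: "continuous_on UNIV f" "bounded (range f)" for f :: "real \<times> real \<Rightarrow> real"
  proof (rule LIMSEQ_subsubseq)
    fix r :: "nat \<Rightarrow> nat" assume "strict_mono r"
    from sub[OF this] obtain s M' where s: "strict_mono s" "weak_conv_prob (\<lambda>n. \<nu> (r (s n))) M'"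
      "\<And>z w. Im z \<noteq> 0 \<Longrightarrow> Im w \<noteq> 0 \<Longrightarrow> cauchy2 M' z w = g z w" by blast
    have bM': "borel_prob M'" using s(2) by (simp add: weak_conv_prob_def)
    have "M' = M"
      by (rule measure_eqI_cauchy2) (use borel_prob_finite[OF bM] borel_prob_finite[OF bM'] bM bM' M(2) s(3) in \<open>auto simp: borel_prob_def\<close>)
    thus "\<exists>s. strict_mono s \<and> (\<lambda>n. \<integral>x. f x \<partial>\<nu> (r (s n))) \<longlonglongrightarrow> (\<integral>x. f x \<partial>M)"
      using s(1) weak_conv_probD[OF s(2) f] by blast
  qed
  thus ?thesis using bM unfolding weak_conv_prob_def by blast
qed

lemma limit_formula:
  assumes \<nu>0: "weak_conv_prob \<nu> \<nu>0" and \<rho>: "weak_conv_signed (\<lambda>n. rho_measure (k n) (\<mu> n)) \<rho>"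
    and zw: "Im z \<noteq> 0" "Im w \<noteq> 0"
  shows "cauchy2 \<nu>0 z w * (1 - cauchy2_weighted \<rho> (F1 z) (F2 w)) = cauchy m1 z * cauchy m2 w"
proof (rule LIMSEQ_unique[OF _ limit_identity[OF zw]])
  show "(\<lambda>n. cauchy2 (\<nu> n) z w * (1 - C z w n)) \<longlonglongrightarrow>
      cauchy2 \<nu>0 z w * (1 - cauchy2_weighted \<rho> (F1 z) (F2 w))"
    by (intro tendsto_intros weak_conv_cauchy2[OF \<nu>0 b\<nu> zw] C_weak_limit[OF \<rho> zw])
qed

end

theorem corollary3p3:
  fixes \<mu> \<nu>s :: "nat \<Rightarrow> (real \<times> real) measure"
    and k :: "nat \<Rightarrow> nat"
  assumes "\<And>n. borel_prob (\<mu> n)"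
    and "\<And>n. k n > 0"
    and "filterlim k at_top sequentially"
    and "\<And>n. borel_prob (\<nu>s n)"
    and "\<And>n. \<exists>\<alpha> \<beta>. bifree_R_defined (\<mu> n) \<alpha> \<beta> \<and> bifree_R_defined (\<nu>s n) \<alpha> \<beta> \<and>
           (\<forall>z\<in>stolz_pair \<alpha> \<beta>. \<forall>w\<in>stolz_pair \<alpha> \<beta>.
              of_nat (k n) * bifree_R (\<mu> n) z w = bifree_R (\<nu>s n) z w)"
  shows
    "((\<exists>\<nu>. weak_conv_prob \<nu>s \<nu>) \<longleftrightarrow>
        (\<exists>m. weak_conv_prob (\<lambda>n. free_conv_power (marginal1 (\<mu> n)) (k n)) m) \<and>
        (\<exists>m. weak_conv_prob (\<lambda>n. free_conv_power (marginal2 (\<mu> n)) (k n)) m) \<and>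
        (\<exists>\<rho>. weak_conv_signed (\<lambda>n. rho_measure (k n) (\<mu> n)) \<rho>))
     \<and>
     (\<forall>\<nu> \<gamma>1 \<gamma>2 \<sigma>1 \<sigma>2 \<rho>.
        finite_measure \<sigma>1 \<and> sets \<sigma>1 = sets borel \<and>
        finite_measure \<sigma>2 \<and> sets \<sigma>2 = sets borel \<and>
        weak_conv_prob \<nu>s \<nu> \<and>
        weak_conv_prob (\<lambda>n. free_conv_power (marginal1 (\<mu> n)) (k n)) (nu_boxplus \<gamma>1 \<sigma>1) \<and>
        weak_conv_prob (\<lambda>n. free_conv_power (marginal2 (\<mu> n)) (k n)) (nu_boxplus \<gamma>2 \<sigma>2) \<and>
        weak_conv_signed (\<lambda>n. rho_measure (k n) (\<mu> n)) \<rho> \<longrightarrow>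
        marginal1 \<nu> = nu_boxplus \<gamma>1 \<sigma>1 \<and>
        marginal2 \<nu> = nu_boxplus \<gamma>2 \<sigma>2 \<and>
        (\<forall>z w. z \<notin> \<real> \<and> w \<notin> \<real> \<longrightarrow>
           cauchy2 \<nu> z w *
             (1 - cauchy2_weighted \<rho> (1 / cauchy (marginal1 \<nu>) z) (1 / cauchy (marginal2 \<nu>) w))
           = cauchy (marginal1 \<nu>) z * cauchy (marginal2 \<nu>) w))"
proof -
  obtain \<alpha> \<beta> where "\<forall>n. bifree_R_defined (\<mu> n) (\<alpha> n) (\<beta> n) \<and> bifree_R_defined (\<nu>s n) (\<alpha> n) (\<beta> n) \<and>
           (\<forall>z\<in>stolz_pair (\<alpha> n) (\<beta> n). \<forall>w\<in>stolz_pair (\<alpha> n) (\<beta> n).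
              of_nat (k n) * bifree_R (\<mu> n) z w = bifree_R (\<nu>s n) z w)"
    using assms(5) by metis
  hence bp: "bifree_power (\<mu> n) (\<nu>s n) (k n) (\<alpha> n) (\<beta> n)" for n
    by unfold_locales (use assms in auto)
  have fc: "free_conv_power (marginal1 (\<mu> n)) (k n) = marginal1 (\<nu>s n)"
    "free_conv_power (marginal2 (\<mu> n)) (k n) = marginal2 (\<nu>s n)" for n
    using bifree_power.free_conv_power_marginal[OF bp] by auto
  have array: "bifree_array \<mu> \<nu>s k \<alpha> \<beta> m1 m2"
    if "weak_conv_prob (\<lambda>n. marginal1 (\<nu>s n)) m1" "weak_conv_prob (\<lambda>n. marginal2 (\<nu>s n)) m2" for m1 m2
    using that bp assms(3) by (simp add: bifree_array_def)
  note marginals = weak_conv_marginal[OF _ assms(4)]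
  \<comment> \<open>In the forward direction the marginals of the limit supply the
    \<open>bifree_array\<close> in which the signed measures are then shown to converge; backwards
    the convergence of the marginals is given.\<close>
  have "(\<exists>\<nu>. weak_conv_prob \<nu>s \<nu>) \<longleftrightarrow>
        (\<exists>m. weak_conv_prob (\<lambda>n. marginal1 (\<nu>s n)) m) \<and> (\<exists>m. weak_conv_prob (\<lambda>n. marginal2 (\<nu>s n)) m) \<and>
        (\<exists>\<rho>. weak_conv_signed (\<lambda>n. rho_measure (k n) (\<mu> n)) \<rho>)"
    using marginals bifree_array.rho_converges[OF array] bifree_array.nu_converges[OF array] by meson
  moreover have "marginal1 \<nu> = nu_boxplus \<gamma>1 \<sigma>1 \<and> marginal2 \<nu> = nu_boxplus \<gamma>2 \<sigma>2 \<and>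
        (\<forall>z w. z \<notin> \<real> \<and> w \<notin> \<real> \<longrightarrow>
           cauchy2 \<nu> z w *
             (1 - cauchy2_weighted \<rho> (1 / cauchy (marginal1 \<nu>) z) (1 / cauchy (marginal2 \<nu>) w))
           = cauchy (marginal1 \<nu>) z * cauchy (marginal2 \<nu>) w)"
    if \<nu>: "weak_conv_prob \<nu>s \<nu>" and m: "weak_conv_prob (\<lambda>n. marginal1 (\<nu>s n)) (nu_boxplus \<gamma>1 \<sigma>1)"
      "weak_conv_prob (\<lambda>n. marginal2 (\<nu>s n)) (nu_boxplus \<gamma>2 \<sigma>2)"
      and \<rho>: "weak_conv_signed (\<lambda>n. rho_measure (k n) (\<mu> n)) \<rho>" for \<nu> \<gamma>1 \<gamma>2 \<sigma>1 \<sigma>2 \<rho>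
  proof (intro conjI allI impI)
    show "marginal1 \<nu> = nu_boxplus \<gamma>1 \<sigma>1"
      by (rule weak_conv_prob_unique[OF marginals(1)[OF \<nu>] m(1)]) (rule borel_prob_marginal(1)[OF assms(4)])
    show "marginal2 \<nu> = nu_boxplus \<gamma>2 \<sigma>2"
      by (rule weak_conv_prob_unique[OF marginals(2)[OF \<nu>] m(2)]) (rule borel_prob_marginal(2)[OF assms(4)])
    fix z w :: complex assume "z \<notin> \<real> \<and> w \<notin> \<real>"
    hence "Im z \<noteq> 0" "Im w \<noteq> 0" by (auto simp: complex_is_Real_iff)
    thus "cauchy2 \<nu> z w *
             (1 - cauchy2_weighted \<rho> (1 / cauchy (marginal1 \<nu>) z) (1 / cauchy (marginal2 \<nu>) w))
           = cauchy (marginal1 \<nu>) z * cauchy (marginal2 \<nu>) w"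
      by (rule bifree_array.limit_formula[OF array[OF marginals[OF \<nu>]] \<nu> \<rho>])
  qed
  ultimately show ?thesis unfolding fc by blast
qed

end
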